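(* Let $K$ be a field and let $\mathcal{C}$ be a generalized $X$-pentomino. Let $S=K[x_v : v\in V(\mathcal{C})]$ and let $I_{\rm adj}(\mathcal{C})\subset S$ be the ideal generated by the adjacent $2$-minors $f_C$, $C\in\mathcal{C}$. Then the Castelnuovo–Mumford regularity of the ideal is $\operatorname{reg}(I_{\rm adj}(\mathcal{C}))=|\mathcal{C}|$.
   Context: A cell is a unit square $C\subset\mathbb{R}^2$ with vertex set $V(C)=\{(i,j),(i,j+1),(i+1,j),(i+1,j+1)\}$, where $i,j$ are positive integers. For a finite collection $\mathcal{C}$ of cells put $V(\mathcal{C})=\bigcup_{C\in\mathcal{C}}V(C)$ and $S=K[x_v : v\in V(\mathcal{C})]$, a standard graded polynomial ring in $|V(\mathcal{C})|$ variables over the field $K$. To a cell $C$ with vertex set $V(C)=\{(i,j),(i,j+1),(i+1,j),(i+1,j+1)\}$ one associates the binomial $f_C=x_{(i,j)}x_{(i+1,j+1)}-x_{(i+1,j)}x_{(i,j+1)}$, and $I_{\rm adj}(\mathcal{C})=(f_C : C\in\mathcal{C})\subset S$. An $X$-pentomino is a collection of five cells consisting of one cell together with the four cells sharing an edge with it. A row of cells is the collection of all cells with vertices $(i,j),(i,j+1),(i+1,j),(i+1,j+1)$ for $p\le i<q$, with $j$ and $p<q$ fixed (so its vertex set is $\{(i,j),(i,j+1): p\le i\le q\}$); a column of cells is defined in the same way with the two coordinates interchanged (its vertex set is $\{(i,j),(i+1,j): p\le j\le q\}$ with $i$ fixed). A generalized $X$-pentomino is a collection of cells of the form $\mathcal{C}=\mathcal{C}'\cup\mathcal{C}''$,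 where $\mathcal{C}'$ is a row of cells and $\mathcal{C}''$ is a column of cells, such that $\mathcal{C}$ contains an $X$-pentomino. The regularity of the graded $S$-module $I$ is $\operatorname{reg}(I)=\max\{j-i : \beta_{i,j}(I)\neq 0\}$, where $\beta_{i,j}(I)=\dim_K\operatorname{Tor}_i^S(I,K)_j$. *)

theory Defs
  imports
    Complex_Main
    "HOL-Library.Poly_Mapping"
    "HOL-Library.Function_Algebras"
    "HOL-Algebra.Ideal"
begin

section \<open>Polynomial rings\<close>

text \<open>
  Polynomials are finitely supported maps from monomials (finitely supported exponent vectors)
  to coefficients.  The variables range over a whole type, so that \<open>K[x\<^sub>v : v \<in> V]\<close> is the subring
  of those polynomials in which only variables from \<open>V\<close> occur.
\<close>

type_synonym ('v, 'k) mpoly = "('v \<Rightarrow>\<^sub>0 nat) \<Rightarrow>\<^sub>0 'k"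

definition Var :: "'v \<Rightarrow> ('v, 'k::field) mpoly"
  where "Var v = Poly_Mapping.single (Poly_Mapping.single v 1) 1"

definition poly_ring :: "'v set \<Rightarrow> ('v, 'k::field) mpoly ring"
  where "poly_ring V =
    \<lparr>carrier = {p. \<forall>m\<in>Poly_Mapping.keys p. Poly_Mapping.keys m \<subseteq> V},
     monoid.mult = (*), one = 1, zero = 0, add = (+)\<rparr>"

definition mon_degree :: "('v \<Rightarrow>\<^sub>0 nat) \<Rightarrow> nat"
  where "mon_degree m = (\<Sum>v\<in>Poly_Mapping.keys m. Poly_Mapping.lookup m v)"

text \<open>
  The degree is an integer because it arises as a difference of degree shifts;
  the zero polynomial is homogeneous of every degree, and the only one of negative degree.
\<close>

definition homogeneous :: "int \<Rightarrow> ('v, 'k::field) mpoly \<Rightarrow> bool"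
  where "homogeneous d p \<longleftrightarrow> (\<forall>m\<in>Poly_Mapping.keys p. int (mon_degree m) = d)"

definition const_coeff :: "('v, 'k::field) mpoly \<Rightarrow> 'k"
  where "const_coeff p = Poly_Mapping.lookup p 0"

lemma cring_poly_ring: "cring (poly_ring V :: ('v, 'k::field) mpoly ring)"
proof -
  let ?S = "{p :: ('v, 'k) mpoly. \<forall>m\<in>Poly_Mapping.keys p. Poly_Mapping.keys m \<subseteq> V}"
  have add: "p + q \<in> ?S" if "p \<in> ?S" "q \<in> ?S" for p q
    using that Poly_Mapping.keys_add[of p q] by blast
  have mult: "p * q \<in> ?S" if "p \<in> ?S" "q \<in> ?S" for p q
  proof -
    have "Poly_Mapping.keys m \<subseteq> V" if m: "m \<in> Poly_Mapping.keys (p * q)" for m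
    proof -
      obtain a b where "m = a + b" "a \<in> Poly_Mapping.keys p" "b \<in> Poly_Mapping.keys q"
        using subsetD[OF keys_mult m] by blast
      then show ?thesis
        using \<open>p \<in> ?S\<close> \<open>q \<in> ?S\<close> Poly_Mapping.keys_add[of a b] by blast
    qed
    then show ?thesis by blast
  qed
  have uminus: "\<exists>q\<in>?S. q + p = 0" if "p \<in> ?S" for p
    using that by (intro bexI[of _ "- p"]) simp_all
  have zero: "0 \<in> ?S" and one: "1 \<in> ?S"
    by simp_all
  have sel: "carrier (poly_ring V) = ?S" "x \<otimes>\<^bsub>poly_ring V\<^esub> y = x * y" "\<one>\<^bsub>poly_ring V\<^esub> = 1"
      "\<zero>\<^bsub>poly_ring V\<^esub> = 0" "x \<oplus>\<^bsub>poly_ring V\<^esub> y = x + y" for x y :: "('v, 'k) mpoly"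
    by (simp_all add: poly_ring_def)
  show ?thesis
  proof (rule cringI)
    show "abelian_group (poly_ring V :: ('v, 'k) mpoly ring)"
      by (rule abelian_groupI; unfold sel)
        (fact add zero uminus | rule add.assoc add.commute add_0_left)+
    show "comm_monoid (poly_ring V :: ('v, 'k) mpoly ring)"
      by (rule comm_monoidI; unfold sel)
        (fact mult one | rule mult.assoc mult.commute mult_1_left)+
  qed (unfold sel, rule distrib_right)
qed


section \<open>Graded free resolutions, Tor and regularity\<close>

text \<open>
  A complex \<open>\<dots> \<rightarrow> F\<^sub>1 \<rightarrow> F\<^sub>0 \<rightarrow> I\<close> of graded free modules of finite rank.  The module \<open>F\<^sub>i\<close> is
  the direct sum of the \<open>S(-d)\<close>, \<open>d\<close> ranging over the list \<open>shifts F i\<close>; thus the \<open>k\<close>-th basis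
  element of \<open>F\<^sub>i\<close> has degree \<open>shifts F i ! k\<close>.  The column \<open>\<lambda>k. diff F i k l\<close> is the image in \<open>F\<^sub>i\<close>
  of the \<open>l\<close>-th basis element of \<open>F\<^sub>(\<^sub>i\<^sub>+\<^sub>1\<^sub>)\<close>, and \<open>aug F k\<close> is the image in \<open>I\<close> of the \<open>k\<close>-th basis
  element of \<open>F\<^sub>0\<close>.
\<close>

record 'p free_complex =
  shifts :: "nat \<Rightarrow> int list"
  diff :: "nat \<Rightarrow> nat \<Rightarrow> nat \<Rightarrow> 'p"
  aug :: "nat \<Rightarrow> 'p"

definition rank :: "('v, 'k::field) mpoly free_complex \<Rightarrow> nat \<Rightarrow> nat"
  where "rank F i = length (shifts F i)"

definition free_mod :: "'v set \<Rightarrow> ('v, 'k::field) mpoly free_complex \<Rightarrow> nat \<Rightarrow> (nat \<Rightarrow> ('v, 'k) mpoly) set"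
  where "free_mod V F i =
    {u. (\<forall>k<rank F i. u k \<in> carrier (poly_ring V)) \<and> (\<forall>k\<ge>rank F i. u k = 0)}"

definition differential ::
    "('v, 'k::field) mpoly free_complex \<Rightarrow> nat \<Rightarrow> (nat \<Rightarrow> ('v, 'k) mpoly) \<Rightarrow> nat \<Rightarrow> ('v, 'k) mpoly"
  where "differential F i u =
    (\<lambda>k. if k < rank F i then \<Sum>l<rank F (Suc i). diff F i k l * u l else 0)"

definition augmentation ::
    "('v, 'k::field) mpoly free_complex \<Rightarrow> (nat \<Rightarrow> ('v, 'k) mpoly) \<Rightarrow> ('v, 'k) mpoly"
  where "augmentation F u = (\<Sum>k<rank F 0. aug F k * u k)"

definition graded_free_resolution ::
    "'v set \<Rightarrow> ('v, 'k::field) mpoly set \<Rightarrow> ('v, 'k) mpoly free_complex \<Rightarrow> bool"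
  where "graded_free_resolution V I F \<longleftrightarrow>
    (\<forall>k<rank F 0. aug F k \<in> carrier (poly_ring V) \<and> homogeneous (shifts F 0 ! k) (aug F k)) \<and>
    (\<forall>i. \<forall>k<rank F i. \<forall>l<rank F (Suc i).
       diff F i k l \<in> carrier (poly_ring V) \<and>
       homogeneous (shifts F (Suc i) ! l - shifts F i ! k) (diff F i k l)) \<and>
    augmentation F ` free_mod V F 0 = I \<and>
    {u \<in> free_mod V F 0. augmentation F u = 0} = differential F 0 ` free_mod V F (Suc 0) \<and>
    (\<forall>i. {u \<in> free_mod V F (Suc i). differential F i u = 0} =
         differential F (Suc i) ` free_mod V F (Suc (Suc i)))"

text \<open>
  The complex \<open>F \<otimes>\<^sub>S K\<close>, where \<open>K = S/(x\<^sub>v : v \<in> V)\<close>: the free module of rank \<open>r\<close> becomes \<open>K\<^sup>r\<close>, and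
  the entries of the differentials are replaced by their constant coefficients.
  \<open>tensor_comp F i j\<close> is the degree \<open>j\<close> component of \<open>F\<^sub>i \<otimes>\<^sub>S K\<close>.
\<close>

definition tensor_comp :: "('v, 'k::field) mpoly free_complex \<Rightarrow> nat \<Rightarrow> int \<Rightarrow> (nat \<Rightarrow> 'k) set"
  where "tensor_comp F i j = {w. \<forall>k. w k \<noteq> 0 \<longrightarrow> k < rank F i \<and> shifts F i ! k = j}"

definition tensor_differential ::
    "('v, 'k::field) mpoly free_complex \<Rightarrow> nat \<Rightarrow> (nat \<Rightarrow> 'k) \<Rightarrow> nat \<Rightarrow> 'k"
  where "tensor_differential F i w =
    (\<lambda>k. if k < rank F i then \<Sum>l<rank F (Suc i). const_coeff (diff F i k l) * w l else 0)"

definition tensor_cycles :: "('v, 'k::field) mpoly free_complex \<Rightarrow> nat \<Rightarrow> int \<Rightarrow> (nat \<Rightarrow> 'k) set"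
  where "tensor_cycles F i j =
    (case i of 0 \<Rightarrow> tensor_comp F 0 j
     | Suc n \<Rightarrow> {w \<in> tensor_comp F (Suc n) j. tensor_differential F n w = 0})"

definition tensor_boundaries :: "('v, 'k::field) mpoly free_complex \<Rightarrow> nat \<Rightarrow> int \<Rightarrow> (nat \<Rightarrow> 'k) set"
  where "tensor_boundaries F i j = tensor_differential F i ` tensor_comp F (Suc i) j"

definition scale_fun :: "'k::field \<Rightarrow> (nat \<Rightarrow> 'k) \<Rightarrow> nat \<Rightarrow> 'k"
  where "scale_fun c w = (\<lambda>k. c * w k)"

lemma vector_space_scale_fun: "vector_space (scale_fun :: 'k::field \<Rightarrow> _)"
  by unfold_locales (auto simp: scale_fun_def fun_eq_iff algebra_simps)

text \<open>
  The dimension of the homology of \<open>F \<otimes>\<^sub>S K\<close> at \<open>F\<^sub>i\<close> in degree \<open>j\<close>.  If \<open>F\<close> is a resolution, then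
  the boundaries form a subspace of the finite-dimensional space of cycles, so the truncated
  subtraction gives the dimension of the quotient.
\<close>

definition tensor_homology_dim :: "('v, 'k::field) mpoly free_complex \<Rightarrow> nat \<Rightarrow> int \<Rightarrow> nat"
  where "tensor_homology_dim F i j =
    vector_space.dim scale_fun (tensor_cycles F i j) -
    vector_space.dim scale_fun (tensor_boundaries F i j)"

text \<open>
  \<open>betti V I i j\<close> is the dimension of \<open>Tor\<^sub>i(I, K)\<^sub>j\<close> over \<open>K[x\<^sub>v : v \<in> V]\<close>, for \<open>V\<close> finite and \<open>I\<close> a
  homogeneous ideal.  Then a resolution by free modules of finite rank exists, as the ring is
  Noetherian, and the value does not depend on the resolution that is chosen.
\<close>

definition betti :: "'v set \<Rightarrow> ('v, 'k::field) mpoly set \<Rightarrow> nat \<Rightarrow> int \<Rightarrow> nat"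
  where "betti V I i j = tensor_homology_dim (SOME F. graded_free_resolution V I F) i j"

definition regularity :: "'v set \<Rightarrow> ('v, 'k::field) mpoly set \<Rightarrow> int"
  where "regularity V I = Max {j - int i | i j. betti V I i j \<noteq> 0}"


section \<open>Collections of cells\<close>

text \<open>A cell is represented by its lower left corner \<open>(i, j)\<close>, where \<open>i\<close> and \<open>j\<close> are positive.\<close>

type_synonym cell = "nat \<times> nat"

fun cell_vertices :: "cell \<Rightarrow> (nat \<times> nat) set"
  where "cell_vertices (i, j) = {(i, j), (i, j + 1), (i + 1, j), (i + 1, j + 1)}"

definition vertices :: "cell set \<Rightarrow> (nat \<times> nat) set"
  where "vertices \<C> = (\<Union>C\<in>\<C>. cell_vertices C)"

fun cell_binomial :: "cell \<Rightarrow> (nat \<times> nat, 'k::field) mpoly"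
  where "cell_binomial (i, j) =
    Var (i, j) * Var (i + 1, j + 1) - Var (i + 1, j) * Var (i, j + 1)"

definition adj_ideal :: "cell set \<Rightarrow> (nat \<times> nat, 'k::field) mpoly set"
  where "adj_ideal \<C> = genideal (poly_ring (vertices \<C>)) (cell_binomial ` \<C>)"

definition X_pentomino :: "cell set \<Rightarrow> bool"
  where "X_pentomino P \<longleftrightarrow>
    (\<exists>i>1. \<exists>j>1. P = {(i, j), (i - 1, j), (i + 1, j), (i, j - 1), (i, j + 1)})"

definition row_of_cells :: "cell set \<Rightarrow> bool"
  where "row_of_cells R \<longleftrightarrow> (\<exists>p q j. 1 \<le> p \<and> p < q \<and> 1 \<le> j \<and> R = {(i, j) | i. p \<le> i \<and> i < q})"

definition column_of_cells :: "cell set \<Rightarrow> bool"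
  where "column_of_cells R \<longleftrightarrow> (\<exists>p q i. 1 \<le> p \<and> p < q \<and> 1 \<le> i \<and> R = {(i, j) | j. p \<le> j \<and> j < q})"

definition generalized_X_pentomino :: "cell set \<Rightarrow> bool"
  where "generalized_X_pentomino \<C> \<longleftrightarrow>
    (\<exists>R T. row_of_cells R \<and> column_of_cells T \<and> \<C> = R \<union> T) \<and> (\<exists>P\<subseteq>\<C>. X_pentomino P)"

end

theory Submission
  imports Defs "HOL-Library.Multiset"
begin

text \<open>
  Number the vertices of the central cell cyclically \<open>y\<^sub>0, \<dots>, y\<^sub>3\<close>.  The cells adjacent to it give quadrics
  \<open>f\<^sub>e = y\<^sub>e v\<^sub>e - y\<^sub>e\<^sub>+\<^sub>1 u\<^sub>e\<close>, linear in \<open>y\<close>, with determinant \<open>\<Delta> = v\<^sub>0v\<^sub>1v\<^sub>2v\<^sub>3 - u\<^sub>0u\<^sub>1u\<^sub>2u\<^sub>3\<close>; the central binomial is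
  \<open>c = y\<^sub>1y\<^sub>3 - y\<^sub>0y\<^sub>2\<close>.  For \<open>J = (f\<^sub>0, \<dots>, f\<^sub>3)\<close> one has \<open>J : \<Delta> = (y\<^sub>0, \<dots>, y\<^sub>3)\<close> and \<open>J : c = J + (\<Delta>)\<close>, so two
  mapping cones over Koszul complexes resolve \<open>S/(J + (c))\<close>.  All summands have the expected regularity
  except two in the top degrees, and these cancel.  Each further cell \<open>g\<close> is regular modulo \<open>J + (c)\<close> and
  the previous ones: the formula for the colon ideal persists after enlarging \<open>J\<close> by minors of the arms,
  and if \<open>g p \<in> J + (c)\<close> it may be applied to \<open>J + (g)\<close>.  Hence each further cell raises the regularity by \<open>1\<close>.

  All colon ideals are computed with three rules for an element regular modulo a finitely generated
  ideal: new variables are regular, a binomial is regular if its initial term is (with respect to a weight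
  for which the ideal is homogeneous), and regular sequences of length two may be swapped.
\<close>


section \<open>Selecting monomials\<close>

text \<open>The Betti numbers in the statement belong to an arbitrarily chosen resolution, and the
  resolution constructed here is not minimal. Hence the argument speaks only of the vanishing of
  single graded pieces of Tor, which any two resolutions share because their comparison maps are
  inverse to each other up to homotopy.

  The easy halves of both colon formulas come from Cramer's rule: \<open>\<Delta>\<close> times each
  \<open>y_e\<close> lies in \<open>J\<close>, and since \<open>c\<close> lies in
  \<open>(y_0, ..., y_3)\<close>, so does \<open>\<Delta> * c\<close>. The hard half is that each
  \<open>y_e\<close> stays regular modulo \<open>J + (\<Delta>)\<close>. For \<open>y_3\<close> this
  means solving the relations between \<open>f_2\<close> and \<open>f_3\<close> modulo
  \<open>y_3\<close> explicitly; besides the trivial relation there is exactly one, and it is the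
  source of \<open>\<Delta>\<close>. Rotation gives the other corners, and the initial term of
  \<open>c\<close> is a product of two corners.

  The regularity computed first is that of the quotient ring: 4 for the X-pentomino itself, realised
  by the product of \<open>f_0, ..., f_3\<close> in position 4 and degree 8. Passing to the ideal
  adds 1, which gives the number of cells.\<close>

lift_definition select :: "('a \<Rightarrow> bool) \<Rightarrow> ('a \<Rightarrow>\<^sub>0 'b::zero) \<Rightarrow> 'a \<Rightarrow>\<^sub>0 'b"
  is "\<lambda>P f a. if P a then f a else 0"
  by (erule rev_finite_subset) (auto split: if_splits)

lemma keys_select: "Poly_Mapping.keys (select P p) = {m \<in> Poly_Mapping.keys p. P m}"
  by (auto simp: in_keys_iff select.rep_eq split: if_splits)

lemma select_add: "select P (p + q) = select P p + select P (q :: 'a \<Rightarrow>\<^sub>0 'b::monoid_add)"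
  by (rule poly_mapping_eqI) (simp add: select.rep_eq lookup_add)

lemma select_zero [simp]: "select P 0 = 0"
  by (rule poly_mapping_eqI) (simp add: select.rep_eq)

lemma select_diff: "select P (p - q) = select P p - select P (q :: 'a \<Rightarrow>\<^sub>0 'b::ab_group_add)"
  by (rule poly_mapping_eqI) (simp add: select.rep_eq lookup_minus)

lemma select_sum: "select P (\<Sum>x\<in>A. f x) = (\<Sum>x\<in>A. select P (f x :: 'a \<Rightarrow>\<^sub>0 'b::comm_monoid_add))"
  by (induction A rule: infinite_finite_induct) (auto simp: select_add)

lemma select_id: "(\<And>m. m \<in> Poly_Mapping.keys p \<Longrightarrow> P m) \<Longrightarrow> select P p = p"
  by (rule poly_mapping_eqI) (auto simp: select.rep_eq in_keys_iff)

lemma select_none: "(\<And>m. m \<in> Poly_Mapping.keys p \<Longrightarrow> \<not> P m) \<Longrightarrow> select P p = 0"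
  by (rule poly_mapping_eqI) (auto simp: select.rep_eq in_keys_iff)

lemma poly_mapping_sum_single:
  "p = (\<Sum>m\<in>Poly_Mapping.keys p. Poly_Mapping.single m (Poly_Mapping.lookup p m))"
  by (rule poly_mapping_eqI)
    (auto simp: lookup_sum lookup_single when_def sum.delta in_keys_iff)

lemma poly_mapping_add_induct [case_names zero single add]:
  assumes "P 0" "\<And>m c. P (Poly_Mapping.single m c)" "\<And>p q. P p \<Longrightarrow> P q \<Longrightarrow> P (p + q)"
  shows "P (p :: 'a \<Rightarrow>\<^sub>0 'b::comm_monoid_add)"
proof -
  have "P (\<Sum>m\<in>A. Poly_Mapping.single m (Poly_Mapping.lookup p m))" for A
    by (induction A rule: infinite_finite_induct) (auto intro: assms)
  then show ?thesis
    by (metis poly_mapping_sum_single)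
qed

text \<open>If adding any monomial of \<open>g\<close> turns \<open>P'\<close> exactly into
  \<open>P\<close>, no term can enter or leave the selection. Used for monomials divisible by a
  variable, monomials of one weight, and monomials in the variables of \<open>V\<close>.\<close>

lemma select_mult:
  fixes g :: "'a::monoid_add \<Rightarrow>\<^sub>0 'b::semiring_0"
  assumes "\<And>m b. b \<in> Poly_Mapping.keys g \<Longrightarrow> P (m + b) \<longleftrightarrow> P' m"
  shows "select P (c * g) = select P' c * g"
proof (induction c rule: poly_mapping_add_induct)
  case (single m x)
  have keys: "\<exists>b\<in>Poly_Mapping.keys g. k = m + b"
    if "k \<in> Poly_Mapping.keys (Poly_Mapping.single m x * g)" for k
    using subsetD[OF keys_mult that] by (auto split: if_splits)
  show ?case
  proof (cases "P' m")
    case True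
    have "select P (Poly_Mapping.single m x * g) = Poly_Mapping.single m x * g"
      using keys assms True by (intro select_id) blast
    moreover have "select P' (Poly_Mapping.single m x) = Poly_Mapping.single m x"
      using True by (intro select_id) (auto split: if_splits)
    ultimately show ?thesis by simp
  next
    case False
    have "select P (Poly_Mapping.single m x * g) = 0"
      using keys assms False by (intro select_none) blast
    moreover have "select P' (Poly_Mapping.single m x) = 0"
      using False by (intro select_none) (auto split: if_splits)
    ultimately show ?thesis by simp
  qed
qed (simp_all add: select_add distrib_right)

lemma lookup_monomial_mult:
  fixes p :: "'a::cancel_comm_monoid_add \<Rightarrow>\<^sub>0 'b::semiring_1"
  shows "Poly_Mapping.lookup (Poly_Mapping.single a 1 * p) (a + m) = Poly_Mapping.lookup p m"
  by (induction p rule: poly_mapping_add_induct)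
    (auto simp: mult_single lookup_single when_def lookup_add distrib_left)

lemma keys_plus_nat:
  "Poly_Mapping.keys (a + b :: 'v \<Rightarrow>\<^sub>0 nat) = Poly_Mapping.keys a \<union> Poly_Mapping.keys b"
  by (auto simp: in_keys_iff lookup_add)


section \<open>Weights\<close>

definition weight :: "('v \<Rightarrow> nat) \<Rightarrow> ('v \<Rightarrow>\<^sub>0 nat) \<Rightarrow> nat"
  where "weight w m = (\<Sum>v\<in>Poly_Mapping.keys m. Poly_Mapping.lookup m v * w v)"

lemma weight_superset:
  assumes "finite A" "Poly_Mapping.keys m \<subseteq> A"
  shows "weight w m = (\<Sum>v\<in>A. Poly_Mapping.lookup m v * w v)"
  unfolding weight_def using assms
  by (intro sum.mono_neutral_left) (auto simp: in_keys_iff)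

lemma weight_add: "weight w (a + b) = weight w a + weight w b"
proof -
  let ?A = "Poly_Mapping.keys a \<union> Poly_Mapping.keys b"
  have "weight w (a + b) = (\<Sum>v\<in>?A. Poly_Mapping.lookup (a + b) v * w v)"
    by (rule weight_superset) (auto simp: keys_plus_nat)
  also have "\<dots> = weight w a + weight w b"
    by (subst (1 2) weight_superset[where A = ?A])
      (auto simp: lookup_add distrib_right sum.distrib)
  finally show ?thesis .
qed

lemma weight_single [simp]: "weight w (Poly_Mapping.single v n) = n * w v"
  by (simp add: weight_def)

lemma weight_zero [simp]: "weight w 0 = 0"
  by (simp add: weight_def)

definition unit_weight :: "'v \<Rightarrow> nat"
  where "unit_weight v = 1"

lemma mon_degree_weight: "mon_degree = weight unit_weight"
  by (simp add: fun_eq_iff mon_degree_def weight_def unit_weight_def)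

definition whom :: "('v \<Rightarrow> nat) \<Rightarrow> int \<Rightarrow> ('v, 'k::field) mpoly \<Rightarrow> bool"
  where "whom w d p \<longleftrightarrow> (\<forall>m\<in>Poly_Mapping.keys p. int (weight w m) = d)"

lemma homogeneous_whom: "homogeneous = whom unit_weight"
  by (simp add: fun_eq_iff homogeneous_def whom_def mon_degree_weight)

definition wcomp :: "('v \<Rightarrow> nat) \<Rightarrow> int \<Rightarrow> ('v, 'k::field) mpoly \<Rightarrow> ('v, 'k) mpoly"
  where "wcomp w d = select (\<lambda>m. int (weight w m) = d)"

lemma whom_wcomp [simp]: "whom w d (wcomp w d p)"
  by (auto simp: whom_def wcomp_def keys_select)

lemma wcomp_whom: "whom w d p \<Longrightarrow> wcomp w e p = (if e = d then p else 0)"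
  by (auto simp: whom_def wcomp_def intro!: select_id select_none)

lemma wcomp_mult:
  assumes "whom w e f"
  shows "wcomp w d (x * f) = wcomp w (d - e) x * f"
  unfolding wcomp_def using assms
  by (intro select_mult) (auto simp: whom_def weight_add)

lemma wcomp_add: "wcomp w d (p + q) = wcomp w d p + wcomp w d q"
  by (simp add: wcomp_def select_add)

lemma wcomp_zero [simp]: "wcomp w d 0 = 0"
  by (simp add: wcomp_def)

lemma wcomp_sum: "wcomp w d (\<Sum>x\<in>A. f x) = (\<Sum>x\<in>A. wcomp w d (f x))"
  by (simp add: wcomp_def select_sum)

lemma sum_wcomp:
  assumes "\<And>m. m \<in> Poly_Mapping.keys p \<Longrightarrow> weight w m < n"
  shows "(\<Sum>d<n. wcomp w (int d) p) = p"
proof (rule poly_mapping_eqI)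
  fix m
  show "Poly_Mapping.lookup (\<Sum>d<n. wcomp w (int d) p) m = Poly_Mapping.lookup p m"
    using assms[of m]
    by (cases "m \<in> Poly_Mapping.keys p")
      (auto simp: lookup_sum wcomp_def select.rep_eq in_keys_iff)
qed

lemma whom_zero [simp]: "whom w d 0"
  by (simp add: whom_def)

lemma whom_add: "whom w d p \<Longrightarrow> whom w d q \<Longrightarrow> whom w d (p + q)"
  unfolding whom_def using Poly_Mapping.keys_add[of p q] by blast

lemma whom_uminus: "whom w d p \<Longrightarrow> whom w d (- p)"
  unfolding whom_def by simp

lemma whom_diff: "whom w d p \<Longrightarrow> whom w d q \<Longrightarrow> whom w d (p - q)"
  using whom_add[of w d p "- q"] whom_uminus[of w d q] by simp

lemma whom_mult: "whom w d p \<Longrightarrow> whom w e q \<Longrightarrow> whom w (d + e) (p * q)"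
  unfolding whom_def using keys_mult[of p q] by (fastforce simp: weight_add)

lemma whom_one [simp]: "whom w 0 1"
  by (simp add: whom_def)

lemma whom_Var: "int (w v) = d \<Longrightarrow> whom w d (Var v)"
  by (simp add: whom_def Var_def)

lemma whom_sum: "(\<And>x. x \<in> A \<Longrightarrow> whom w d (f x)) \<Longrightarrow> whom w d (\<Sum>x\<in>A. f x)"
  by (induction A rule: infinite_finite_induct) (auto intro: whom_add)


section \<open>Ideals and elements regular modulo an ideal\<close>

text \<open>The subspaces of a commutative ring over itself are its ideals, so \<open>span\<close>
  is ideal generation, here in the ring of polynomials in all variables of the type.\<close>

interpretation ideal: module "(*) :: 'a::comm_ring_1 \<Rightarrow> 'a \<Rightarrow> 'a"
  by unfold_locales (simp_all add: algebra_simps)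

declare ideal.scale_scale [simp del]

abbreviation ispan :: "'a::comm_ring_1 set \<Rightarrow> 'a set"
  where "ispan \<equiv> ideal.span"

text \<open>A nonzerodivisor on the quotient by the ideal \<open>(B)\<close>; that quotient may be
  zero.\<close>

definition nzd :: "'a::comm_ring_1 set \<Rightarrow> 'a \<Rightarrow> bool"
  where "nzd B f \<longleftrightarrow> (\<forall>x. f * x \<in> ispan B \<longrightarrow> x \<in> ispan B)"

lemma nzdD: "nzd B f \<Longrightarrow> f * x \<in> ispan B \<Longrightarrow> x \<in> ispan B"
  by (simp add: nzd_def)

lemma ispan_mult_base: "x \<in> B \<Longrightarrow> c * x \<in> ispan B"
  by (intro ideal.span_scale ideal.span_base)

lemma ispan_scale2: "x \<in> ispan B \<Longrightarrow> x * c \<in> ispan B"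
  using ideal.span_scale[of x B c] by (simp add: mult.commute)

lemma ispan_insertI: "x - k * a \<in> ispan B \<Longrightarrow> x \<in> ispan (insert a B)"
  by (auto simp: ideal.span_insert)

lemma ispan_insertE:
  assumes "x \<in> ispan (insert a B)"
  obtains k j where "x = j + k * a" "j \<in> ispan B"
  using assms by (auto simp: ideal.span_insert) (metis diff_add_cancel)

lemma nzd_mult: "nzd B f \<Longrightarrow> nzd B g \<Longrightarrow> nzd B (f * g)"
  unfolding nzd_def mult.assoc by blast

lemma nzd_cong_ispan: "ispan B = ispan B' \<Longrightarrow> nzd B f \<Longrightarrow> nzd B' f"
  by (simp add: nzd_def)

lemma nzd_cong:
  assumes "nzd B f" "f - g \<in> ispan B"
  shows "nzd B g"
  unfolding nzd_def
proof (intro allI impI)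
  fix x
  assume "g * x \<in> ispan B"
  then have "(f - g) * x + g * x \<in> ispan B"
    by (rule ideal.span_add[OF ispan_scale2[OF assms(2)]])
  then show "x \<in> ispan B"
    using assms(1) by (simp add: nzd_def algebra_simps)
qed

lemma nzd_uminus: "nzd B f \<Longrightarrow> nzd B (- f)"
  unfolding nzd_def using ideal.span_neg by fastforce

text \<open>A relation \<open>g x = j + k f\<close> puts \<open>f k\<close> into
  \<open>(B, g)\<close>, hence \<open>k = j' + l g\<close>. Then \<open>g (x - l f)\<close> lies in
  \<open>(B)\<close>, and \<open>g\<close> cancels.\<close>

lemma nzd_swap:
  assumes "nzd B g" "nzd (insert g B) f"
  shows "nzd (insert f B) g"
  unfolding nzd_def
proof (intro allI impI)
  fix x
  assume "g * x \<in> ispan (insert f B)"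
  then obtain k j where 1: "g * x = j + k * f" "j \<in> ispan B"
    by (rule ispan_insertE)
  then have "f * k - x * g \<in> ispan B"
    using ideal.span_neg[of j B] by (simp add: algebra_simps)
  then have "k \<in> ispan (insert g B)"
    using assms(2) by (auto simp: nzd_def intro: ispan_insertI)
  then obtain l j' where 2: "k = j' + l * g" "j' \<in> ispan B"
    by (rule ispan_insertE)
  have "g * (x - l * f) = g * x - l * g * f"
    by (simp add: algebra_simps)
  also have "\<dots> = j + (j' + l * g) * f - l * g * f"
    unfolding 1(1) 2(1) ..
  also have "\<dots> = j + f * j'"
    by (simp add: algebra_simps)
  also have "\<dots> \<in> ispan B"
    using 1 2 by (intro ideal.span_add ideal.span_scale)
  finally show "x \<in> ispan (insert f B)"
    using assms(1) by (auto simp: nzd_def intro: ispan_insertI)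
qed

section \<open>Regularity of new variables and of polynomials with a regular initial term\<close>

definition vars :: "('v, 'k::field) mpoly \<Rightarrow> 'v set"
  where "vars p = (\<Union>m\<in>Poly_Mapping.keys p. Poly_Mapping.keys m)"

lemma vars_Var [simp]: "vars (Var v) = {v}"
  by (simp add: vars_def Var_def)

lemma vars_mult: "vars (p * q) \<subseteq> vars p \<union> vars q"
  unfolding vars_def using keys_mult[of p q] by (fastforce simp: keys_plus_nat)

lemma vars_add: "vars (p + q) \<subseteq> vars p \<union> vars q"
  unfolding vars_def using Poly_Mapping.keys_add[of p q] by blast

lemma vars_uminus [simp]: "vars (- p) = vars p"
  by (simp add: vars_def)

lemma vars_diff: "vars (p - q) \<subseteq> vars p \<union> vars q"
  using vars_add[of p "- q"] by simp

lemma Var_mult_cancel: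
  fixes x :: "('v, 'k::field) mpoly"
  assumes "Var v * x = Var v * y"
  shows "x = y"
proof (rule poly_mapping_eqI)
  fix m
  show "Poly_Mapping.lookup x m = Poly_Mapping.lookup y m"
    using arg_cong[OF assms, of "\<lambda>p. Poly_Mapping.lookup p (Poly_Mapping.single v 1 + m)"]
    unfolding Var_def lookup_monomial_mult .
qed

lemma select_var_dvd: "\<exists>p'. select (\<lambda>m. v \<in> Poly_Mapping.keys m) p = Var v * (p' :: ('v, 'k::field) mpoly)"
proof (induction p rule: poly_mapping_add_induct)
  case (single m c)
  show ?case
  proof (cases "v \<in> Poly_Mapping.keys m")
    case True
    have "m = Poly_Mapping.single v 1 + (m - Poly_Mapping.single v 1)"
      using True by (intro poly_mapping_eqI) (auto simp: lookup_add lookup_minus lookup_single when_def in_keys_iff)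
    then have "Poly_Mapping.single m c = Var v * Poly_Mapping.single (m - Poly_Mapping.single v 1) c"
      unfolding Var_def mult_single by simp
    moreover have "select (\<lambda>m. v \<in> Poly_Mapping.keys m) (Poly_Mapping.single m c) = Poly_Mapping.single m c"
      using True by (intro select_id) (auto split: if_splits)
    ultimately show ?thesis by metis
  next
    case False
    then have "select (\<lambda>m. v \<in> Poly_Mapping.keys m) (Poly_Mapping.single m c) = 0"
      by (intro select_none) (auto split: if_splits)
    then show ?thesis by (metis mult_zero_right)
  qed
qed (auto simp: select_add intro: exI[of _ 0], metis distrib_left)

text \<open>Because \<open>v\<close> does not occur in \<open>B\<close>, selecting the terms
  divisible by \<open>v\<close> from a member of \<open>(B)\<close> leaves \<open>v\<close> times a
  member. For \<open>v * x\<close> nothing is lost by selecting, and \<open>v\<close>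
  cancels.\<close>

lemma nzd_Var:
  fixes B :: "('v, 'k::field) mpoly set"
  assumes "\<And>g. g \<in> B \<Longrightarrow> v \<notin> vars g"
  shows "nzd B (Var v)"
  unfolding nzd_def
proof (intro allI impI)
  fix x
  let ?sel = "select (\<lambda>m. v \<in> Poly_Mapping.keys m)"
  have "\<exists>p'\<in>ispan B. ?sel p = Var v * p'" if "p \<in> ispan B" for p
    using that
  proof (induction rule: ideal.span_induct_alt)
    case base
    then show ?case by (intro bexI[of _ 0]) (auto simp: ideal.span_zero)
  next
    case (step c g p)
    then obtain p' where p': "p' \<in> ispan B" "?sel p = Var v * p'" by blast
    obtain c' where c': "?sel c = Var v * c'" using select_var_dvd[of v c] by (elim exE)
    have "?sel (c * g) = ?sel c * g"
      using assms[OF step(1)] by (intro select_mult) (auto simp: keys_plus_nat vars_def)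
    then have "?sel (c * g + p) = Var v * (c' * g + p')"
      by (simp only: select_add p' c' distrib_left mult.assoc)
    moreover have "c' * g + p' \<in> ispan B"
      using p'(1) step(1) by (intro ideal.span_add ispan_mult_base)
    ultimately show ?case by blast
  qed
  moreover assume "Var v * x \<in> ispan B"
  moreover have "?sel (Var v * x) = Var v * x"
  proof (rule select_id)
    fix m assume "m \<in> Poly_Mapping.keys (Var v * x)"
    then have "m \<in> {a + b |a b. a \<in> Poly_Mapping.keys (Var v :: ('v, 'k) mpoly) \<and> b \<in> Poly_Mapping.keys x}"
      using keys_mult by blast
    then show "v \<in> Poly_Mapping.keys m"
      by (auto simp: Var_def keys_plus_nat)
  qed
  ultimately show "x \<in> ispan B"
    by (metis Var_mult_cancel)
qed

lemma ispan_wcomp: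
  assumes "\<And>g. g \<in> B \<Longrightarrow> \<exists>d. whom w d g" "p \<in> ispan B"
  shows "wcomp w e p \<in> ispan B"
  using assms(2)
proof (induction rule: ideal.span_induct_alt)
  case (step c g p)
  obtain d where "whom w d g" using assms(1) step(1) by blast
  then show ?case
    using step by (auto simp: wcomp_add wcomp_mult intro!: ideal.span_add ispan_mult_base)
qed (auto simp: ideal.span_zero)

text \<open>The ideal is graded by \<open>w\<close>, so the relation splits into components:
  \<open>f\<close> times the component of \<open>x\<close> of weight \<open>k\<close> is determined
  by the component of higher weight \<open>k + (d - e)\<close>. Descending induction from the top
  weight therefore puts all components of \<open>x\<close> into \<open>(B)\<close>.\<close>

lemma nzd_initial:
  assumes B: "\<And>g. g \<in> B \<Longrightarrow> \<exists>d. whom w d g"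
    and f: "whom w d f" and h: "whom w e h" and "e < d" and nzd: "nzd B f"
  shows "nzd B (f + h)"
  unfolding nzd_def
proof (intro allI impI)
  fix x
  assume x: "(f + h) * x \<in> ispan B"
  obtain n where n: "\<And>m. m \<in> Poly_Mapping.keys x \<Longrightarrow> weight w m < n"
    using finite_imp_Sup_less[of "weight w ` Poly_Mapping.keys x" _ "Suc (Max (insert 0 (weight w ` Poly_Mapping.keys x)))"]
    by (metis Max_ge finite_imageI finite_insert finite_keys image_eqI insertCI less_Suc_eq_le)
  have comp: "f * wcomp w k x + h * wcomp w (k + (d - e)) x \<in> ispan B" for k
  proof -
    have "wcomp w (k + d) ((f + h) * x) \<in> ispan B"
      by (rule ispan_wcomp[OF B x])
    moreover have "(f + h) * x = x * f + x * h"
      by (simp add: algebra_simps)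
    moreover have "k + d - d = k" "k + d - e = k + (d - e)"
      by simp_all
    ultimately show ?thesis
      by (metis wcomp_add wcomp_mult[OF f] wcomp_mult[OF h] mult.commute)
  qed
  have high: "wcomp w k x = 0" if "k \<ge> int n" for k
    unfolding wcomp_def using n that by (intro select_none) force
  have "wcomp w k x \<in> ispan B" for k
  proof (induction "nat (int n - k)" arbitrary: k rule: less_induct)
    case less
    show ?case
    proof (cases "k \<ge> int n")
      case True
      then show ?thesis by (simp add: high ideal.span_zero)
    next
      case False
      have "wcomp w (k + (d - e)) x \<in> ispan B"
        using False \<open>e < d\<close> by (intro less) auto
      then have "f * wcomp w k x \<in> ispan B"
        using comp[of k] ideal.span_add_eq2 ideal.span_scale by blast
      then show ?thesis using nzd by (simp add: nzd_def)
    qed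
  qed
  then have "(\<Sum>d<n. wcomp w (int d) x) \<in> ispan B"
    by (intro ideal.span_sum)
  then show "x \<in> ispan B"
    using sum_wcomp[of x w n] n by simp
qed


section \<open>Chains of adjacent minors\<close>

definition fresh :: "'v \<Rightarrow> ('v, 'k::field) mpoly set \<Rightarrow> bool"
  where "fresh v B \<longleftrightarrow> (\<forall>g\<in>B. v \<notin> vars g)"

lemma fresh_simps [simp]:
  "fresh v {}" "fresh v (insert g B) \<longleftrightarrow> v \<notin> vars g \<and> fresh v B"
  "fresh v (A \<union> B) \<longleftrightarrow> fresh v A \<and> fresh v B"
  by (auto simp: fresh_def)

lemma nzd_fresh: "fresh v B \<Longrightarrow> nzd B (Var v)"
  unfolding fresh_def by (rule nzd_Var) blast

lemma weight_not_in_keys: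
  "v \<notin> Poly_Mapping.keys m \<Longrightarrow> weight (\<lambda>x. of_bool (x = v)) m = 0"
  by (auto simp: weight_def intro!: sum.neutral)

lemma whom_fresh: "v \<notin> vars g \<Longrightarrow> whom (\<lambda>x. of_bool (x = v)) 0 g"
  by (simp add: whom_def vars_def weight_not_in_keys)

text \<open>Give \<open>v\<close> weight one and all other variables weight zero; then
  \<open>h * Var v\<close> is the initial term.\<close>

lemma nzd_linear:
  assumes "nzd B h" "fresh v B" "v \<notin> vars h" "v \<notin> vars f"
  shows "nzd B (h * Var v + f)"
proof (rule nzd_initial[where w = "\<lambda>x. of_bool (x = v)" and d = 1 and e = 0])
  show "\<exists>d. whom (\<lambda>x. of_bool (x = v)) d g" if "g \<in> B" for g
    using assms(2) that by (auto simp: fresh_def intro: whom_fresh)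
  have "whom (\<lambda>x. of_bool (x = v)) (0 + 1) (h * Var v)"
    using assms by (intro whom_mult whom_fresh whom_Var) auto
  then show "whom (\<lambda>x. of_bool (x = v)) 1 (h * Var v)" by simp
  show "nzd B (h * Var v)"
    using assms by (intro nzd_mult nzd_fresh)
qed (use assms in \<open>auto intro: whom_fresh\<close>)

text \<open>Adjacent 2-minors of the matrix with two rows whose first column is
  \<open>(h1, h2)\<close> and whose further columns are the listed pairs of variables.\<close>

fun chain :: "('v, 'k::field) mpoly \<Rightarrow> ('v, 'k) mpoly \<Rightarrow> ('v \<times> 'v) list \<Rightarrow> ('v, 'k) mpoly list"
  where
    "chain h1 h2 [] = []"
  | "chain h1 h2 ((u, v) # xs) = (h1 * Var v - h2 * Var u) # chain (Var u) (Var v) xs"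

lemma chain_append:
  "xs \<noteq> [] \<Longrightarrow> chain h1 h2 (xs @ [(u, v)]) =
    chain h1 h2 xs @ [Var (fst (last xs)) * Var v - Var (snd (last xs)) * Var u]"
  by (induction h1 h2 xs rule: chain.induct) auto

definition pvars :: "('v \<times> 'v) list \<Rightarrow> 'v list"
  where "pvars xs = concat (map (\<lambda>(u, v). [u, v]) xs)"

lemma pvars_simps [simp]: "pvars [] = []" "pvars ((u, v) # xs) = u # v # pvars xs"
  "pvars (xs @ zs) = pvars xs @ pvars zs"
  by (simp_all add: pvars_def)

lemma pvars_fst_snd: "(u, v) \<in> set xs \<Longrightarrow> u \<in> set (pvars xs) \<and> v \<in> set (pvars xs)"
  by (induction xs) auto

lemma set_pvars: "set (pvars xs) = fst ` set xs \<union> snd ` set xs"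
  by (induction xs) force+

lemma distinct_pvars_fst_snd: "distinct (pvars xs) \<Longrightarrow> fst ` set xs \<inter> snd ` set xs = {}"
  by (induction xs) (force simp: set_pvars)+

lemma pvars_sides:
  assumes "distinct (pvars xs)" "(u, v) \<in> set xs"
  shows "u \<in> fst ` set xs" "u \<notin> snd ` set xs" "v \<notin> fst ` set xs" "v \<in> snd ` set xs"
  using distinct_pvars_fst_snd[OF assms(1)] assms(2) by force+

lemma vars_chain:
  "g \<in> set (chain h1 h2 xs) \<Longrightarrow> vars g \<subseteq> vars h1 \<union> vars h2 \<union> set (pvars xs)"
proof (induction h1 h2 xs rule: chain.induct)
  case (2 h1 h2 u v xs)
  have "vars (h1 * Var v - h2 * Var u) \<subseteq> vars h1 \<union> vars h2 \<union> {u, v}"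
    using vars_diff[of "h1 * Var v" "h2 * Var u"] vars_mult[of h1 "Var v"] vars_mult[of h2 "Var u"]
    by auto
  then show ?case using 2 by auto
qed auto

lemma fresh_chain [simp]:
  "z \<notin> vars h1 \<Longrightarrow> z \<notin> vars h2 \<Longrightarrow> z \<notin> set (pvars xs) \<Longrightarrow> fresh z (set (chain h1 h2 xs))"
  unfolding fresh_def using vars_chain by blast

text \<open>A weight that is constant along each of the two rows makes both terms of every minor
  equally heavy.\<close>

lemma whom_chain:
  assumes "whom w a h1" "whom w b h2"
    "\<And>u v. (u, v) \<in> set xs \<Longrightarrow> int (w u) = a \<and> int (w v) = b"
    "g \<in> set (chain h1 h2 xs)"
  shows "whom w (a + b) g"
  using assms
proof (induction h1 h2 xs rule: chain.induct)
  case (2 h1 h2 u v xs)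
  have uv: "whom w a (Var u)" "whom w b (Var v)"
    using 2(4)[of u v] by (auto intro: whom_Var)
  have "whom w (a + b) (h1 * Var v - h2 * Var u)"
    using whom_mult[OF 2(2) uv(2)] whom_mult[OF 2(3) uv(1)]
    by (intro whom_diff) (simp_all add: add.commute)
  then show ?case using 2 uv by auto
qed auto

primrec regseq :: "'a::comm_ring_1 set \<Rightarrow> 'a list \<Rightarrow> bool"
  where
    "regseq B [] \<longleftrightarrow> True"
  | "regseq B (f # fs) \<longleftrightarrow> nzd B f \<and> regseq (insert f B) fs"

lemma regseq_append:
  "regseq B (fs @ gs) \<longleftrightarrow> regseq B fs \<and> regseq (set fs \<union> B) gs"
  by (induction fs arbitrary: B) auto

lemma nzd_insert_fresh:
  assumes "nzd B h" "fresh v B" "v \<notin> vars h"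
  shows "nzd (insert (Var v) B) h"
  using assms by (intro nzd_swap[OF _ nzd_fresh]) auto

text \<open>The minor is linear in the new variable \<open>u\<close> with regular coefficient
  \<open>h2\<close>. Modulo \<open>v\<close> it is \<open>h2 * Var u\<close> up to sign, still
  regular, so a swap makes \<open>v\<close> regular modulo the minor. Thus \<open>v\<close> can take
  over the part of \<open>h2\<close> in the next column.\<close>

lemma nzd_minor:
  assumes "nzd B h2" "fresh u B" "fresh v B" "u \<notin> vars h1" "u \<notin> vars h2" "v \<notin> vars h1" "v \<notin> vars h2" "u \<noteq> v"
  shows "nzd B (h1 * Var v - h2 * Var u)"
    and "nzd (insert (h1 * Var v - h2 * Var u) B) (Var v)"
proof -
  have "u \<notin> vars (h1 * Var v)"
    using assms vars_mult[of h1 "Var v"] by auto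
  then have "nzd B (- (h2 * Var u + (- (h1 * Var v))))"
    using assms by (intro nzd_uminus nzd_linear) auto
  then show "nzd B (h1 * Var v - h2 * Var u)"
    by simp
  have "nzd (insert (Var v) B) (h2 * Var u)"
    using assms by (intro nzd_mult nzd_insert_fresh nzd_fresh) auto
  then have "nzd (insert (Var v) B) (h1 * Var v - h2 * Var u)"
    by (rule nzd_cong[OF nzd_uminus])
      (simp add: ispan_mult_base ideal.span_neg)
  then show "nzd (insert (h1 * Var v - h2 * Var u) B) (Var v)"
    using assms by (intro nzd_swap[OF nzd_fresh]) auto
qed

text \<open>The induction carries along that the lower entry of the current column is regular modulo
  everything adjoined so far.\<close>

lemma regseq_chain:
  assumes "nzd B h2" "distinct (pvars xs)"
    "\<And>z. z \<in> set (pvars xs) \<Longrightarrow> fresh z (insert h1 (insert h2 B))"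
  shows "regseq B (chain h1 h2 xs)"
  using assms
proof (induction h1 h2 xs arbitrary: B rule: chain.induct)
  case (2 h1 h2 u v xs)
  note minor = nzd_minor[OF 2(2), of u v h1]
  have "fresh z (insert (Var u) (insert (Var v) (insert (h1 * Var v - h2 * Var u) B)))"
    if "z \<in> set (pvars xs)" for z
    using that 2(3) 2(4)[of z] vars_diff[of "h1 * Var v" "h2 * Var u"]
      vars_mult[of h1 "Var v"] vars_mult[of h2 "Var u"] by auto
  moreover have "nzd B (h1 * Var v - h2 * Var u)" "nzd (insert (h1 * Var v - h2 * Var u) B) (Var v)"
    using 2(3) 2(4)[of u] 2(4)[of v] by (intro minor; simp)+
  ultimately have "regseq (insert (h1 * Var v - h2 * Var u) B) (chain (Var u) (Var v) xs)"
    using 2(3) by (intro 2(1)) (simp_all only: pvars_simps distinct.simps)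
  then show ?case
    using \<open>nzd B (h1 * Var v - h2 * Var u)\<close> by simp
qed simp

text \<open>Each minor is regular modulo \<open>(B, z)\<close>, so a swap preserves the regularity
  of \<open>z\<close> whenever a minor is adjoined; the lower entry of the next column is again
  regular modulo \<open>z\<close>.\<close>

lemma nzd_chain_second:
  assumes "nzd B z" "nzd (insert z B) h2" "distinct (pvars xs)"
    "\<And>x. x \<in> set (pvars xs) \<Longrightarrow> fresh x (insert z (insert h1 (insert h2 B)))"
  shows "nzd (set (chain h1 h2 xs) \<union> B) z"
  using assms
proof (induction h1 h2 xs arbitrary: B rule: chain.induct)
  case (2 h1 h2 u v xs)
  let ?f = "h1 * Var v - h2 * Var u"
  note minor = nzd_minor[OF 2(3), of u v h1]
  have "fresh x (insert z (insert (Var u) (insert (Var v) (insert ?f B))))"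
    if "x \<in> set (pvars xs)" for x
    using that 2(4) 2(5)[of x] vars_diff[of "h1 * Var v" "h2 * Var u"]
      vars_mult[of h1 "Var v"] vars_mult[of h2 "Var u"] by auto
  moreover have "nzd (insert ?f B) z"
    using 2(2,4) 2(5)[of u] 2(5)[of v] by (intro nzd_swap[OF 2(2) minor(1)]) auto
  moreover have "nzd (insert z (insert ?f B)) (Var v)"
    using 2(2,4) 2(5)[of u] 2(5)[of v] minor(2) by (auto simp: insert_commute)
  ultimately have "nzd (set (chain (Var u) (Var v) xs) \<union> insert ?f B) z"
    using 2(4) by (intro 2(1)) auto
  then show ?case by simp
qed simp

lemma chain_swap: "chain h2 h1 (map prod.swap xs) = map uminus (chain h1 h2 xs)"
  by (induction h1 h2 xs rule: chain.induct) auto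

lemma ispan_uminus_image: "ispan (uminus ` A \<union> B) = ispan (A \<union> B)"
  unfolding ideal.span_eq
proof safe
  fix x
  show "x \<in> A \<Longrightarrow> - x \<in> ispan (A \<union> B)" "x \<in> B \<Longrightarrow> x \<in> ispan (A \<union> B)"
    "x \<in> B \<Longrightarrow> x \<in> ispan (uminus ` A \<union> B)"
    by (auto intro: ideal.span_base ideal.span_neg)
  assume "x \<in> A"
  then have "- (- x) \<in> ispan (uminus ` A \<union> B)"
    by (intro ideal.span_neg ideal.span_base) auto
  then show "x \<in> ispan (uminus ` A \<union> B)" by simp
qed

lemma set_pvars_swap: "set (pvars (map prod.swap xs)) = set (pvars xs)"
  by (induction xs) auto

lemma distinct_pvars_swap: "distinct (pvars (map prod.swap xs)) = distinct (pvars xs)"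
  by (induction xs) (auto simp: set_pvars_swap)

text \<open>Exchanging the two rows only changes the signs of the minors, not the ideal.\<close>

lemma nzd_chain_first:
  assumes "nzd B z" "nzd (insert z B) h1" "distinct (pvars xs)"
    "\<And>x. x \<in> set (pvars xs) \<Longrightarrow> fresh x (insert z (insert h1 (insert h2 B)))"
  shows "nzd (set (chain h1 h2 xs) \<union> B) z"
proof -
  have "nzd (set (chain h2 h1 (map prod.swap xs)) \<union> B) z"
    using assms by (intro nzd_chain_second) (auto simp: set_pvars_swap distinct_pvars_swap)
  then show ?thesis
    using ispan_uminus_image[of "set (chain h1 h2 xs)" B]
    by (auto simp: chain_swap intro: nzd_cong_ispan)
qed

lemma ispan_mono: "A \<subseteq> B \<Longrightarrow> x \<in> ispan A \<Longrightarrow> x \<in> ispan B"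
  using ideal.span_mono by blast

text \<open>Modulo \<open>(B)\<close> the pair \<open>f, g\<close> is a regular sequence, so
  \<open>f x = g y\<close> has only the Koszul solutions \<open>x = d g\<close>,
  \<open>y = d f\<close>.\<close>

lemma nzd_syzygy:
  assumes "nzd B f" "nzd (insert f B) g" "f * x - g * y \<in> ispan B"
  obtains d where "x - d * g \<in> ispan B" "y - d * f \<in> ispan B"
proof -
  have "- (f * x - g * y) = g * y - x * f" by (simp add: mult_ac)
  then have "g * y - x * f \<in> ispan B"
    using ideal.span_neg[OF assms(3)] by (simp only:)
  then have "y \<in> ispan (insert f B)"
    using assms(2) by (auto intro: nzdD ispan_insertI)
  then obtain d j where d: "y = j + d * f" "j \<in> ispan B"
    by (rule ispan_insertE)
  have "f * (x - d * g) = (f * x - g * y) + g * j"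
    using d(1) by (simp add: algebra_simps)
  also have "\<dots> \<in> ispan B"
    using assms(3) d(2) by (intro ideal.span_add ideal.span_scale)
  finally have "x - d * g \<in> ispan B"
    using assms(1) by (rule nzdD[rotated])
  then show thesis
    using d by (intro that) auto
qed


section \<open>Four arms\<close>

lemma distinct_append5:
  assumes "distinct (a @ b @ c @ d @ e)"
  shows "set b \<inter> set c = {} \<and> set b \<inter> set d = {} \<and> set b \<inter> set e = {} \<and>
    set c \<inter> set d = {} \<and> set c \<inter> set e = {} \<and> set d \<inter> set e = {} \<and>
    set a \<inter> set b = {} \<and> set a \<inter> set c = {} \<and> set a \<inter> set d = {} \<and> set a \<inter> set e = {} \<and>
    distinct a \<and> distinct b \<and> distinct c \<and> distinct d \<and> distinct e"
  using assms by auto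

text \<open>
  The vertices of the central cell in cyclic order are \<open>y\<^sub>0\<close>, \<open>y\<^sub>1\<close>, \<open>y\<^sub>2\<close>, \<open>y\<^sub>3\<close>.  The arm attached to the edge
  \<open>y\<^sub>e y\<^sub>e\<^sub>+\<^sub>1\<close> consists of the vertex pairs \<open>(u\<^sub>e, v\<^sub>e)\<close>, followed by those in \<open>zs\<^sub>e\<close>, where the first
  components lie on the side of \<open>y\<^sub>e\<close>.
\<close>

locale arms =
  fixes y0 y1 y2 y3 :: 'v
    and u0 v0 u1 v1 u2 v2 u3 v3 :: 'v
    and zs0 zs1 zs2 zs3 :: "('v \<times> 'v) list"
    and field_type :: "'k::field itself"
  assumes distinct: "distinct ([y0, y1, y2, y3] @ pvars ((u0, v0) # zs0) @ pvars ((u1, v1) # zs1) @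
    pvars ((u2, v2) # zs2) @ pvars ((u3, v3) # zs3))"
begin

abbreviation X :: "'v \<Rightarrow> ('v, 'k) mpoly" where "X \<equiv> Var"

definition tail0 where "tail0 = set (chain (X u0) (X v0) zs0)"
definition tail1 where "tail1 = set (chain (X u1) (X v1) zs1)"
definition tail2 where "tail2 = set (chain (X u2) (X v2) zs2)"
definition tail3 where "tail3 = set (chain (X u3) (X v3) zs3)"

definition f0 where "f0 = X y0 * X v0 - X y1 * X u0"
definition f1 where "f1 = X y1 * X v1 - X y2 * X u1"
definition f2 where "f2 = X y2 * X v2 - X y3 * X u2"
definition f3 where "f3 = X y3 * X v3 - X y0 * X u3"

definition tails where "tails = tail0 \<union> tail1 \<union> tail2 \<union> tail3"
definition J where "J = {f0, f1, f2, f3} \<union> tails"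
text \<open>For prolonged arms the colon ideal of \<open>J\<close> by \<open>\<Delta>\<close> also
  contains the minors beyond the first cells, hence the tails.\<close>

definition Y where "Y = {X y0, X y1, X y2, X y3} \<union> tails"
definition \<Delta> where "\<Delta> = X v0 * X v1 * X v2 * X v3 - X u0 * X u1 * X u2 * X u3"
definition center where "center = X y1 * X y3 - X y0 * X y2"

lemma chain_eqs:
  "set (chain (X y0) (X y1) ((u0, v0) # zs0)) = insert f0 tail0"
  "set (chain (X y1) (X y2) ((u1, v1) # zs1)) = insert f1 tail1"
  "set (chain (X y2) (X y3) ((u2, v2) # zs2)) = insert f2 tail2"
  "set (chain (X y3) (X y0) ((u3, v3) # zs3)) = insert f3 tail3"
  by (simp_all add: f0_def f1_def f2_def f3_def tail0_def tail1_def tail2_def tail3_def)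

definition P0 where "P0 = set (pvars ((u0, v0) # zs0))"
definition P1 where "P1 = set (pvars ((u1, v1) # zs1))"
definition P2 where "P2 = set (pvars ((u2, v2) # zs2))"
definition P3 where "P3 = set (pvars ((u3, v3) # zs3))"

lemmas distinct_P = distinct_append5[OF distinct, folded P0_def P1_def P2_def P3_def]

lemma disjoint_P:
  "P0 \<inter> P1 = {}" "P0 \<inter> P2 = {}" "P0 \<inter> P3 = {}" "P1 \<inter> P2 = {}" "P1 \<inter> P3 = {}" "P2 \<inter> P3 = {}"
  "set [y0, y1, y2, y3] \<inter> P0 = {}" "set [y0, y1, y2, y3] \<inter> P1 = {}"
  "set [y0, y1, y2, y3] \<inter> P2 = {}" "set [y0, y1, y2, y3] \<inter> P3 = {}"
  by (insert distinct_P) (elim conjE, assumption)+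

lemma distinct_pvars: "distinct (pvars ((u0, v0) # zs0))" "distinct (pvars ((u1, v1) # zs1))"
    "distinct (pvars ((u2, v2) # zs2))" "distinct (pvars ((u3, v3) # zs3))" "distinct [y0, y1, y2, y3]"
  by (insert distinct_P) (elim conjE, assumption)+

lemma separate:
  "x \<in> P0 \<Longrightarrow> x \<notin> P1 \<and> x \<notin> P2 \<and> x \<notin> P3 \<and> x \<noteq> y0 \<and> x \<noteq> y1 \<and> x \<noteq> y2 \<and> x \<noteq> y3 \<and> y0 \<noteq> x \<and> y1 \<noteq> x \<and> y2 \<noteq> x \<and> y3 \<noteq> x"
  "x \<in> P1 \<Longrightarrow> x \<notin> P0 \<and> x \<notin> P2 \<and> x \<notin> P3 \<and> x \<noteq> y0 \<and> x \<noteq> y1 \<and> x \<noteq> y2 \<and> x \<noteq> y3 \<and> y0 \<noteq> x \<and> y1 \<noteq> x \<and> y2 \<noteq> x \<and> y3 \<noteq> x"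
  "x \<in> P2 \<Longrightarrow> x \<notin> P0 \<and> x \<notin> P1 \<and> x \<notin> P3 \<and> x \<noteq> y0 \<and> x \<noteq> y1 \<and> x \<noteq> y2 \<and> x \<noteq> y3 \<and> y0 \<noteq> x \<and> y1 \<noteq> x \<and> y2 \<noteq> x \<and> y3 \<noteq> x"
  "x \<in> P3 \<Longrightarrow> x \<notin> P0 \<and> x \<notin> P1 \<and> x \<notin> P2 \<and> x \<noteq> y0 \<and> x \<noteq> y1 \<and> x \<noteq> y2 \<and> x \<noteq> y3 \<and> y0 \<noteq> x \<and> y1 \<noteq> x \<and> y2 \<noteq> x \<and> y3 \<noteq> x"
  using disjoint_P by auto

lemma y_notin_P [simp]:
  "y0 \<notin> P0" "y1 \<notin> P0" "y2 \<notin> P0" "y3 \<notin> P0"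
  "y0 \<notin> P1" "y1 \<notin> P1" "y2 \<notin> P1" "y3 \<notin> P1"
  "y0 \<notin> P2" "y1 \<notin> P2" "y2 \<notin> P2" "y3 \<notin> P2"
  "y0 \<notin> P3" "y1 \<notin> P3" "y2 \<notin> P3" "y3 \<notin> P3"
  using disjoint_P by auto

lemma separate_y [simp]:
  "y0 \<noteq> y1" "y0 \<noteq> y2" "y0 \<noteq> y3" "y1 \<noteq> y0" "y1 \<noteq> y2" "y1 \<noteq> y3"
  "y2 \<noteq> y0" "y2 \<noteq> y1" "y2 \<noteq> y3" "y3 \<noteq> y0" "y3 \<noteq> y1" "y3 \<noteq> y2"
  using distinct_pvars(5) by auto

lemma in_P [simp]: "u0 \<in> P0" "v0 \<in> P0" "u1 \<in> P1" "v1 \<in> P1" "u2 \<in> P2" "v2 \<in> P2" "u3 \<in> P3" "v3 \<in> P3"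
  unfolding P0_def P1_def P2_def P3_def by simp_all

lemmas separate_uv [simp] = separate(1)[OF in_P(1)] separate(1)[OF in_P(2)] separate(2)[OF in_P(3)]
  separate(2)[OF in_P(4)] separate(3)[OF in_P(5)] separate(3)[OF in_P(6)] separate(4)[OF in_P(7)]
  separate(4)[OF in_P(8)]

lemma fresh_f [simp]:
  "z \<notin> P0 \<Longrightarrow> z \<noteq> y0 \<Longrightarrow> z \<noteq> y1 \<Longrightarrow> z \<notin> vars f0" "z \<notin> P1 \<Longrightarrow> z \<noteq> y1 \<Longrightarrow> z \<noteq> y2 \<Longrightarrow> z \<notin> vars f1"
  "z \<notin> P2 \<Longrightarrow> z \<noteq> y2 \<Longrightarrow> z \<noteq> y3 \<Longrightarrow> z \<notin> vars f2" "z \<notin> P3 \<Longrightarrow> z \<noteq> y3 \<Longrightarrow> z \<noteq> y0 \<Longrightarrow> z \<notin> vars f3"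
  unfolding f0_def f1_def f2_def f3_def using in_P
  by (auto dest!: subsetD[OF vars_diff] subsetD[OF vars_mult] simp del: in_P)

lemma fresh_tails [simp]:
  "z \<notin> P0 \<Longrightarrow> fresh z tail0" "z \<notin> P1 \<Longrightarrow> fresh z tail1"
  "z \<notin> P2 \<Longrightarrow> fresh z tail2" "z \<notin> P3 \<Longrightarrow> fresh z tail3"
  unfolding tail0_def tail1_def tail2_def tail3_def P0_def P1_def P2_def P3_def
  by (rule fresh_chain; simp)+

lemma fresh_tails_union [simp]: "z \<notin> P0 \<union> P1 \<union> P2 \<union> P3 \<Longrightarrow> fresh z tails"
  by (simp add: tails_def)

text \<open>The first column of a tail consists of two new variables, each regular modulo the other.
  \<open>C\<close> enters through an equation so that the union may be presented in any
  order.\<close>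

lemma nzd_tail0:
  assumes "\<And>z. z \<in> P0 \<Longrightarrow> fresh z B" "C = tail0 \<union> B"
  shows "nzd C (X u0)" "nzd C (X v0)"
proof -
  have B: "fresh u0 B" "fresh v0 B" "u0 \<noteq> v0" "distinct (pvars zs0)"
      "u0 \<notin> set (pvars zs0)" "v0 \<notin> set (pvars zs0)"
    using distinct_pvars(1) assms(1)[of u0] assms(1)[of v0] by simp_all
  show "nzd C (X u0)"
    unfolding tail0_def assms(2) using B assms(1) by (intro nzd_chain_second nzd_fresh) (auto simp: P0_def)
  show "nzd C (X v0)"
    unfolding tail0_def assms(2) using B assms(1) by (intro nzd_chain_first nzd_fresh) (auto simp: P0_def)
qed

text \<open>Cramer's rule: the coefficients are cofactors of the matrix that expresses
  \<open>f0, ..., f3\<close> in terms of \<open>y0, ..., y3\<close>.\<close>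

lemma \<Delta>_y0: "\<Delta> * X y0 \<in> ispan J"
proof -
  have "\<Delta> * X y0 = X v1 * X v2 * X v3 * f0 + X u0 * X v2 * X v3 * f1 + X u0 * X u1 * X v3 * f2
      + X u0 * X u1 * X u2 * f3"
    by (simp add: \<Delta>_def f0_def f1_def f2_def f3_def algebra_simps)
  also have "\<dots> \<in> ispan J"
    by (intro ideal.span_add ispan_mult_base) (auto simp: J_def)
  finally show ?thesis .
qed

text \<open>Adjoining a whole arm keeps \<open>z\<close> regular as soon as one corner of its edge
  is regular modulo \<open>z\<close>; either corner can serve as the entry of the first column that
  starts the chain argument.\<close>

lemma nzd_arm0:
  assumes "C = insert f0 tail0 \<union> B" "B' = insert z B" "nzd B z" "nzd B' (X y0) \<or> nzd B' (X y1)"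
    "\<And>x. x \<in> P0 \<Longrightarrow> fresh x (insert z B)"
  shows "nzd C z"
  unfolding assms(1) chain_eqs[symmetric]
  using assms(4)
proof
  assume "nzd B' (X y0)"
  then show "nzd (set (chain (X y0) (X y1) ((u0, v0) # zs0)) \<union> B) z"
    using assms(2,3,5) distinct_pvars(1)
    by (intro nzd_chain_first) (auto simp del: pvars_simps simp flip: P0_def dest: separate)
next
  assume "nzd B' (X y1)"
  then show "nzd (set (chain (X y0) (X y1) ((u0, v0) # zs0)) \<union> B) z"
    using assms(2,3,5) distinct_pvars(1)
    by (intro nzd_chain_second) (auto simp del: pvars_simps simp flip: P0_def dest: separate)
qed

text \<open>
  The constellation is invariant under rotation, so that every statement about the first arm
  carries over to the others.
\<close>

lemma rotated: "arms y1 y2 y3 y0 u1 v1 u2 v2 u3 v3 u0 v0 zs1 zs2 zs3 zs0"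
  unfolding arms_def by (rule iffD1[OF mset_eq_imp_distinct_iff distinct]) simp

interpretation rot: arms y1 y2 y3 y0 u1 v1 u2 v2 u3 v3 u0 v0 zs1 zs2 zs3 zs0 "TYPE('k)"
  by (rule rotated)

text \<open>Of the symmetric quantities only the central binomial changes, and only by its
  sign.\<close>

lemma rot_simps:
  "rot.tail0 = tail1" "rot.tail1 = tail2" "rot.tail2 = tail3" "rot.tail3 = tail0"
  "rot.f0 = f1" "rot.f1 = f2" "rot.f2 = f3" "rot.f3 = f0"
  "rot.P0 = P1" "rot.P1 = P2" "rot.P2 = P3" "rot.P3 = P0"
  "rot.tails = tails" "rot.J = J" "rot.Y = Y" "rot.\<Delta> = \<Delta>" "rot.center = - center"
  unfolding rot.tails_def rot.J_def rot.Y_def rot.\<Delta>_def rot.center_def tails_def J_def Y_def \<Delta>_def center_def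
    rot.tail0_def rot.tail1_def rot.tail2_def rot.tail3_def tail0_def tail1_def tail2_def tail3_def
    rot.f0_def rot.f1_def rot.f2_def rot.f3_def f0_def f1_def f2_def f3_def
    rot.P0_def rot.P1_def rot.P2_def rot.P3_def P0_def P1_def P2_def P3_def
  by (auto simp: mult_ac)

lemmas nzd_tail1 = rot.nzd_tail0[unfolded rot_simps]
  and nzd_arm1 = rot.nzd_arm0[unfolded rot_simps]
  and \<Delta>_y1 = rot.\<Delta>_y0[unfolded rot_simps]

end

text \<open>Reopening the context lets the same rotation act on the facts just derived, which moves
  them one edge further each time.\<close>

context arms
begin

interpretation rot: arms y1 y2 y3 y0 u1 v1 u2 v2 u3 v3 u0 v0 zs1 zs2 zs3 zs0 "TYPE('k)"
  by (rule rotated)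

lemmas nzd_tail2 = rot.nzd_tail1[unfolded rot_simps]
  and nzd_arm2 = rot.nzd_arm1[unfolded rot_simps]
  and \<Delta>_y2 = rot.\<Delta>_y1[unfolded rot_simps]

end

context arms
begin

interpretation rot: arms y1 y2 y3 y0 u1 v1 u2 v2 u3 v3 u0 v0 zs1 zs2 zs3 zs0 "TYPE('k)"
  by (rule rotated)

lemmas nzd_tail3 = rot.nzd_tail2[unfolded rot_simps]
  and nzd_arm3 = rot.nzd_arm2[unfolded rot_simps]
  and \<Delta>_y3 = rot.\<Delta>_y2[unfolded rot_simps]

section \<open>The colon ideal of \<open>J\<close> by the determinant\<close>

lemma J_subset_Y: "ispan J \<subseteq> ispan Y"
proof (rule ideal.span_minimal)
  have "X y0 * a - X y1 * b \<in> ispan Y" "X y1 * a - X y2 * b \<in> ispan Y"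
    "X y2 * a - X y3 * b \<in> ispan Y" "X y3 * a - X y0 * b \<in> ispan Y" for a b
    by (intro ideal.span_diff ispan_scale2 ideal.span_base; simp add: Y_def)+
  then show "J \<subseteq> ispan Y"
    unfolding J_def f0_def f1_def f2_def f3_def by (auto simp: Y_def intro: ideal.span_base)
qed (rule ideal.subspace_span)

lemma weight_chain:
  assumes "\<And>u v. (u, v) \<in> set ((a, b) # zs) \<Longrightarrow> w u = p \<and> w v = q"
    and "g \<in> set (chain (X a) (X b) zs)"
  shows "whom w (int p + int q) g"
proof (rule whom_chain[OF _ _ _ assms(2)])
  show "whom w (int p) (X a)" "whom w (int q) (X b)"
    using assms(1)[of a b] by (simp_all add: whom_Var)
  show "int (w u) = int p \<and> int (w v) = int q" if "(u, v) \<in> set zs" for u v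
    using assms(1)[of u v] that by simp
qed

lemma nzd_Y_v: "nzd Y (X v0)" "nzd Y (X v1)" "nzd Y (X v2)" "nzd Y (X v3)"
proof -
  let ?Y = "{X y0, X y1, X y2, X y3}"
  show "nzd Y (X v0)"
    by (rule nzd_tail0(2)[of "?Y \<union> tail1 \<union> tail2 \<union> tail3"]) (auto simp: Y_def tails_def dest!: separate)
  show "nzd Y (X v1)"
    by (rule nzd_tail1(2)[of "?Y \<union> tail0 \<union> tail2 \<union> tail3"]) (auto simp: Y_def tails_def dest!: separate)
  show "nzd Y (X v2)"
    by (rule nzd_tail2(2)[of "?Y \<union> tail0 \<union> tail1 \<union> tail3"]) (auto simp: Y_def tails_def dest!: separate)
  show "nzd Y (X v3)"
    by (rule nzd_tail3(2)[of "?Y \<union> tail0 \<union> tail1 \<union> tail2"]) (auto simp: Y_def tails_def dest!: separate)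
qed

lemma nzd_Y_\<Delta>: "nzd Y \<Delta>"
proof -
  \<comment> \<open>Weight one on the \<open>v\<close> side of the first arm alone: all tail minors
    are homogeneous, and the product of the \<open>v\<close> outweighs the product of the
    \<open>u\<close>.\<close>
  define w :: "'v \<Rightarrow> nat" where "w x = of_bool (x \<in> snd ` set ((u0, v0) # zs0))" for x
  have w0: "w u = 0 \<and> w v = 1" if "(u, v) \<in> set ((u0, v0) # zs0)" for u v
    using pvars_sides[OF distinct_pvars(1) that] unfolding w_def by simp
  have other: "w x = 0" if "x \<notin> P0" for x
    using that unfolding P0_def set_pvars w_def by simp
  have w1: "w u = 0 \<and> w v = 0" if "(u, v) \<in> set ((u1, v1) # zs1)" for u v
    using pvars_fst_snd[OF that, folded P1_def] by (auto simp: other dest!: separate(2))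
  have w2: "w u = 0 \<and> w v = 0" if "(u, v) \<in> set ((u2, v2) # zs2)" for u v
    using pvars_fst_snd[OF that, folded P2_def] by (auto simp: other dest!: separate(3))
  have w3: "w u = 0 \<and> w v = 0" if "(u, v) \<in> set ((u3, v3) # zs3)" for u v
    using pvars_fst_snd[OF that, folded P3_def] by (auto simp: other dest!: separate(4))
  have w: "w u0 = 0" "w u1 = 0" "w u2 = 0" "w u3 = 0" "w v0 = 1" "w v1 = 0" "w v2 = 0" "w v3 = 0"
    using w0[of u0 v0] w1[of u1 v1] w2[of u2 v2] w3[of u3 v3] by simp_all
  have "\<exists>d. whom w d g" if "g \<in> tails" for g
    using that weight_chain[OF w0] weight_chain[OF w1] weight_chain[OF w2] weight_chain[OF w3]
    unfolding tails_def tail0_def tail1_def tail2_def tail3_def by (elim UnE) (rule exI, assumption | blast)+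
  then have "\<exists>d. whom w d g" if "g \<in> Y" for g
    using that unfolding Y_def by (elim UnE insertE) (auto intro: whom_Var)
  moreover have "whom w (int (w v0) + int (w v1) + int (w v2) + int (w v3)) (X v0 * X v1 * X v2 * X v3)"
    by (intro whom_mult whom_Var refl)
  moreover have "whom w (int (w u0) + int (w u1) + int (w u2) + int (w u3)) (X u0 * X u1 * X u2 * X u3)"
    by (intro whom_mult whom_Var refl)
  moreover have "nzd Y (X v0 * X v1 * X v2 * X v3)"
    by (intro nzd_mult nzd_Y_v)
  ultimately have "nzd Y (X v0 * X v1 * X v2 * X v3 + (- (X u0 * X u1 * X u2 * X u3)))"
    using w by (intro nzd_initial[of Y w 1 _ 0]) (auto intro: whom_uminus)
  then show ?thesis by (simp add: \<Delta>_def)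
qed

lemma \<Delta>_Y: "z \<in> ispan Y \<Longrightarrow> \<Delta> * z \<in> ispan J"
proof (induction rule: ideal.span_induct_alt)
  case (step c g z)
  have "\<Delta> * g \<in> ispan J"
    using step(1) unfolding Y_def
    by (auto intro: \<Delta>_y0 \<Delta>_y1 \<Delta>_y2 \<Delta>_y3) (auto simp: J_def intro: ispan_mult_base)
  then show ?case
    using step by (simp add: distrib_left mult.left_commute ideal.span_add ideal.span_scale)
qed (auto simp: ideal.span_zero)

text \<open>One inclusion is Cramer's rule. For the other, \<open>J\<close> lies in
  \<open>(Y)\<close>, modulo which \<open>\<Delta>\<close> is regular.\<close>

lemma colon_\<Delta>: "\<Delta> * z \<in> ispan J \<longleftrightarrow> z \<in> ispan Y"
  using \<Delta>_Y J_subset_Y nzd_Y_\<Delta> by (auto simp: nzd_def)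

section \<open>Regularity of the corners modulo \<open>J\<close> and the determinant\<close>

definition others where "others = insert f1 tail1 \<union> insert f2 tail2 \<union> insert f3 tail3"

text \<open>Without the first arm the edges form a path \<open>y1, y2, y3, y0\<close>. Along it each
  corner is regular because the next one is regular modulo it, and the last corner is a new
  variable.\<close>

lemma nzd_others: "nzd others (X y1)"
proof -
  let ?A2 = "insert f2 tail2" and ?A3 = "insert f3 tail3"
  have 1: "nzd (?A3 \<union> {X y1, X y2}) (X y3)"
    by (rule nzd_arm3[of _ "{X y1, X y2}"]) (auto intro!: nzd_fresh dest!: separate)
  have 2: "nzd (?A2 \<union> ?A3 \<union> {X y1}) (X y2)"
    by (rule nzd_arm2[of _ "?A3 \<union> {X y1}", OF _ _ _ disjI2[OF 1]]) (auto intro!: nzd_fresh dest!: separate)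
  show ?thesis
    unfolding others_def
    by (rule nzd_arm1[of _ "?A2 \<union> ?A3", OF _ _ _ disjI2[OF 2]]) (auto intro!: nzd_fresh dest!: separate)
qed

text \<open>The same walk along the path \<open>y0, y1, y2\<close>, which ends at the new variable
  \<open>y2\<close>.\<close>

lemma nzd_path_y0: "nzd ({X y3, f0, f1} \<union> tails) (X y0)"
proof (rule nzd_arm0[OF _ refl])
  show "{X y3, f0, f1} \<union> tails = insert f0 tail0 \<union> ({X y3, f1} \<union> tail1 \<union> tail2 \<union> tail3)"
    by (auto simp: tails_def)
  have "nzd ({X y0, X y3, f1} \<union> tail1 \<union> tail2 \<union> tail3) (X y1)"
    by (rule nzd_arm1[of _ "{X y0, X y3} \<union> tail2 \<union> tail3", OF _ refl])
      (auto intro!: nzd_fresh dest!: separate)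
  then show "nzd (insert (X y0) ({X y3, f1} \<union> tail1 \<union> tail2 \<union> tail3)) (X y0) \<or>
      nzd (insert (X y0) ({X y3, f1} \<union> tail1 \<union> tail2 \<union> tail3)) (X y1)"
    by simp
qed (auto intro!: nzd_fresh dest!: separate)

text \<open>
  Modulo \<open>y\<^sub>3\<close> a relation \<open>p f\<^sub>2 + q f\<^sub>3\<close> becomes \<open>p y\<^sub>2 v\<^sub>2 = q y\<^sub>0 u\<^sub>3\<close>; the solutions are spanned by the
  trivial one and by \<open>p = u\<^sub>0 u\<^sub>1 u\<^sub>3\<close>, \<open>q = v\<^sub>0 v\<^sub>1 v\<^sub>2\<close>, which yields \<open>\<Delta>\<close>.
\<close>

lemma syzygy_y2_y0:
  assumes pq: "p * X y2 - q * X y0 \<in> ispan ({X y3, f0, f1} \<union> tails)"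
  obtains w z where
    "p - (w * X y0 + z * (X u0 * X u1)) \<in> ispan ({X y3, f0, f1} \<union> tails)"
    "q - (w * X y2 + z * (X v0 * X v1)) \<in> ispan ({X y3, f0, f1} \<union> tails)"
proof -
  let ?A = "{X y3, f0, f1} \<union> tails" and ?T = "{X y0, X y3} \<union> tails"
  have T_A: "x \<in> ispan (insert (X y0) ?A)" if "x \<in> ispan ?T" for x
    using that by (rule subsetD[OF ideal.span_mono, rotated]) auto
  have nzd_y2: "nzd ?T (X y2)"
    by (rule nzd_fresh) simp
  have nzd_y1: "nzd (insert (X y2) ?T) (X y1)"
    by (rule nzd_fresh) simp
  have nzd_v1: "nzd ({X u0, X y2} \<union> ?T) (X v1)"
    by (rule nzd_tail1(2)[of "{X u0, X y2, X y0, X y3} \<union> tail0 \<union> tail2 \<union> tail3"])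
      (auto simp: tails_def dest!: separate)
  have nzd_u0: "nzd (insert (X y2) ?T) (X u0)"
    by (rule nzd_tail0(1)[of "{X y2, X y0, X y3} \<union> tail1 \<union> tail2 \<union> tail3"])
      (auto simp: tails_def dest!: separate)
  \<comment> \<open>Modulo \<open>y0\<close> the relation concerns \<open>p\<close> alone, and
    \<open>f0\<close> turns into \<open>- y1 u0\<close>. Comparing the coefficients
    \<open>b\<close>, \<open>c\<close> of \<open>f0\<close>, \<open>f1\<close> yields a relation
    between the variables \<open>y2\<close> and \<open>y1\<close>.\<close>
  have "p * X y2 \<in> ispan (insert (X y0) ?A)"
    using pq by (rule ispan_insertI)
  also have "insert (X y0) ?A = insert f0 (insert f1 ?T)" by auto
  finally obtain b j where 1: "p * X y2 = j + b * f0" "j \<in> ispan (insert f1 ?T)"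
    by (rule ispan_insertE)
  obtain c j' where 2: "j = j' + c * f1" "j' \<in> ispan ?T"
    using 1(2) by (rule ispan_insertE)
  have y0: "X y0 * x \<in> ispan ?T" for x
    by (rule ispan_scale2) (simp add: ideal.span_base)
  have eq: "X y2 * (p + c * X u1) - X y1 * (c * X v1 - b * X u0) = j' + X y0 * (b * X v0)"
    unfolding 1 2 by (simp add: 1(1)[unfolded 2(1)] f0_def f1_def algebra_simps)
  then have r: "X y2 * (p + c * X u1) - X y1 * (c * X v1 - b * X u0) \<in> ispan ?T"
    using 2(2) y0 by (simp add: ideal.span_add)
  obtain d where d: "(p + c * X u1) - d * X y1 \<in> ispan ?T" "(c * X v1 - b * X u0) - d * X y2 \<in> ispan ?T"
    by (rule nzd_syzygy[OF nzd_y2 nzd_y1 r])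
  \<comment> \<open>\<open>c v1 = b u0 + d y2\<close> modulo \<open>?T\<close>, and
    \<open>v1\<close> is regular modulo \<open>u0\<close> and \<open>y2\<close>; so \<open>c\<close>
    is a combination of \<open>u0\<close> and \<open>y2\<close>.\<close>
  have "X v1 * c - (b * X u0 + d * X y2) = (c * X v1 - b * X u0) - d * X y2"
    by (simp add: mult.commute)
  then have "X v1 * c - (b * X u0 + d * X y2) \<in> ispan ({X u0, X y2} \<union> ?T)"
    using d(2) ispan_mono[of ?T "{X u0, X y2} \<union> ?T"] by (simp only: Un_upper2)
  moreover have "b * X u0 + d * X y2 \<in> ispan ({X u0, X y2} \<union> ?T)"
    by (intro ideal.span_add ispan_mult_base) auto
  ultimately have "X v1 * c \<in> ispan ({X u0, X y2} \<union> ?T)"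
    by (metis diff_add_cancel ideal.span_add)
  then have "c \<in> ispan ({X u0, X y2} \<union> ?T)"
    by (rule nzdD[OF nzd_v1])
  also have "{X u0, X y2} \<union> ?T = insert (X u0) (insert (X y2) ?T)" by auto
  finally obtain c1 c2 where c1: "c = c2 + c1 * X u0" "c2 \<in> ispan (insert (X y2) ?T)"
    by (rule ispan_insertE)
  obtain c3 t where c3: "c2 = t + c3 * X y2" "t \<in> ispan ?T"
    using c1(2) by (rule ispan_insertE)
  \<comment> \<open>What remains is a relation between \<open>y2\<close> and \<open>u0\<close>,
    which again is of Koszul type.\<close>
  have "X y2 * (d - X v1 * c3) - X u0 * (X v1 * c1 - b)
      = t * X v1 - ((c * X v1 - b * X u0) - d * X y2)"
    unfolding c1 c3 by (simp add: algebra_simps)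
  also have "\<dots> \<in> ispan ?T"
    by (rule ideal.span_diff[OF ispan_scale2[OF c3(2)] d(2)])
  finally obtain e where e: "(d - X v1 * c3) - e * X u0 \<in> ispan ?T" "(X v1 * c1 - b) - e * X y2 \<in> ispan ?T"
    by (rule nzd_syzygy[OF nzd_y2 nzd_u0])
  have "p - (- c1) * (X u0 * X u1) = ((p + c * X u1) - d * X y1) - X u1 * t
      + X y1 * ((d - X v1 * c3) - e * X u0) + (c3 * f1 - e * f0 + (e * X v0) * X y0)"
    unfolding c1 c3 f0_def f1_def by (simp add: algebra_simps)
  also have "\<dots> \<in> ispan (insert (X y0) ?A)"
  proof (rule ideal.span_add[OF ideal.span_add[OF ideal.span_diff]])
    show "c3 * f1 - e * f0 + (e * X v0) * X y0 \<in> ispan (insert (X y0) ?A)"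
      by (intro ideal.span_add ideal.span_diff ispan_mult_base) auto
  qed (rule T_A, (rule d(1) ideal.span_scale[OF c3(2)] ideal.span_scale[OF e(1)]))+
  finally obtain w j2 where w: "p - (- c1) * (X u0 * X u1) = j2 + w * X y0" "j2 \<in> ispan ?A"
    by (rule ispan_insertE)
  define z where "z = - c1"
  have p: "p - (w * X y0 + z * (X u0 * X u1)) \<in> ispan ?A"
    using w by (simp add: z_def algebra_simps)
  \<comment> \<open>\<open>q\<close> needs no second computation: the original relation determines
    it after multiplication by \<open>y0\<close>, which is regular modulo \<open>?A\<close>.\<close>
  have "X y0 * (q - (w * X y2 + z * (X v0 * X v1))) =
      (p - (w * X y0 + z * (X u0 * X u1))) * X y2 - (p * X y2 - q * X y0)
      + ((- (z * X u0)) * f1 + (- (z * X v1)) * f0)"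
    unfolding f0_def f1_def by (simp add: algebra_simps)
  also have "\<dots> \<in> ispan ?A"
  proof (rule ideal.span_add[OF ideal.span_diff[OF ispan_scale2[OF p] pq]])
    show "(- (z * X u0)) * f1 + (- (z * X v1)) * f0 \<in> ispan ?A"
      by (intro ideal.span_add ispan_mult_base) auto
  qed
  finally have "q - (w * X y2 + z * (X v0 * X v1)) \<in> ispan ?A"
    using nzd_path_y0 by (rule nzdD[rotated])
  then show thesis
    using p by (rule that[rotated])
qed

text \<open>Write \<open>y3 x = p f2 + q f3\<close> modulo \<open>f0\<close>, \<open>f1\<close> and
  the tails. Reducing modulo \<open>y3\<close> leaves a relation whose solutions are known; each
  solution, inserted for \<open>p\<close> and \<open>q\<close>, gives \<open>y3\<close> times an
  explicit member of \<open>J + (\<Delta>)\<close>.\<close>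

lemma colon_y3:
  assumes "X y3 * x \<in> ispan J"
  shows "x \<in> ispan (insert \<Delta> J)"
proof -
  let ?B = "{f0, f1} \<union> tails" and ?A = "{X y3, f0, f1} \<union> tails"
  have A: "?A = insert (X y3) ?B" by auto
  have J: "J = insert f2 (insert f3 ?B)" by (auto simp: J_def)
  obtain p j where p: "X y3 * x = j + p * f2" "j \<in> ispan (insert f3 ?B)"
    using assms unfolding J by (rule ispan_insertE)
  obtain q j' where q: "j = j' + q * f3" "j' \<in> ispan ?B"
    using p(2) by (rule ispan_insertE)
  have B_A: "t \<in> ispan ?A" if "t \<in> ispan ?B" for t
    using that by (rule subsetD[OF ideal.span_mono, rotated]) auto
  have y3: "t * X y3 \<in> ispan ?A" for t
    by (intro ispan_mult_base) auto
  have "X v2 * (X y2 * p) - X u3 * (X y0 * q) = (x + p * X u2 - q * X v3) * X y3 - j'"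
    using p(1) unfolding q(1) by (simp add: f2_def f3_def algebra_simps)
  also have "\<dots> \<in> ispan ?A"
    by (intro ideal.span_diff y3 B_A q)
  finally have r: "X v2 * (X y2 * p) - X u3 * (X y0 * q) \<in> ispan ?A" .
  have nzd_v2: "nzd ?A (X v2)"
    by (rule nzd_tail2(2)[of "{X y3, f0, f1} \<union> tail0 \<union> tail1 \<union> tail3"])
      (auto simp: tails_def dest!: separate)
  have nzd_v2': "nzd (insert (X y0) ?A) (X v2)"
    by (rule nzd_tail2(2)[of "{X y0, X y3, f0, f1} \<union> tail0 \<union> tail1 \<union> tail3"])
      (auto simp: tails_def dest!: separate)
  have nzd_u3: "nzd (insert (X v2) ?A) (X u3)"
    by (rule nzd_tail3(1)[of "{X v2, X y3, f0, f1} \<union> tail0 \<union> tail1 \<union> tail2"])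
      (auto simp: tails_def dest!: separate)
  have nzd_u3': "nzd (insert (X y2) ?A) (X u3)"
    by (rule nzd_tail3(1)[of "{X y2, X y3, f0, f1} \<union> tail0 \<union> tail1 \<union> tail2"])
      (auto simp: tails_def dest!: separate)
  have nzd_y2: "nzd ?A (X y2)"
  proof (rule nzd_arm1[OF _ refl])
    show "?A = insert f1 tail1 \<union> ({X y3, f0} \<union> tail0 \<union> tail2 \<union> tail3)"
      by (auto simp: tails_def)
    have "nzd ({X y2, X y3, f0} \<union> tail0 \<union> tail2 \<union> tail3) (X y1)"
      by (rule nzd_arm0[of _ "{X y2, X y3} \<union> tail2 \<union> tail3", OF _ refl])
        (auto intro!: nzd_fresh dest!: separate)
    then show "nzd (insert (X y2) ({X y3, f0} \<union> tail0 \<union> tail2 \<union> tail3)) (X y1) \<or>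
        nzd (insert (X y2) ({X y3, f0} \<union> tail0 \<union> tail2 \<union> tail3)) (X y2)"
      by simp
  qed (auto intro!: nzd_fresh dest!: separate)
  \<comment> \<open>The factors \<open>v2\<close> and \<open>u3\<close> can be divided out: modulo
    \<open>?A\<close> one gets \<open>p = p' u3\<close> and \<open>q = q' v2\<close> with
    \<open>p' y2 = q' y0\<close>.\<close>
  obtain d where d: "X y2 * p - d * X u3 \<in> ispan ?A" "X y0 * q - d * X v2 \<in> ispan ?A"
    by (rule nzd_syzygy[OF nzd_v2 nzd_u3 r])
  have "X y2 * p - X u3 * d \<in> ispan ?A" "X y0 * q - X v2 * d \<in> ispan ?A"
    using d by (simp_all add: mult.commute)
  then obtain p' q' where p': "p - p' * X u3 \<in> ispan ?A" "d - p' * X y2 \<in> ispan ?A"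
    and q': "q - q' * X v2 \<in> ispan ?A" "d - q' * X y0 \<in> ispan ?A"
    using nzd_syzygy[OF nzd_y2 nzd_u3'] nzd_syzygy[OF nzd_path_y0 nzd_v2'] by metis
  have "p' * X y2 - q' * X y0 = (d - q' * X y0) - (d - p' * X y2)" by simp
  also have "\<dots> \<in> ispan ?A"
    by (rule ideal.span_diff[OF q'(2) p'(2)])
  finally obtain w z where
    wz: "p' - (w * X y0 + z * (X u0 * X u1)) \<in> ispan ?A" "q' - (w * X y2 + z * (X v0 * X v1)) \<in> ispan ?A"
    by (rule syzygy_y2_y0)
  have "p - (w * X y0 + z * (X u0 * X u1)) * X u3 =
      (p - p' * X u3) + (p' - (w * X y0 + z * (X u0 * X u1))) * X u3"
    by (simp add: algebra_simps)
  also have "\<dots> \<in> ispan ?A"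
    using p' wz by (intro ideal.span_add ispan_scale2)
  finally obtain a a' where a: "p - (w * X y0 + z * (X u0 * X u1)) * X u3 = a' + a * X y3" "a' \<in> ispan ?B"
    unfolding A by (rule ispan_insertE)
  have "q - (w * X y2 + z * (X v0 * X v1)) * X v2 =
      (q - q' * X v2) + (q' - (w * X y2 + z * (X v0 * X v1))) * X v2"
    by (simp add: algebra_simps)
  also have "\<dots> \<in> ispan ?A"
    using q' wz by (intro ideal.span_add ispan_scale2)
  finally obtain b b' where b: "q - (w * X y2 + z * (X v0 * X v1)) * X v2 = b' + b * X y3" "b' \<in> ispan ?B"
    unfolding A by (rule ispan_insertE)
  \<comment> \<open>\<open>y0 u3 f2 + y2 v2 f3\<close> equals \<open>y3 (v3 f2 + u2 f3)\<close>, and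
    \<open>u0 u1 u3 f2 + v0 v1 v2 f3\<close> equals \<open>y3 \<Delta>\<close> modulo
    \<open>f0\<close> and \<open>f1\<close>; \<open>r\<close> is the resulting quotient by
    \<open>y3\<close>.\<close>
  define r where "r = w * (X v3 * f2 + X u2 * f3) + z * \<Delta> + a * f2 + b * f3"
  have pq: "p = (w * X y0 + z * (X u0 * X u1)) * X u3 + (a' + a * X y3)"
    "q = (w * X y2 + z * (X v0 * X v1)) * X v2 + (b' + b * X y3)"
    using a(1) b(1) by (simp_all only: diff_eq_eq add.commute)
  have "X y3 * x = j' + q * f3 + p * f2"
    using p(1) q(1) by simp
  also have "\<dots> = X y3 * r + (j' + a' * f2 + b' * f3 - (z * X u3 * X v2 * X u0) * f1 - (z * X u3 * X v2 * X v1) * f0)"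
    unfolding pq r_def by (simp add: f0_def f1_def f2_def f3_def \<Delta>_def algebra_simps)
  finally have "X y3 * (x - r) =
      j' + a' * f2 + b' * f3 - (z * X u3 * X v2 * X u0) * f1 - (z * X u3 * X v2 * X v1) * f0"
    by (simp add: algebra_simps)
  also have "\<dots> \<in> ispan ?B"
    using q(2) a(2) b(2) by (intro ideal.span_add ideal.span_diff ispan_scale2 ispan_mult_base) auto
  finally have "X y3 * (x - r) \<in> ispan ?B" .
  moreover have "nzd ?B (X y3)"
    by (rule nzd_fresh) simp
  ultimately have "x - r \<in> ispan ?B" by (auto intro: nzdD)
  then have "x - r \<in> ispan (insert \<Delta> J)"
    by (rule subsetD[OF ideal.span_mono, rotated]) (auto simp: J)
  moreover have "r \<in> ispan (insert \<Delta> J)"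
    unfolding r_def by (intro ideal.span_add ispan_mult_base ideal.span_scale) (auto simp: J_def)
  ultimately have "x - r + r \<in> ispan (insert \<Delta> J)"
    by (rule ideal.span_add)
  then show ?thesis by simp
qed

text \<open>In \<open>y3 x = j + z \<Delta>\<close> the terms \<open>y3 x\<close> and
  \<open>j\<close> lie in \<open>(Y)\<close>, so \<open>z\<close> does, as \<open>\<Delta>\<close>
  is regular there. Then \<open>z \<Delta>\<close> is already in \<open>J\<close>, which reduces to
  the colon ideal by \<open>y3\<close>.\<close>

lemma nzd_y3: "nzd (insert \<Delta> J) (X y3)"
  unfolding nzd_def
proof (intro allI impI)
  fix x
  assume "X y3 * x \<in> ispan (insert \<Delta> J)"
  then obtain z j where z: "X y3 * x = j + z * \<Delta>" "j \<in> ispan J"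
    by (rule ispan_insertE)
  have "X y3 * x \<in> ispan Y"
    by (intro ispan_scale2 ideal.span_base) (simp add: Y_def)
  moreover have "j \<in> ispan Y"
    using z(2) J_subset_Y by blast
  moreover have "\<Delta> * z = X y3 * x - j"
    using z(1) by (simp add: mult.commute)
  ultimately have "\<Delta> * z \<in> ispan Y"
    by (simp add: ideal.span_diff)
  then have "\<Delta> * z \<in> ispan J"
    by (rule \<Delta>_Y[OF nzdD[OF nzd_Y_\<Delta>]])
  then have "X y3 * x \<in> ispan J"
    using z by (simp add: mult.commute ideal.span_add)
  then show "x \<in> ispan (insert \<Delta> J)"
    by (rule colon_y3)
qed

end

context arms
begin

interpretation rot: arms y1 y2 y3 y0 u1 v1 u2 v2 u3 v3 u0 v0 zs1 zs2 zs3 zs0 "TYPE('k)"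
  by (rule rotated)

lemmas nzd_y0 = rot.nzd_y3[unfolded rot_simps]

end

context arms
begin

interpretation rot: arms y1 y2 y3 y0 u1 v1 u2 v2 u3 v3 u0 v0 zs1 zs2 zs3 zs0 "TYPE('k)"
  by (rule rotated)

lemmas nzd_y1 = rot.nzd_y0[unfolded rot_simps]

lemma J_arms: "J = insert f0 tail0 \<union> insert f1 tail1 \<union> insert f2 tail2 \<union> insert f3 tail3"
  by (auto simp: J_def tails_def)

text \<open>For a suitable weight the initial term of the central binomial is \<open>y\<^sub>1 y\<^sub>3\<close>.\<close>

lemma nzd_center: "nzd (insert \<Delta> J) center"
proof -
  \<comment> \<open>Weight one on \<open>y3\<close> and on the vertices that continue its side of
    the two arms meeting there. Then \<open>f2\<close>, \<open>f3\<close> and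
    \<open>\<Delta>\<close> are homogeneous of weight one, and \<open>f0\<close>, \<open>f1\<close>
    of weight zero.\<close>
  define w :: "'v \<Rightarrow> nat" where
    "w x = of_bool (x = y3 \<or> x \<in> snd ` set ((u2, v2) # zs2) \<or> x \<in> fst ` set ((u3, v3) # zs3))" for x
  have sub: "snd ` set ((u2, v2) # zs2) \<subseteq> P2" "fst ` set ((u3, v3) # zs3) \<subseteq> P3"
    by (simp_all only: P2_def P3_def set_pvars Un_upper1 Un_upper2)
  have other: "w x = 0" if "x \<in> P0 \<union> P1" for x
  proof -
    have "x \<notin> P2" "x \<notin> P3" "x \<noteq> y3"
      using that separate by blast+
    then have "x \<notin> snd ` set ((u2, v2) # zs2)" "x \<notin> fst ` set ((u3, v3) # zs3)"
      using sub by blast+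
    then show ?thesis
      using \<open>x \<noteq> y3\<close> unfolding w_def by simp
  qed
  have y: "w y0 = 0" "w y1 = 0" "w y2 = 0" "w y3 = 1"
  proof -
    have "y \<notin> snd ` set ((u2, v2) # zs2) \<and> y \<notin> fst ` set ((u3, v3) # zs3)" if "y \<in> {y0, y1, y2, y3}" for y
      using that sub y_notin_P by blast
    then show "w y0 = 0" "w y1 = 0" "w y2 = 0" "w y3 = 1"
      unfolding w_def by simp_all
  qed
  have w0: "w u = 0 \<and> w v = 0" if "(u, v) \<in> set ((u0, v0) # zs0)" for u v
    using pvars_fst_snd[OF that, folded P0_def] by (simp add: other)
  have w1: "w u = 0 \<and> w v = 0" if "(u, v) \<in> set ((u1, v1) # zs1)" for u v
    using pvars_fst_snd[OF that, folded P1_def] by (simp add: other)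
  have w2: "w u = 0 \<and> w v = 1" if "(u, v) \<in> set ((u2, v2) # zs2)" for u v
  proof -
    have "u \<notin> fst ` set ((u3, v3) # zs3)" "u \<noteq> y3"
      using pvars_fst_snd[OF that, folded P2_def] separate(3) sub(2) by blast+
    then show ?thesis
      using pvars_sides[OF distinct_pvars(3) that] unfolding w_def by simp
  qed
  have w3: "w u = 1 \<and> w v = 0" if "(u, v) \<in> set ((u3, v3) # zs3)" for u v
  proof -
    have "v \<notin> snd ` set ((u2, v2) # zs2)" "v \<noteq> y3"
      using pvars_fst_snd[OF that, folded P3_def] separate(4) sub(1) by blast+
    then show ?thesis
      using pvars_sides[OF distinct_pvars(4) that] unfolding w_def by simp
  qed
  have w: "w u0 = 0" "w u1 = 0" "w u2 = 0" "w u3 = 1" "w v0 = 0" "w v1 = 0" "w v2 = 1" "w v3 = 0"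
    using w0[of u0 v0] w1[of u1 v1] w2[of u2 v2] w3[of u3 v3] by simp_all
  have arm: "\<exists>d. whom w d g" if "g \<in> set (chain (X a) (X b) zs)"
      "\<And>u v. (u, v) \<in> set zs \<Longrightarrow> w u = w a \<and> w v = w b" for g a b zs
    using whom_chain[of w "int (w a)" "X a" "int (w b)" "X b" zs g] that by (auto simp: whom_Var)
  have "\<exists>d. whom w d g" if "g \<in> J" for g
    using that w0 w1 w2 w3 y unfolding J_arms chain_eqs[symmetric] by (elim UnE) (erule arm; simp)+
  moreover have \<Delta>: "whom w 1 \<Delta>"
  proof -
    have "whom w (int (w v0) + int (w v1) + int (w v2) + int (w v3)) (X v0 * X v1 * X v2 * X v3)"
      "whom w (int (w u0) + int (w u1) + int (w u2) + int (w u3)) (X u0 * X u1 * X u2 * X u3)"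
      by (intro whom_mult whom_Var refl)+
    then show ?thesis
      unfolding \<Delta>_def using w by (intro whom_diff) simp_all
  qed
  ultimately have hom: "\<exists>d. whom w d g" if "g \<in> insert \<Delta> J" for g
    using that by blast
  have "whom w (int (w y1) + int (w y3)) (X y1 * X y3)" "whom w (int (w y0) + int (w y2)) (X y0 * X y2)"
    by (intro whom_mult whom_Var refl)+
  then have "whom w 1 (X y1 * X y3)" "whom w 0 (- (X y0 * X y2))"
    using y by (auto intro: whom_uminus)
  then have "nzd (insert \<Delta> J) (X y1 * X y3 + (- (X y0 * X y2)))"
    by (intro nzd_initial[where w = w and d = 1 and e = 0])
      (auto intro: nzd_mult nzd_y1 nzd_y3 simp: hom simp del: insert_iff)
  then show ?thesis by (simp add: center_def)
qed

lemma \<Delta>_center: "\<Delta> * center \<in> ispan J"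
  by (rule \<Delta>_Y) (auto simp: center_def Y_def intro!: ideal.span_diff ispan_mult_base)

text \<open>The central binomial is regular modulo \<open>J + (\<Delta>)\<close> and multiplies
  \<open>\<Delta>\<close> into \<open>J\<close>.\<close>

lemma colon_center: "center * x \<in> ispan J \<longleftrightarrow> x \<in> ispan (insert \<Delta> J)"
proof
  assume "center * x \<in> ispan J"
  then have "center * x \<in> ispan (insert \<Delta> J)"
    by (rule ispan_mono[rotated]) auto
  then show "x \<in> ispan (insert \<Delta> J)"
    by (rule nzdD[OF nzd_center])
next
  assume "x \<in> ispan (insert \<Delta> J)"
  then obtain z j where "x = j + z * \<Delta>" "j \<in> ispan J"
    by (rule ispan_insertE)
  moreover have "center * (j + z * \<Delta>) = center * j + z * (\<Delta> * center)"
    by (simp add: algebra_simps)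
  ultimately show "center * x \<in> ispan J"
    using \<Delta>_center by (simp add: ideal.span_add ideal.span_scale)
qed

text \<open>Adding the arms backwards around the cycle, the next binomial is a minor whose lower
  entry \<open>y\<close> is regular modulo the binomials already present.\<close>

lemma regseq_J:
  assumes "zs0 = []" "zs1 = []" "zs2 = []" "zs3 = []"
  shows "regseq {} [f3, f2, f1, f0]"
proof -
  have tails: "tail0 = {}" "tail1 = {}" "tail2 = {}" "tail3 = {}"
    unfolding tail0_def tail1_def tail2_def tail3_def by (simp_all add: assms)
  have uv: "u0 \<noteq> v0" "u1 \<noteq> v1" "u2 \<noteq> v2" "u3 \<noteq> v3"
    using distinct_pvars by auto
  have y3: "nzd {f3} (X y3)"
    by (rule nzd_arm3[of _ "{}" "{X y3}"]) (auto simp: tails intro!: nzd_fresh)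
  have y3': "nzd {X y2, f3} (X y3)"
    by (rule nzd_arm3[of _ "{X y2}" "{X y3, X y2}"]) (auto simp: tails intro!: nzd_fresh dest!: separate)
  have y2: "nzd {f2, f3} (X y2)"
    by (rule nzd_arm2[of _ "{f3}" "{X y2, f3}", OF _ _ _ disjI2[OF y3']]) (auto simp: tails intro!: nzd_fresh dest!: separate)
  have y1: "nzd {f1, f2, f3} (X y1)"
    using nzd_others by (simp add: others_def tails insert_commute)
  have "nzd {} f3"
    unfolding f3_def using uv by (intro nzd_minor nzd_fresh) simp_all
  moreover have "nzd {f3} f2"
    unfolding f2_def using uv y3 by (intro nzd_minor) simp_all
  moreover have "nzd {f2, f3} f1"
    unfolding f1_def using uv y2 by (intro nzd_minor) simp_all
  moreover have "nzd {f1, f2, f3} f0"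
    unfolding f0_def using uv y1 by (intro nzd_minor) simp_all
  ultimately show ?thesis by simp
qed

lemma regseq_Y: "regseq {} [X y3, X y2, X y1, X y0]"
  by (auto intro!: nzd_fresh)

end

text \<open>
  If \<open>g p = j + k f\<close> with \<open>f\<close> the central binomial, then \<open>f k\<close> lies in the ideal of the prolonged
  arms, and hence \<open>k = k' + h g\<close> with \<open>f k' \<in> J\<close>.
\<close>

lemma (in arms) nzd_prolong:
  assumes prolonged: "arms y0 y1 y2 y3 u0 v0 u1 v1 u2 v2 u3 v3 (zs0 @ [(a, b)]) zs1 zs2 zs3"
  defines "g \<equiv> X (fst (last ((u0, v0) # zs0))) * X b - X (snd (last ((u0, v0) # zs0))) * X a"
  shows "arms.J y0 y1 y2 y3 u0 v0 u1 v1 u2 v2 u3 v3 (zs0 @ [(a, b)]) zs1 zs2 zs3 = insert g J"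
    and "nzd (insert center J) g"
proof -
  interpret pro: arms y0 y1 y2 y3 u0 v0 u1 v1 u2 v2 u3 v3 "zs0 @ [(a, b)]" zs1 zs2 zs3 "TYPE('k)"
    by (rule assms)
  have chain: "chain (X y0) (X y1) ((u0, v0) # zs0 @ [(a, b)]) = chain (X y0) (X y1) ((u0, v0) # zs0) @ [g]"
    using chain_append[of "(u0, v0) # zs0" "X y0" "X y1" a b] by (simp add: g_def)
  have "insert f0 pro.tail0 = insert g (insert f0 tail0)"
    using arg_cong[OF chain, of set] unfolding set_append chain_eqs pro.chain_eqs by auto
  then show proJ: "pro.J = insert g J"
    unfolding J_arms pro.J_arms by auto
  \<comment> \<open>Modulo the other three arms, the prolonged first arm is a regular sequence with
    \<open>g\<close> as its last member; hence \<open>g\<close> is regular modulo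
    \<open>J\<close>.\<close>
  have "regseq others (chain (X y0) (X y1) ((u0, v0) # zs0 @ [(a, b)]))"
  proof (rule regseq_chain[OF nzd_others])
    show "distinct (pvars ((u0, v0) # zs0 @ [(a, b)]))"
      by (rule pro.distinct_pvars)
    show "fresh z (insert (X y0) (insert (X y1) others))"
      if "z \<in> set (pvars ((u0, v0) # zs0 @ [(a, b)]))" for z
      using that[folded pro.P0_def] by (auto simp: others_def dest!: pro.separate)
  qed
  then have "nzd (set (chain (X y0) (X y1) ((u0, v0) # zs0)) \<union> others) g"
    unfolding chain regseq_append by simp
  moreover have "set (chain (X y0) (X y1) ((u0, v0) # zs0)) \<union> others = J"
    unfolding chain_eqs by (auto simp: J_arms others_def)
  ultimately have nzd_g: "nzd J g" by simp
  show "nzd (insert center J) g"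
    unfolding nzd_def
  proof (intro allI impI)
    fix p
    assume "g * p \<in> ispan (insert center J)"
    then obtain k j where k: "g * p = j + k * center" "j \<in> ispan J"
      by (rule ispan_insertE)
    \<comment> \<open>Seen in the ideal of the prolonged arms, the relation only says that
      \<open>center * k\<close> vanishes, so the colon formula for that ideal applies.\<close>
    have "center * k = p * g - j"
      using k(1) by (simp add: mult.commute)
    also have "\<dots> \<in> ispan pro.J"
      unfolding proJ by (intro ideal.span_diff ispan_mult_base ispan_mono[OF _ k(2)]) auto
    finally have "k \<in> ispan (insert \<Delta> pro.J)"
      using pro.colon_center by simp
    also have "insert \<Delta> pro.J = insert g (insert \<Delta> J)"
      unfolding proJ by auto
    finally obtain k' h where k': "k = k' + h * g" "k' \<in> ispan (insert \<Delta> J)"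
      by (rule ispan_insertE)
    have "g * (p - h * center) = j + center * k'"
      using k(1) unfolding k'(1) by (simp add: algebra_simps)
    also have "\<dots> \<in> ispan J"
      using k(2) k'(2) colon_center by (simp add: ideal.span_add)
    finally have "p - h * center \<in> ispan J"
      by (rule nzdD[OF nzd_g])
    then show "p \<in> ispan (insert center J)"
      by (rule ispan_insertI)
  qed
qed


section \<open>The subring of polynomials in given variables\<close>

abbreviation R :: "'v set \<Rightarrow> ('v, 'k::field) mpoly set"
  where "R V \<equiv> carrier (poly_ring V)"

lemma R_eq: "R V = {p. \<forall>m\<in>Poly_Mapping.keys p. Poly_Mapping.keys m \<subseteq> V}"
  by (simp add: poly_ring_def)

lemma R_iff_vars: "p \<in> R V \<longleftrightarrow> vars p \<subseteq> V"
  by (auto simp: R_eq vars_def)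

lemma R_zero [simp]: "0 \<in> R V" and R_one [simp]: "1 \<in> R V"
  by (simp_all add: R_eq)

lemma R_add: "p \<in> R V \<Longrightarrow> q \<in> R V \<Longrightarrow> p + q \<in> R V"
  unfolding R_iff_vars using vars_add[of p q] by blast

lemma R_mult: "p \<in> R V \<Longrightarrow> q \<in> R V \<Longrightarrow> p * q \<in> R V"
  unfolding R_iff_vars using vars_mult[of p q] by blast

lemma R_uminus: "p \<in> R V \<Longrightarrow> - p \<in> R V"
  by (simp add: R_iff_vars)

lemma R_diff: "p \<in> R V \<Longrightarrow> q \<in> R V \<Longrightarrow> p - q \<in> R V"
  unfolding R_iff_vars using vars_diff[of p q] by blast

lemma R_sum: "(\<And>x. x \<in> A \<Longrightarrow> f x \<in> R V) \<Longrightarrow> (\<Sum>x\<in>A. f x) \<in> R V"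
  by (induction A rule: infinite_finite_induct) (auto intro: R_add)

lemma R_wcomp: "p \<in> R V \<Longrightarrow> wcomp w d p \<in> R V"
  by (auto simp: R_eq wcomp_def keys_select)

lemma R_Var: "v \<in> V \<Longrightarrow> Var v \<in> R V"
  by (simp add: R_iff_vars)

abbreviation hcomp :: "int \<Rightarrow> ('v, 'k::field) mpoly \<Rightarrow> ('v, 'k) mpoly"
  where "hcomp \<equiv> wcomp unit_weight"

lemma const_coeff_zero [simp]: "const_coeff 0 = 0" and const_coeff_one [simp]: "const_coeff 1 = 1"
  by (simp_all add: const_coeff_def)

lemma const_coeff_add: "const_coeff (p + q) = const_coeff p + const_coeff q"
  by (simp add: const_coeff_def lookup_add)

lemma const_coeff_uminus: "const_coeff (- p) = - const_coeff p"
  by (simp add: const_coeff_def)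

lemma const_coeff_diff: "const_coeff (p - q) = const_coeff p - const_coeff q"
  by (simp add: const_coeff_def lookup_minus)

lemma const_coeff_sum: "const_coeff (\<Sum>x\<in>A. f x) = (\<Sum>x\<in>A. const_coeff (f x))"
  by (simp add: const_coeff_def lookup_sum)

lemma const_coeff_mult: "const_coeff (p * q) = const_coeff p * const_coeff q"
proof -
  have 1: "const_coeff (p * Poly_Mapping.single m c) = const_coeff p * const_coeff (Poly_Mapping.single m c)" for m c
  proof (induction p rule: poly_mapping_add_induct)
    case (single n d)
    have "n + m = 0 \<longleftrightarrow> n = 0 \<and> m = 0"
      by (auto simp: poly_mapping_eq_iff fun_eq_iff lookup_add)
    then show ?case
      by (auto simp: const_coeff_def mult_single lookup_single when_def)
  qed (simp_all add: const_coeff_add distrib_right)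
  show ?thesis
    by (induction q rule: poly_mapping_add_induct) (simp_all add: 1 const_coeff_add distrib_left)
qed

lemma const_coeff_homogeneous: "homogeneous d p \<Longrightarrow> const_coeff p \<noteq> 0 \<Longrightarrow> d = 0"
  by (auto simp: homogeneous_def const_coeff_def mon_degree_weight in_keys_iff dest!: bspec[of _ _ 0])

lemma homogeneous_0_const:
  assumes "homogeneous 0 p" "const_coeff p = 0"
  shows "p = 0"
proof (rule poly_mapping_eqI)
  fix m
  show "Poly_Mapping.lookup p m = Poly_Mapping.lookup 0 m"
  proof (cases "m \<in> Poly_Mapping.keys p")
    case True
    then have "mon_degree m = 0"
      using assms(1) by (auto simp: homogeneous_def)
    then have "m = 0"
      by (intro poly_mapping_eqI) (auto simp: mon_degree_def in_keys_iff)
    then show ?thesis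
      using assms(2) by (simp add: const_coeff_def)
  qed (simp add: in_keys_iff)
qed


section \<open>Matrices\<close>

text \<open>Coordinates from \<open>r\<close> on are set to zero, so that elements of a free module
  can be compared as functions.\<close>

definition mat_map :: "nat \<Rightarrow> nat \<Rightarrow> (nat \<Rightarrow> nat \<Rightarrow> 'a) \<Rightarrow> (nat \<Rightarrow> 'a) \<Rightarrow> nat \<Rightarrow> 'a::comm_ring_1"
  where "mat_map r s A u = (\<lambda>k. if k < r then \<Sum>l<s. A k l * u l else 0)"

definition unit_vec :: "nat \<Rightarrow> nat \<Rightarrow> 'a::comm_ring_1"
  where "unit_vec l = (\<lambda>k. if k = l then 1 else 0)"

lemma mat_map_unit_vec: "l < s \<Longrightarrow> mat_map r s A (unit_vec l) = (\<lambda>k. if k < r then A k l else 0)"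
  by (auto simp: mat_map_def unit_vec_def sum.delta if_distrib cong: if_cong)

lemma mat_map_comp:
  "mat_map r s A (mat_map s t B u) = mat_map r t (\<lambda>k l. \<Sum>m<s. A k m * B m l) u"
proof
  fix k
  have "(\<Sum>l<s. A k l * (\<Sum>m<t. B l m * u m)) = (\<Sum>l<s. \<Sum>m<t. A k l * B l m * u m)"
    by (simp add: sum_distrib_left mult.assoc)
  also have "\<dots> = (\<Sum>m<t. \<Sum>l<s. A k l * B l m * u m)"
    by (rule sum.swap)
  finally show "mat_map r s A (mat_map s t B u) k = mat_map r t (\<lambda>k l. \<Sum>m<s. A k m * B m l) u k"
    by (simp add: mat_map_def sum_distrib_right)
qed

lemma mat_map_cong:
  "(\<And>k l. k < r \<Longrightarrow> l < s \<Longrightarrow> A k l = B k l) \<Longrightarrow> (\<And>l. l < s \<Longrightarrow> u l = v l) \<Longrightarrow>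
    mat_map r s A u = mat_map r s B v"
  by (auto simp: mat_map_def intro!: sum.cong)

lemma mat_map_commute:
  assumes "\<And>k l. k < r \<Longrightarrow> l < t \<Longrightarrow> (\<Sum>m<s. A k m * B m l) = (\<Sum>m<s'. C k m * D m l)"
  shows "mat_map r s A (mat_map s t B u) = mat_map r s' C (mat_map s' t D u)"
  unfolding mat_map_comp using assms by (rule mat_map_cong) auto

lemma mat_map_add: "mat_map r s A (\<lambda>k. u k + v k) = (\<lambda>k. mat_map r s A u k + mat_map r s A v k)"
  by (auto simp: mat_map_def distrib_left sum.distrib)

lemma mat_map_diff: "mat_map r s A (\<lambda>k. u k - v k) = (\<lambda>k. mat_map r s A u k - mat_map r s A v k)"
  by (auto simp: mat_map_def right_diff_distrib sum_subtractf)

lemma mat_map_uminus: "mat_map r s A (\<lambda>k. - u k) = (\<lambda>k. - mat_map r s A u k)"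
  by (auto simp: mat_map_def sum_negf)

lemma mat_map_zero [simp]: "mat_map r s A (\<lambda>_. 0) = (\<lambda>_. 0)" "mat_map r s A 0 = 0"
  by (auto simp: mat_map_def fun_eq_iff)

lemma mat_map_add_mat:
  "mat_map r s (\<lambda>k l. A k l + B k l) u = (\<lambda>k. mat_map r s A u k + mat_map r s B u k)"
  by (auto simp: mat_map_def distrib_right sum.distrib)

lemma differential_mat_map: "differential F i = mat_map (rank F i) (rank F (Suc i)) (diff F i)"
  by (auto simp: differential_def mat_map_def fun_eq_iff)

lemma mat_map_differential_unit_vec:
  "k < r \<Longrightarrow> l < rank F (Suc i) \<Longrightarrow>
    mat_map r (rank F i) A (differential F i (unit_vec l)) k = (\<Sum>m<rank F i. A k m * diff F i m l)"
  unfolding differential_mat_map mat_map_comp by (simp add: mat_map_unit_vec)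

lemma tensor_differential_mat_map:
  "tensor_differential F i = mat_map (rank F i) (rank F (Suc i)) (\<lambda>k l. const_coeff (diff F i k l))"
  by (auto simp: tensor_differential_def mat_map_def fun_eq_iff)

definition fmod :: "'v set \<Rightarrow> nat \<Rightarrow> (nat \<Rightarrow> ('v, 'k::field) mpoly) set"
  where "fmod V n = {u. (\<forall>k<n. u k \<in> R V) \<and> (\<forall>k\<ge>n. u k = 0)}"

lemma free_mod_fmod: "free_mod V F i = fmod V (rank F i)"
  by (simp add: free_mod_def fmod_def)

lemma fmod_unit_vec: "l < n \<Longrightarrow> unit_vec l \<in> fmod V n"
  by (auto simp: fmod_def unit_vec_def)

lemma fmod_diff: "u \<in> fmod V n \<Longrightarrow> v \<in> fmod V n \<Longrightarrow> (\<lambda>k. u k - v k) \<in> fmod V n"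
  by (auto simp: fmod_def intro: R_diff)

lemma fmod_add: "u \<in> fmod V n \<Longrightarrow> v \<in> fmod V n \<Longrightarrow> (\<lambda>k. u k + v k) \<in> fmod V n"
  by (auto simp: fmod_def intro: R_add)

text \<open>Matrix of a homogeneous map of degree \<open>d\<close> between graded free modules, from
  the one with basis degrees \<open>cs\<close> to the one with basis degrees
  \<open>rs\<close>.\<close>

definition hmat :: "'v set \<Rightarrow> int list \<Rightarrow> int list \<Rightarrow> int \<Rightarrow> (nat \<Rightarrow> nat \<Rightarrow> ('v, 'k::field) mpoly) \<Rightarrow> bool"
  where "hmat V rs cs d A \<longleftrightarrow> (\<forall>k<length rs. \<forall>l<length cs.
    A k l \<in> R V \<and> homogeneous (cs ! l + d - rs ! k) (A k l))"

definition hvec :: "'v set \<Rightarrow> int list \<Rightarrow> int \<Rightarrow> (nat \<Rightarrow> ('v, 'k::field) mpoly) \<Rightarrow> bool"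
  where "hvec V sh e u \<longleftrightarrow> u \<in> fmod V (length sh) \<and> (\<forall>k<length sh. homogeneous (e - sh ! k) (u k))"

lemma mat_map_fmod:
  "hmat V rs cs d A \<Longrightarrow> u \<in> fmod V (length cs) \<Longrightarrow> mat_map (length rs) (length cs) A u \<in> fmod V (length rs)"
  by (auto simp: hmat_def fmod_def mat_map_def intro!: R_sum R_mult)

lemma hvec_column:
  "hmat V rs cs d A \<Longrightarrow> l < length cs \<Longrightarrow> hvec V rs (cs ! l + d) (mat_map (length rs) (length cs) A (unit_vec l))"
  by (auto simp: hmat_def hvec_def fmod_def mat_map_unit_vec)

lemma hvec_mat_map:
  assumes "hmat V rs cs d A" "hvec V cs e u"
  shows "hvec V rs (e + d) (mat_map (length rs) (length cs) A u)"
  unfolding hvec_def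
proof (intro conjI allI impI)
  show "mat_map (length rs) (length cs) A u \<in> fmod V (length rs)"
    using assms by (intro mat_map_fmod) (auto simp: hvec_def)
  fix k assume k: "k < length rs"
  have "homogeneous (e + d - rs ! k) (A k l * u l)" if "l < length cs" for l
    using assms k that whom_mult[of unit_weight "cs ! l + d - rs ! k" "A k l" "e - cs ! l" "u l"]
    by (auto simp: hmat_def hvec_def homogeneous_whom algebra_simps)
  then show "homogeneous (e + d - rs ! k) (mat_map (length rs) (length cs) A u k)"
    using k unfolding homogeneous_whom by (auto simp: mat_map_def intro: whom_sum)
qed

lemma hvec_diff: "hvec V sh e u \<Longrightarrow> hvec V sh e v \<Longrightarrow> hvec V sh e (\<lambda>k. u k - v k)"
  by (auto simp: hvec_def homogeneous_whom intro: fmod_diff whom_diff)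

definition hvec_comp :: "int list \<Rightarrow> int \<Rightarrow> (nat \<Rightarrow> ('v, 'k::field) mpoly) \<Rightarrow> nat \<Rightarrow> ('v, 'k) mpoly"
  where "hvec_comp sh e u = (\<lambda>k. if k < length sh then hcomp (e - sh ! k) (u k) else 0)"

lemma hvec_comp: "u \<in> fmod V (length sh) \<Longrightarrow> hvec V sh e (hvec_comp sh e u)"
  by (auto simp: hvec_def hvec_comp_def fmod_def homogeneous_whom intro: R_wcomp)

lemma hvec_comp_id: "hvec V sh e u \<Longrightarrow> hvec_comp sh e u = u"
  by (auto simp: hvec_def hvec_comp_def fmod_def homogeneous_whom wcomp_whom fun_eq_iff)

lemma hvec_comp_mat_map:
  assumes "hmat V rs cs d A"
  shows "mat_map (length rs) (length cs) A (hvec_comp cs e u) =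
    hvec_comp rs (e + d) (mat_map (length rs) (length cs) A u)"
proof
  fix k
  have "A k l * hcomp (e - cs ! l) (u l) = hcomp (e + d - rs ! k) (A k l * u l)"
    if "k < length rs" "l < length cs" for l
  proof -
    have "whom unit_weight (cs ! l + d - rs ! k) (A k l)"
      using assms that by (simp add: hmat_def homogeneous_whom)
    from wcomp_mult[OF this, of "e + d - rs ! k" "u l"]
    show ?thesis by (simp add: mult.commute)
  qed
  then show "mat_map (length rs) (length cs) A (hvec_comp cs e u) k =
      hvec_comp rs (e + d) (mat_map (length rs) (length cs) A u) k"
    by (auto simp: mat_map_def hvec_comp_def wcomp_sum intro: sum.cong)
qed


section \<open>Resolutions of cyclic modules\<close>

text \<open>\<open>resolves V I F\<close>: the complex \<open>\<dots> \<rightarrow> F\<^sub>1 \<rightarrow> F\<^sub>0 = S\<close> is a resolution of \<open>S/I\<close>; \<open>aug F\<close> plays no role.\<close>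

definition cycles :: "'v set \<Rightarrow> ('v, 'k::field) mpoly set \<Rightarrow> ('v, 'k) mpoly free_complex \<Rightarrow> nat \<Rightarrow>
    (nat \<Rightarrow> ('v, 'k) mpoly) set"
  where "cycles V I F i = (case i of
      0 \<Rightarrow> {u \<in> free_mod V F 0. u 0 \<in> I}
    | Suc n \<Rightarrow> {u \<in> free_mod V F (Suc n). differential F n u = 0})"

definition resolves :: "'v set \<Rightarrow> ('v, 'k::field) mpoly set \<Rightarrow> ('v, 'k) mpoly free_complex \<Rightarrow> bool"
  where "resolves V I F \<longleftrightarrow> shifts F 0 = [0] \<and>
    (\<forall>i. hmat V (shifts F i) (shifts F (Suc i)) 0 (diff F i)) \<and>
    (\<forall>i. cycles V I F i = differential F i ` free_mod V F (Suc i))"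

lemma resolvesD:
  assumes "resolves V I F"
  shows "shifts F 0 = [0]" "rank F 0 = 1" "hmat V (shifts F i) (shifts F (Suc i)) 0 (diff F i)"
    "cycles V I F i = differential F i ` free_mod V F (Suc i)"
  using assms by (simp_all add: resolves_def rank_def)

lemma cycles_free_mod: "u \<in> cycles V I F i \<Longrightarrow> u \<in> fmod V (rank F i)"
  by (auto simp: cycles_def free_mod_fmod split: nat.splits)

lemma boundary_cycle: "resolves V I F \<Longrightarrow> u \<in> fmod V (rank F (Suc i)) \<Longrightarrow> differential F i u \<in> cycles V I F i"
  by (simp add: resolvesD(4) free_mod_fmod)

text \<open>The differential preserves degrees, so any lift may be replaced by its component of
  degree \<open>e\<close>.\<close>

lemma homogeneous_lift:
  assumes F: "resolves V I F" and u: "u \<in> cycles V I F i" "hvec V (shifts F i) e u"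
  obtains v where "hvec V (shifts F (Suc i)) e v" "differential F i v = u"
proof -
  obtain v where v: "v \<in> fmod V (rank F (Suc i))" "differential F i v = u"
    using u(1) unfolding resolvesD(4)[OF F] free_mod_fmod by auto
  have "differential F i (hvec_comp (shifts F (Suc i)) e v) = hvec_comp (shifts F i) (e + 0) u"
    using hvec_comp_mat_map[OF resolvesD(3)[OF F]] v(2) unfolding differential_mat_map rank_def by metis
  also have "\<dots> = u"
    using u(2) hvec_comp_id by simp
  finally show thesis
    using v(1) by (intro that[OF hvec_comp]) (simp_all add: rank_def)
qed

text \<open>The step common to the construction of chain maps and of homotopies: cycles prescribed
  for the basis elements are lifted to the columns of a matrix.\<close>

lemma lift_columns:
  assumes G: "resolves V I G"
    and w: "\<And>l. l < length sh \<Longrightarrow> w l \<in> cycles V I G i \<and> hvec V (shifts G i) (sh ! l + d) (w l)"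
  obtains B where "hmat V (shifts G (Suc i)) sh d B"
    "\<And>k l. k < rank G i \<Longrightarrow> l < length sh \<Longrightarrow> (\<Sum>m<rank G (Suc i). diff G i k m * B m l) = w l k"
proof -
  have "\<exists>v. hvec V (shifts G (Suc i)) (sh ! l + d) v \<and> differential G i v = w l" if "l < length sh" for l
    using homogeneous_lift[OF G] w[OF that] by metis
  then obtain v where v: "\<And>l. l < length sh \<Longrightarrow> hvec V (shifts G (Suc i)) (sh ! l + d) (v l)"
    "\<And>l. l < length sh \<Longrightarrow> differential G i (v l) = w l"
    by metis
  show thesis
  proof (rule that[of "\<lambda>k l. v l k"])
    show "hmat V (shifts G (Suc i)) sh d (\<lambda>k l. v l k)"
      using v(1) by (auto simp: hmat_def hvec_def fmod_def)
    show "(\<Sum>m<rank G (Suc i). diff G i k m * v l m) = w l k" if "k < rank G i" "l < length sh" for k l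
      using fun_cong[OF v(2)[OF that(2)], of k] that(1) by (simp add: differential_def)
  qed
qed

definition chain_map :: "'v set \<Rightarrow> ('v, 'k::field) mpoly free_complex \<Rightarrow> ('v, 'k) mpoly free_complex \<Rightarrow> int \<Rightarrow>
    (nat \<Rightarrow> nat \<Rightarrow> nat \<Rightarrow> ('v, 'k) mpoly) \<Rightarrow> bool"
  where "chain_map V F G d \<Phi> \<longleftrightarrow>
    (\<forall>i. hmat V (shifts G i) (shifts F i) d (\<Phi> i)) \<and>
    (\<forall>i. \<forall>k<rank G i. \<forall>l<rank F (Suc i).
      (\<Sum>m<rank G (Suc i). diff G i k m * \<Phi> (Suc i) m l) = (\<Sum>m<rank F i. \<Phi> i k m * diff F i m l))"

abbreviation app :: "('v, 'k::field) mpoly free_complex \<Rightarrow> ('v, 'k) mpoly free_complex \<Rightarrow>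
    (nat \<Rightarrow> nat \<Rightarrow> nat \<Rightarrow> ('v, 'k) mpoly) \<Rightarrow> nat \<Rightarrow> (nat \<Rightarrow> ('v, 'k) mpoly) \<Rightarrow> nat \<Rightarrow> ('v, 'k) mpoly"
  where "app F G \<Phi> i \<equiv> mat_map (rank G i) (rank F i) (\<Phi> i)"

lemma chain_mapD:
  assumes "chain_map V F G d \<Phi>"
  shows "hmat V (shifts G i) (shifts F i) d (\<Phi> i)"
    "differential G i (app F G \<Phi> (Suc i) u) = app F G \<Phi> i (differential F i u)"
  using assms unfolding chain_map_def differential_mat_map
  by (auto intro!: mat_map_commute)

text \<open>The comparison theorem for multiplication by \<open>f\<close> from \<open>S/I\<close> to
  \<open>S/I'\<close>.\<close>

lemma exists_chain_map:
  assumes F: "resolves V I F" and G: "resolves V I' G"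
    and f: "f \<in> R V" "homogeneous d f" "\<And>p. p \<in> I \<Longrightarrow> f * p \<in> I'"
  obtains \<Phi> where "chain_map V F G d \<Phi>" "\<Phi> 0 0 0 = f"
proof -
  let ?map = "\<lambda>i A. mat_map (rank G i) (rank F i) A"
  \<comment> \<open>Cycles must go to cycles for the next lift to exist; this is the invariant of
    the recursive choice.\<close>
  let ?P = "\<lambda>i A. hmat V (shifts G i) (shifts F i) d A \<and> (i = 0 \<longrightarrow> A 0 0 = f) \<and>
    (\<forall>u\<in>cycles V I F i. ?map i A u \<in> cycles V I' G i)"
  let ?Q = "\<lambda>i A B. \<forall>k<rank G i. \<forall>l<rank F (Suc i).
      (\<Sum>m<rank G (Suc i). diff G i k m * B m l) = (\<Sum>m<rank F i. A k m * diff F i m l)"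
  have "\<exists>\<Phi>. \<forall>i. ?P i (\<Phi> i) \<and> ?Q i (\<Phi> i) (\<Phi> (Suc i))"
  proof (rule dependent_nat_choice)
    have "?P 0 (\<lambda>_ _. f)"
      using resolvesD(1,2)[OF F] resolvesD(1,2)[OF G] f
      by (auto simp: hmat_def cycles_def free_mod_fmod fmod_def mat_map_def intro: R_mult)
    then show "\<exists>A. ?P 0 A" by blast
  next
    fix A i
    assume A: "?P i A"
    let ?w = "\<lambda>l. ?map i A (differential F i (unit_vec l))"
    have "?w l \<in> cycles V I' G i \<and> hvec V (shifts G i) (shifts F (Suc i) ! l + d) (?w l)"
      if "l < length (shifts F (Suc i))" for l
    proof
      show "?w l \<in> cycles V I' G i"
        using A boundary_cycle[OF F fmod_unit_vec, of l i] that by (simp add: rank_def)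
      have "hvec V (shifts F i) (shifts F (Suc i) ! l + 0) (differential F i (unit_vec l))"
        using hvec_column[OF resolvesD(3)[OF F] that] by (simp add: differential_mat_map rank_def)
      from hvec_mat_map[OF conjunct1[OF A] this]
      show "hvec V (shifts G i) (shifts F (Suc i) ! l + d) (?w l)"
        by (simp add: rank_def)
    qed
    from lift_columns[OF G this] obtain B where
      B: "hmat V (shifts G (Suc i)) (shifts F (Suc i)) d B"
        "\<And>k l. k < rank G i \<Longrightarrow> l < length (shifts F (Suc i)) \<Longrightarrow>
          (\<Sum>m<rank G (Suc i). diff G i k m * B m l) = ?w l k"
      by blast
    have Q: "?Q i A B"
      using B(2) by (auto simp: rank_def[of F "Suc i", symmetric] mat_map_differential_unit_vec mat_map_unit_vec)
    have "?map (Suc i) B u \<in> cycles V I' G (Suc i)" if u: "u \<in> cycles V I F (Suc i)" for u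
    proof -
      have "?map (Suc i) B u \<in> fmod V (rank G (Suc i))"
        using mat_map_fmod[OF B(1)] cycles_free_mod[OF u] by (simp add: rank_def)
      moreover have "differential G i (?map (Suc i) B u) = ?map i A (differential F i u)"
        unfolding differential_mat_map using Q by (intro mat_map_commute) auto
      moreover have "differential F i u = 0"
        using u by (simp add: cycles_def)
      ultimately show ?thesis
        by (simp add: cycles_def free_mod_fmod)
    qed
    then show "\<exists>B. ?P (Suc i) B \<and> ?Q i A B"
      using B(1) Q by blast
  qed
  then obtain \<Phi> where "\<And>i. ?P i (\<Phi> i) \<and> ?Q i (\<Phi> i) (\<Phi> (Suc i))" by blast
  then show thesis
    by (intro that[of \<Phi>]) (auto simp: chain_map_def)
qed

text \<open>The chain map lifts the zero map from \<open>S/I\<close> to \<open>S/I'\<close>, hence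
  is homotopic to zero.\<close>

lemma null_homotopic:
  assumes F: "resolves V I F" and G: "resolves V I' G" and \<Phi>: "chain_map V F G d \<Phi>"
    and 0: "\<Phi> 0 0 0 \<in> I'"
  obtains h where "\<And>i. hmat V (shifts G (Suc i)) (shifts F i) d (h i)"
    "\<And>i k l. k < rank G (Suc i) \<Longrightarrow> l < rank F (Suc i) \<Longrightarrow> \<Phi> (Suc i) k l =
      (\<Sum>m<rank G (Suc (Suc i)). diff G (Suc i) k m * h (Suc i) m l) +
      (\<Sum>m<rank F i. h i k m * diff F i m l)"
proof -
  let ?map = "\<lambda>i A. mat_map (rank G (Suc i)) (rank F i) A"
  \<comment> \<open>On cycles the second term of the homotopy vanishes, so there the chain map must
    agree with the differential after \<open>A\<close>.\<close>
  let ?P = "\<lambda>i A. hmat V (shifts G (Suc i)) (shifts F i) d A \<and>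
    (\<forall>u\<in>cycles V I F i. app F G \<Phi> i u = differential G i (?map i A u))"
  let ?Q = "\<lambda>i A B. \<forall>k<rank G (Suc i). \<forall>l<rank F (Suc i). \<Phi> (Suc i) k l =
      (\<Sum>m<rank G (Suc (Suc i)). diff G (Suc i) k m * B m l) +
      (\<Sum>m<rank F i. A k m * diff F i m l)"
  have "\<exists>h. \<forall>i. ?P i (h i) \<and> ?Q i (h i) (h (Suc i))"
  proof (rule dependent_nat_choice)
    have "app F G \<Phi> 0 (unit_vec l) \<in> cycles V I' G 0 \<and>
        hvec V (shifts G 0) (shifts F 0 ! l + d) (app F G \<Phi> 0 (unit_vec l))"
      if l: "l < length (shifts F 0)" for l
    proof
      show *: "hvec V (shifts G 0) (shifts F 0 ! l + d) (app F G \<Phi> 0 (unit_vec l))"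
        using hvec_column[OF chain_mapD(1)[OF \<Phi>] l] by (simp add: rank_def)
      show "app F G \<Phi> 0 (unit_vec l) \<in> cycles V I' G 0"
        using * 0 l resolvesD(1,2)[OF F] resolvesD(1,2)[OF G]
        by (auto simp: cycles_def hvec_def free_mod_fmod rank_def mat_map_unit_vec)
    qed
    from lift_columns[OF G this] obtain B where
      B: "hmat V (shifts G (Suc 0)) (shifts F 0) d B"
        "\<And>k l. k < rank G 0 \<Longrightarrow> l < length (shifts F 0) \<Longrightarrow>
          (\<Sum>m<rank G (Suc 0). diff G 0 k m * B m l) = app F G \<Phi> 0 (unit_vec l) k"
      by blast
    have "app F G \<Phi> 0 u = differential G 0 (?map 0 B u)" for u
      unfolding differential_mat_map mat_map_comp
      by (rule mat_map_cong) (auto simp: B(2) rank_def[of F 0, symmetric] mat_map_unit_vec)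
    then show "\<exists>A. ?P 0 A" using B(1) by blast
  next
    fix A i
    assume A: "?P i A"
    let ?w = "\<lambda>l k. app F G \<Phi> (Suc i) (unit_vec l) k - ?map i A (differential F i (unit_vec l)) k"
    have "?w l \<in> cycles V I' G (Suc i) \<and> hvec V (shifts G (Suc i)) (shifts F (Suc i) ! l + d) (?w l)"
      if l: "l < length (shifts F (Suc i))" for l
    proof
      have cyc: "differential F i (unit_vec l) \<in> cycles V I F i"
        using boundary_cycle[OF F fmod_unit_vec, of l i] l by (simp add: rank_def)
      have "hvec V (shifts F i) (shifts F (Suc i) ! l + 0) (differential F i (unit_vec l))"
        using hvec_column[OF resolvesD(3)[OF F] l] by (simp add: differential_mat_map rank_def)
      from hvec_mat_map[OF conjunct1[OF A] this]
      have "hvec V (shifts G (Suc i)) (shifts F (Suc i) ! l + d) (?map i A (differential F i (unit_vec l)))"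
        by (simp add: rank_def)
      then show *: "hvec V (shifts G (Suc i)) (shifts F (Suc i) ! l + d) (?w l)"
        using hvec_column[OF chain_mapD(1)[OF \<Phi>] l] by (intro hvec_diff) (simp_all add: rank_def)
      have "differential G i (?w l) = (\<lambda>k. app F G \<Phi> i (differential F i (unit_vec l)) k -
          differential G i (?map i A (differential F i (unit_vec l))) k)"
        unfolding differential_mat_map mat_map_diff
        unfolding differential_mat_map[symmetric] chain_mapD(2)[OF \<Phi>] ..
      also have "\<dots> = 0"
        using A cyc by (auto simp: fun_eq_iff)
      finally show "?w l \<in> cycles V I' G (Suc i)"
        using * by (simp add: cycles_def hvec_def free_mod_fmod rank_def)
    qed
    from lift_columns[OF G this] obtain B where
      B: "hmat V (shifts G (Suc (Suc i))) (shifts F (Suc i)) d B"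
        "\<And>k l. k < rank G (Suc i) \<Longrightarrow> l < length (shifts F (Suc i)) \<Longrightarrow>
          (\<Sum>m<rank G (Suc (Suc i)). diff G (Suc i) k m * B m l) = ?w l k"
      by blast
    have Q: "?Q i A B"
      using B(2) by (auto simp: rank_def[of F "Suc i", symmetric] mat_map_differential_unit_vec mat_map_unit_vec)
    have "app F G \<Phi> (Suc i) u = differential G (Suc i) (?map (Suc i) B u)" if u: "u \<in> cycles V I F (Suc i)" for u
    proof -
      have "app F G \<Phi> (Suc i) u = (\<lambda>k. differential G (Suc i) (?map (Suc i) B u) k + ?map i A (differential F i u) k)"
        unfolding differential_mat_map mat_map_comp mat_map_add_mat[symmetric]
        using Q by (intro mat_map_cong) auto
      moreover have "differential F i u = 0"
        using u by (simp add: cycles_def)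
      ultimately show ?thesis by simp
    qed
    then show "\<exists>B. ?P (Suc i) B \<and> ?Q i A B"
      using B(1) Q by blast
  qed
  then obtain h where "\<And>i. ?P i (h i) \<and> ?Q i (h i) (h (Suc i))" by blast
  then show thesis
    by (intro that[of h]) auto
qed


section \<open>Tensoring with the residue field\<close>

abbreviation cmat :: "(nat \<Rightarrow> nat \<Rightarrow> ('v, 'k::field) mpoly) \<Rightarrow> nat \<Rightarrow> nat \<Rightarrow> 'k"
  where "cmat A \<equiv> \<lambda>k l. const_coeff (A k l)"

definition tcomp :: "int list \<Rightarrow> int \<Rightarrow> (nat \<Rightarrow> 'k::field) set"
  where "tcomp sh j = {w. \<forall>k. w k \<noteq> 0 \<longrightarrow> k < length sh \<and> sh ! k = j}"

lemma tensor_comp_tcomp: "tensor_comp F i j = tcomp (shifts F i) j"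
  by (simp add: tensor_comp_def tcomp_def rank_def)

lemma tcomp_mat_map:
  assumes "hmat V rs cs d A" "w \<in> tcomp cs j"
  shows "mat_map (length rs) (length cs) (cmat A) w \<in> tcomp rs (j + d)"
  unfolding tcomp_def
proof (intro CollectI allI impI)
  fix k
  assume nz: "mat_map (length rs) (length cs) (cmat A) w k \<noteq> 0"
  then have k: "k < length rs" by (auto simp: mat_map_def split: if_splits)
  with nz obtain l where l: "l < length cs" "const_coeff (A k l) * w l \<noteq> 0"
    by (auto simp: mat_map_def elim: sum.not_neutral_contains_not_neutral)
  have "cs ! l + d - rs ! k = 0"
    using assms(1) k l by (intro const_coeff_homogeneous[of _ "A k l"]) (auto simp: hmat_def)
  then show "k < length rs \<and> rs ! k = j + d"
    using k l assms(2) by (auto simp: tcomp_def)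
qed

lemma tcomp_diff: "u \<in> tcomp sh j \<Longrightarrow> v \<in> tcomp sh j \<Longrightarrow> (\<lambda>k. u k - v k) \<in> tcomp sh j"
  unfolding tcomp_def by (auto simp: ) (metis diff_0_right)+

lemma chain_map_cmat:
  assumes "chain_map V F G d \<Phi>"
  shows "tensor_differential G i (mat_map (rank G (Suc i)) (rank F (Suc i)) (cmat (\<Phi> (Suc i))) w) =
    mat_map (rank G i) (rank F i) (cmat (\<Phi> i)) (tensor_differential F i w)"
  unfolding tensor_differential_mat_map
proof (rule mat_map_commute)
  fix k l assume "k < rank G i" "l < rank F (Suc i)"
  then have "const_coeff (\<Sum>m<rank G (Suc i). diff G i k m * \<Phi> (Suc i) m l) =
      const_coeff (\<Sum>m<rank F i. \<Phi> i k m * diff F i m l)"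
    using assms by (simp add: chain_map_def)
  then show "(\<Sum>m<rank G (Suc i). const_coeff (diff G i k m) * const_coeff (\<Phi> (Suc i) m l)) =
      (\<Sum>m<rank F i. const_coeff (\<Phi> i k m) * const_coeff (diff F i m l))"
    by (simp add: const_coeff_sum const_coeff_mult)
qed

lemma differential_differential:
  assumes "resolves V I F" "u \<in> fmod V (rank F (Suc (Suc i)))"
  shows "differential F i (differential F (Suc i) u) = 0"
  using boundary_cycle[OF assms] by (simp add: cycles_def)

lemma tensor_differential_differential:
  assumes F: "resolves V I F"
  shows "tensor_differential F i (tensor_differential F (Suc i) w) = 0"
proof -
  have "(\<Sum>m<rank F (Suc i). diff F i k m * diff F (Suc i) m l) = 0"
    if "k < rank F i" "l < rank F (Suc (Suc i))" for k l
  proof -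
    have "differential F i (differential F (Suc i) (unit_vec l)) k = 0"
      using differential_differential[OF F fmod_unit_vec, of l i] that by simp
    then show ?thesis
      using that unfolding differential_mat_map[of F i] by (simp add: mat_map_differential_unit_vec)
  qed
  then have "const_coeff (\<Sum>m<rank F (Suc i). diff F i k m * diff F (Suc i) m l) = 0"
    if "k < rank F i" "l < rank F (Suc (Suc i))" for k l
    using that by simp
  then show ?thesis
    unfolding tensor_differential_mat_map mat_map_comp
    by (auto simp: const_coeff_sum const_coeff_mult mat_map_def fun_eq_iff)
qed

lemma tensor_boundaries_subset_cycles:
  assumes F: "resolves V I F"
  shows "tensor_boundaries F i j \<subseteq> tensor_cycles F i j"
proof
  fix w assume "w \<in> tensor_boundaries F i j"
  then obtain y where y: "y \<in> tcomp (shifts F (Suc i)) j" "w = tensor_differential F i y"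
    by (auto simp: tensor_boundaries_def tensor_comp_tcomp)
  have "w \<in> tcomp (shifts F i) j"
    using tcomp_mat_map[OF resolvesD(3)[OF F] y(1)] by (simp add: y(2) tensor_differential_mat_map rank_def)
  then show "w \<in> tensor_cycles F i j"
    using tensor_differential_differential[OF F] y(2)
    by (auto simp: tensor_cycles_def tensor_comp_tcomp split: nat.splits)
qed

text \<open>For a resolution of \<open>S/I\<close>: the degree \<open>j\<close> part of
  \<open>Tor_i(S/I, K)\<close> is zero, stated without dimensions.\<close>

definition tor_vanishes :: "('v, 'k::field) mpoly free_complex \<Rightarrow> nat \<Rightarrow> int \<Rightarrow> bool"
  where "tor_vanishes F i j \<longleftrightarrow> tensor_cycles F i j \<subseteq> tensor_boundaries F i j"

lemma chain_mapI:
  assumes "\<And>i. hmat V (shifts G i) (shifts F i) d (\<Phi> i)"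
    "\<And>i l. l < rank F (Suc i) \<Longrightarrow>
      differential G i (app F G \<Phi> (Suc i) (unit_vec l)) = app F G \<Phi> i (differential F i (unit_vec l))"
  shows "chain_map V F G d \<Phi>"
  unfolding chain_map_def
proof (intro conjI allI impI assms)
  fix i k l assume kl: "k < rank G i" "l < rank F (Suc i)"
  show "(\<Sum>m<rank G (Suc i). diff G i k m * \<Phi> (Suc i) m l) = (\<Sum>m<rank F i. \<Phi> i k m * diff F i m l)"
    using fun_cong[OF assms(2)[OF kl(2)], of k] kl
    unfolding differential_mat_map mat_map_comp by (simp add: mat_map_unit_vec)
qed

text \<open>Lift the identity to \<open>\<alpha>\<close> and \<open>\<beta>\<close> in the two
  directions; then \<open>\<beta> \<alpha> - id\<close> has a null-homotopy \<open>h\<close>. A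
  cycle \<open>w\<close> of the tensored complex is \<open>\<beta> \<alpha> w\<close> minus the
  boundary of \<open>h w\<close>, and \<open>\<alpha> w\<close> is a boundary by hypothesis.\<close>

lemma tor_vanishes_transfer:
  assumes F: "resolves V I F" and G: "resolves V I G" and van: "tor_vanishes G (Suc i) j"
  shows "tor_vanishes F (Suc i) j"
proof -
  obtain \<alpha> where \<alpha>: "chain_map V F G 0 \<alpha>" "\<alpha> 0 0 0 = 1"
    by (rule exists_chain_map[OF F G, of 1 0]) (auto simp: homogeneous_whom)
  obtain \<beta> where \<beta>: "chain_map V G F 0 \<beta>" "\<beta> 0 0 0 = 1"
    by (rule exists_chain_map[OF G F, of 1 0]) (auto simp: homogeneous_whom)
  define \<chi> where "\<chi> i k l = (\<Sum>m<rank G i. \<beta> i k m * \<alpha> i m l) - (if k = l then 1 else 0)" for i k l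
  have app_\<chi>: "app F F \<chi> i u = (\<lambda>k. app G F \<beta> i (app F G \<alpha> i u) k - (if k < rank F i then u k else 0))" for i u
  proof
    fix k
    have "(\<Sum>l<rank F i. \<chi> i k l * u l) =
        (\<Sum>l<rank F i. (\<Sum>m<rank G i. \<beta> i k m * \<alpha> i m l) * u l) - (\<Sum>l<rank F i. if k = l then u l else 0)"
      unfolding sum_subtractf[symmetric] by (intro sum.cong) (auto simp: \<chi>_def algebra_simps)
    then show "app F F \<chi> i u k = app G F \<beta> i (app F G \<alpha> i u) k - (if k < rank F i then u k else 0)"
      unfolding mat_map_comp by (simp add: mat_map_def)
  qed
  have \<chi>: "chain_map V F F 0 \<chi>"
  proof (rule chain_mapI)
    fix i
    have "\<chi> i k l \<in> R V \<and> homogeneous (shifts F i ! l - shifts F i ! k) (\<chi> i k l)"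
      if "k < length (shifts F i)" "l < length (shifts F i)" for k l
    proof
      note h = chain_mapD(1)[OF \<alpha>(1), of i] chain_mapD(1)[OF \<beta>(1), of i]
      have "whom unit_weight (shifts F i ! l - shifts F i ! k) (\<beta> i k m * \<alpha> i m l)" if "m < rank G i" for m
        using whom_mult[of unit_weight "shifts G i ! m - shifts F i ! k" "\<beta> i k m" "shifts F i ! l - shifts G i ! m" "\<alpha> i m l"]
          h that \<open>k < _\<close> \<open>l < _\<close> by (auto simp: hmat_def homogeneous_whom rank_def)
      then show "homogeneous (shifts F i ! l - shifts F i ! k) (\<chi> i k l)"
        unfolding homogeneous_whom \<chi>_def by (intro whom_diff whom_sum) auto
      show "\<chi> i k l \<in> R V"
        using h that unfolding \<chi>_def by (intro R_diff R_sum R_mult) (auto simp: hmat_def rank_def)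
    qed
    then show "hmat V (shifts F i) (shifts F i) 0 (\<chi> i)"
      by (simp add: hmat_def)
    fix l
    assume l: "l < rank F (Suc i)"
    have 1: "(if k < rank F (Suc i) then unit_vec l k else 0) = (unit_vec l k :: ('a, 'b) mpoly)" for k
      using l by (auto simp: unit_vec_def)
    have 2: "(if k < rank F i then differential F i (unit_vec l) k else 0) = differential F i (unit_vec l) k" for k
      by (auto simp: differential_def)
    show "differential F i (app F F \<chi> (Suc i) (unit_vec l)) = app F F \<chi> i (differential F i (unit_vec l))"
      unfolding app_\<chi> chain_mapD(2)[OF \<alpha>(1), symmetric] chain_mapD(2)[OF \<beta>(1), symmetric] 1 2
      unfolding differential_mat_map mat_map_diff ..
  qed
  have "\<chi> 0 0 0 = 0"
    using resolvesD(2)[OF F] resolvesD(2)[OF G] \<alpha>(2) \<beta>(2) by (simp add: \<chi>_def)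
  moreover have "0 \<in> I"
  proof -
    have "differential F 0 0 \<in> cycles V I F 0"
      by (rule boundary_cycle[OF F]) (auto simp: fmod_def)
    then show ?thesis by (simp add: cycles_def differential_mat_map)
  qed
  ultimately have "\<chi> 0 0 0 \<in> I" by simp
  then obtain h where h: "\<And>i. hmat V (shifts F (Suc i)) (shifts F i) 0 (h i)"
    "\<And>i k l. k < rank F (Suc i) \<Longrightarrow> l < rank F (Suc i) \<Longrightarrow> \<chi> (Suc i) k l =
      (\<Sum>m<rank F (Suc (Suc i)). diff F (Suc i) k m * h (Suc i) m l) +
      (\<Sum>m<rank F i. h i k m * diff F i m l)"
    by (rule null_homotopic[OF F F \<chi>]) (rule that)
  let ?n = "Suc i"
  have "w \<in> tensor_boundaries F ?n j" if w: "w \<in> tensor_cycles F ?n j" for w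
  proof -
    have w': "w \<in> tcomp (shifts F ?n) j" "tensor_differential F i w = 0"
      using w by (simp_all add: tensor_cycles_def tensor_comp_tcomp)
    let ?a = "mat_map (rank G ?n) (rank F ?n) (cmat (\<alpha> ?n)) w"
    have "?a \<in> tensor_cycles G ?n j"
      using tcomp_mat_map[OF chain_mapD(1)[OF \<alpha>(1)] w'(1)] chain_map_cmat[OF \<alpha>(1), of i w] w'(2)
      by (simp add: tensor_cycles_def tensor_comp_tcomp rank_def)
    then obtain y where y: "y \<in> tcomp (shifts G (Suc ?n)) j" "?a = tensor_differential G ?n y"
      using van by (auto simp: tor_vanishes_def tensor_boundaries_def tensor_comp_tcomp)
    let ?b = "mat_map (rank F (Suc ?n)) (rank G (Suc ?n)) (cmat (\<beta> (Suc ?n))) y"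
    let ?c = "mat_map (rank F (Suc ?n)) (rank F ?n) (cmat (h ?n)) w"
    have "mat_map (rank F ?n) (rank G ?n) (cmat (\<beta> ?n)) ?a = tensor_differential F ?n ?b"
      unfolding y(2) chain_map_cmat[OF \<beta>(1)] ..
    moreover have "mat_map (rank F ?n) (rank G ?n) (cmat (\<beta> ?n)) ?a k - w k =
        tensor_differential F ?n ?c k + mat_map (rank F ?n) (rank F i) (cmat (h i)) (tensor_differential F i w) k" for k
    proof (cases "k < rank F ?n")
      case True
      have 1: "const_coeff (\<chi> ?n k l) = (\<Sum>m<rank F (Suc ?n). const_coeff (diff F ?n k m) * const_coeff (h ?n m l)) +
          (\<Sum>m<rank F i. const_coeff (h i k m) * const_coeff (diff F i m l))" if "l < rank F ?n" for l
        using h(2)[OF True that] by (simp add: const_coeff_add const_coeff_sum const_coeff_mult)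
      have 2: "const_coeff (\<chi> ?n k l) = (\<Sum>m<rank G ?n. const_coeff (\<beta> ?n k m) * const_coeff (\<alpha> ?n m l)) -
          (if k = l then 1 else 0)" for l
        by (simp add: \<chi>_def const_coeff_diff const_coeff_sum const_coeff_mult)
      have eq: "(\<Sum>m<rank G ?n. const_coeff (\<beta> ?n k m) * const_coeff (\<alpha> ?n m l)) =
          (\<Sum>m<rank F (Suc ?n). const_coeff (diff F ?n k m) * const_coeff (h ?n m l)) +
          (\<Sum>m<rank F i. const_coeff (h i k m) * const_coeff (diff F i m l)) + (if k = l then 1 else 0)"
        if "l < rank F ?n" for l
        using 1[OF that] unfolding 2 diff_eq_eq .
      have "(\<Sum>l<rank F ?n. (if k = l then 1 else 0) * w l) = w k"
        using True by (simp add: sum.delta if_distrib[of "\<lambda>x. x * _"] cong: if_cong)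
      then show ?thesis
        using True unfolding tensor_differential_mat_map mat_map_comp
        by (simp add: mat_map_def eq distrib_right sum.distrib)
    next
      case False
      then show ?thesis
        using w'(1) by (auto simp: mat_map_def tensor_differential_mat_map tcomp_def rank_def)
    qed
    ultimately have "w = (\<lambda>k. tensor_differential F ?n ?b k - tensor_differential F ?n ?c k)"
      using w'(2) by (auto simp: fun_eq_iff algebra_simps)
    also have "\<dots> = tensor_differential F ?n (\<lambda>k. ?b k - ?c k)"
      by (simp add: tensor_differential_mat_map mat_map_diff)
    finally have "w = tensor_differential F ?n (\<lambda>k. ?b k - ?c k)" .
    moreover have "(\<lambda>k. ?b k - ?c k) \<in> tcomp (shifts F (Suc ?n)) j"
      using tcomp_mat_map[OF chain_mapD(1)[OF \<beta>(1)] y(1)] tcomp_mat_map[OF h(1) w'(1)]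
      by (intro tcomp_diff) (simp_all add: rank_def)
    ultimately show ?thesis
      by (auto simp: tensor_boundaries_def tensor_comp_tcomp)
  qed
  then show ?thesis by (auto simp: tor_vanishes_def)
qed


section \<open>Regularity\<close>

interpretation kvec: vector_space "scale_fun :: 'k::field \<Rightarrow> (nat \<Rightarrow> 'k) \<Rightarrow> nat \<Rightarrow> 'k"
  by (rule vector_space_scale_fun)

text \<open>Extend a basis of \<open>B\<close> to a maximal independent subset of \<open>Z\<close>.
  If the latter is no larger, the two coincide, and \<open>Z\<close> lies in the span of the basis
  of \<open>B\<close>.\<close>

lemma dim_diff_eq_0:
  fixes Z B :: "(nat \<Rightarrow> 'k::field) set"
  assumes B: "kvec.subspace B" "B \<subseteq> Z" and fin: "finite W" "Z \<subseteq> kvec.span W"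
  shows "kvec.dim Z - kvec.dim B = 0 \<longleftrightarrow> Z \<subseteq> B"
proof
  obtain b where b: "b \<subseteq> B" "kvec.independent b" "B \<subseteq> kvec.span b" "card b = kvec.dim B"
    by (rule kvec.basis_exists)
  have "b \<subseteq> Z" using b(1) B(2) by blast
  then obtain c where c: "b \<subseteq> c" "c \<subseteq> Z" "kvec.independent c" "Z \<subseteq> kvec.span c"
    using kvec.maximal_independent_subset_extend b(2) by metis
  have "finite c"
    using kvec.independent_span_bound[OF fin(1) c(3)] c(2) fin(2) by blast
  have dimZ: "kvec.dim Z = card c"
    using c by (intro kvec.basis_card_eq_dim[symmetric])
  assume "kvec.dim Z - kvec.dim B = 0"
  then have "card c \<le> card b" using dimZ b(4) by simp
  then have "b = c"
    using \<open>finite c\<close> c(1) by (intro card_seteq)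
  then show "Z \<subseteq> B"
    using c(4) b(1) B(1) kvec.span_minimal by blast
next
  assume "Z \<subseteq> B"
  then have "Z = B" using B(2) by blast
  then show "kvec.dim Z - kvec.dim B = 0" by simp
qed

lemma sum_fun_apply: "(\<Sum>x\<in>A. f x) k = (\<Sum>x\<in>A. f x k)"
  by (induction A rule: infinite_finite_induct) auto

lemma scale_fun_unit_vec_span:
  assumes "w \<in> tcomp sh j"
  shows "w \<in> kvec.span (unit_vec ` {..<length sh})"
proof -
  have "w = (\<Sum>l<length sh. scale_fun (w l) (unit_vec l))"
  proof
    fix k
    have "(\<Sum>l<length sh. scale_fun (w l) (unit_vec l)) k = (\<Sum>l<length sh. if k = l then w l else 0)"
      by (simp add: sum_fun_apply scale_fun_def unit_vec_def if_distrib cong: if_cong)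
    then show "w k = (\<Sum>l<length sh. scale_fun (w l) (unit_vec l)) k"
      using assms by (auto simp: sum.delta tcomp_def)
  qed
  also have "\<dots> \<in> kvec.span (unit_vec ` {..<length sh})"
    by (intro kvec.span_sum kvec.span_scale kvec.span_base) auto
  finally show ?thesis .
qed

text \<open>Inserting \<open>S\<close> in position 0 turns a resolution of \<open>I\<close> into one
  of \<open>S/I\<close>. For \<open>I\<close> inside the maximal ideal this identifies
  \<open>Tor_i(I, K)\<close> with \<open>Tor_{i+1}(S/I, K)\<close>.\<close>

definition extend_complex :: "('v, 'k::field) mpoly free_complex \<Rightarrow> ('v, 'k) mpoly free_complex"
  where "extend_complex F = \<lparr>shifts = (\<lambda>i. case i of 0 \<Rightarrow> [0] | Suc n \<Rightarrow> shifts F n),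
    diff = (\<lambda>i. case i of 0 \<Rightarrow> (\<lambda>k l. aug F l) | Suc n \<Rightarrow> diff F n), aug = (\<lambda>_. 0)\<rparr>"

definition truncate_complex :: "('v, 'k::field) mpoly free_complex \<Rightarrow> ('v, 'k) mpoly free_complex"
  where "truncate_complex G = \<lparr>shifts = (\<lambda>i. shifts G (Suc i)), diff = (\<lambda>i. diff G (Suc i)), aug = (\<lambda>l. diff G 0 0 l)\<rparr>"

lemma extend_complex_simps [simp]:
  "shifts (extend_complex F) 0 = [0]" "shifts (extend_complex F) (Suc i) = shifts F i"
  "diff (extend_complex F) 0 = (\<lambda>k l. aug F l)" "diff (extend_complex F) (Suc i) = diff F i"
  "rank (extend_complex F) 0 = 1" "rank (extend_complex F) (Suc i) = rank F i"
  "differential (extend_complex F) (Suc i) = differential F i"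
  "tensor_differential (extend_complex F) (Suc i) = tensor_differential F i"
  by (simp_all add: extend_complex_def rank_def differential_def tensor_differential_def fun_eq_iff)

lemma truncate_complex_simps [simp]:
  "shifts (truncate_complex G) i = shifts G (Suc i)" "diff (truncate_complex G) i = diff G (Suc i)"
  "aug (truncate_complex G) = (\<lambda>l. diff G 0 0 l)" "rank (truncate_complex G) i = rank G (Suc i)"
  "differential (truncate_complex G) i = differential G (Suc i)"
  by (simp_all add: truncate_complex_def rank_def differential_def fun_eq_iff)

lemma differential_extend_0: "differential (extend_complex F) 0 u = (\<lambda>k. if k = 0 then augmentation F u else 0)"
  by (auto simp: differential_def augmentation_def)

lemma resolves_extend:
  assumes "graded_free_resolution V I F"
  shows "resolves V I (extend_complex F)"
  unfolding resolves_def
proof (intro conjI allI)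
  note F = assms[unfolded graded_free_resolution_def free_mod_fmod]
  fix i
  show "hmat V (shifts (extend_complex F) i) (shifts (extend_complex F) (Suc i)) 0 (diff (extend_complex F) i)"
    using F by (cases i) (auto simp: hmat_def rank_def)
  have aug: "augmentation F u \<in> I \<and> augmentation F u \<in> R V" if "u \<in> fmod V (rank F 0)" for u
    using F that by (auto simp: augmentation_def fmod_def intro!: R_sum R_mult)
  show "cycles V I (extend_complex F) i = differential (extend_complex F) i ` free_mod V (extend_complex F) (Suc i)"
  proof (cases i)
    case 0
    have "u \<in> (\<lambda>u k. if k = 0 then augmentation F u else 0) ` fmod V (rank F 0)"
      if u: "u \<in> fmod V 1" "u 0 \<in> I" for u
    proof -
      obtain x where "x \<in> fmod V (rank F 0)" "u 0 = augmentation F x"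
        using F u(2) by auto
      moreover have "u = (\<lambda>k. if k = 0 then u 0 else 0)"
        using u(1) by (auto simp: fmod_def)
      ultimately show ?thesis by (intro image_eqI[of _ _ x]) (simp_all only:)
    qed
    moreover have "(\<lambda>k. if k = 0 then augmentation F u else 0) \<in> fmod V 1" if "u \<in> fmod V (rank F 0)" for u
      using aug[OF that] by (auto simp: fmod_def)
    ultimately show ?thesis
      using aug unfolding 0 by (auto simp: cycles_def free_mod_fmod differential_extend_0)
  next
    case (Suc n)
    show ?thesis
    proof (cases n)
      case 0
      have "differential (extend_complex F) 0 u = 0 \<longleftrightarrow> augmentation F u = 0" for u
        by (auto simp: differential_extend_0 fun_eq_iff)
      then show ?thesis
        using F by (simp add: Suc 0 cycles_def free_mod_fmod)
    next
      case (Suc m)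
      then show ?thesis
        using F by (simp add: \<open>i = Suc n\<close> Suc cycles_def free_mod_fmod)
    qed
  qed
qed simp

lemma graded_free_resolution_truncate:
  assumes G: "resolves V I G" and I: "I \<subseteq> R V"
  shows "graded_free_resolution V I (truncate_complex G)"
  unfolding graded_free_resolution_def free_mod_fmod
proof (intro conjI allI impI)
  note r0 = resolvesD(1,2)[OF G]
  fix k assume "k < rank (truncate_complex G) 0"
  then show "aug (truncate_complex G) k \<in> R V" "homogeneous (shifts (truncate_complex G) 0 ! k) (aug (truncate_complex G) k)"
    using resolvesD(3)[OF G, of 0] r0 by (auto simp: hmat_def rank_def)
next
  fix i k l assume "k < rank (truncate_complex G) i" "l < rank (truncate_complex G) (Suc i)"
  then show "diff (truncate_complex G) i k l \<in> R V"
    "homogeneous (shifts (truncate_complex G) (Suc i) ! l - shifts (truncate_complex G) i ! k) (diff (truncate_complex G) i k l)"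
    using resolvesD(3)[OF G, of "Suc i"] by (auto simp: hmat_def rank_def)
next
  note r0 = resolvesD(1,2)[OF G]
  have aug: "differential G 0 u = (\<lambda>k. if k = 0 then augmentation (truncate_complex G) u else 0)" for u
    using r0 by (simp add: differential_def augmentation_def fun_eq_iff)
  show "augmentation (truncate_complex G) ` fmod V (rank (truncate_complex G) 0) = I"
  proof (intro equalityI subsetI)
    fix p assume "p \<in> augmentation (truncate_complex G) ` fmod V (rank (truncate_complex G) 0)"
    then obtain u where u: "u \<in> fmod V (rank G (Suc 0))" "p = augmentation (truncate_complex G) u" by auto
    have "differential G 0 u \<in> cycles V I G 0"
      using boundary_cycle[OF G u(1)] .
    then show "p \<in> I" by (simp add: cycles_def aug u(2))
  next
    fix p assume p: "p \<in> I"
    then have "(\<lambda>k. if k = 0 then p else 0) \<in> cycles V I G 0"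
      using I r0 by (auto simp: cycles_def free_mod_fmod fmod_def)
    then obtain u where u: "u \<in> fmod V (rank G (Suc 0))" "(\<lambda>k. if k = 0 then p else 0) = differential G 0 u"
      unfolding resolvesD(4)[OF G] free_mod_fmod by auto
    have "p = augmentation (truncate_complex G) u"
      using fun_cong[OF u(2), of 0] by (simp add: aug)
    then show "p \<in> augmentation (truncate_complex G) ` fmod V (rank (truncate_complex G) 0)"
      using u(1) by auto
  qed
  have "differential G 0 u = 0 \<longleftrightarrow> augmentation (truncate_complex G) u = 0" for u
    by (auto simp: aug fun_eq_iff)
  then show "{u \<in> fmod V (rank (truncate_complex G) 0). augmentation (truncate_complex G) u = 0} =
      differential (truncate_complex G) 0 ` fmod V (rank (truncate_complex G) (Suc 0))"
    using resolvesD(4)[OF G, of "Suc 0"] by (simp add: cycles_def free_mod_fmod)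
  show "{u \<in> fmod V (rank (truncate_complex G) (Suc i)). differential (truncate_complex G) i u = 0} =
      differential (truncate_complex G) (Suc i) ` fmod V (rank (truncate_complex G) (Suc (Suc i)))" for i
    using resolvesD(4)[OF G, of "Suc (Suc i)"] by (simp add: cycles_def free_mod_fmod)
qed

lemma tensor_homology_dim_eq_0:
  assumes F: "graded_free_resolution V I F" and I: "\<And>p. p \<in> I \<Longrightarrow> const_coeff p = 0"
  shows "tensor_homology_dim F i j = 0 \<longleftrightarrow> tor_vanishes (extend_complex F) (Suc i) j"
proof -
  note E = resolves_extend[OF F]
  \<comment> \<open>The images of the basis elements lie in \<open>I\<close>, so the augmentation
    becomes zero after tensoring and imposes no condition on cycles.\<close>
  have aug: "const_coeff (aug F l) = 0" if "l < rank F 0" for l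
  proof -
    have "augmentation F (unit_vec l) = aug F l"
      using that by (simp add: augmentation_def unit_vec_def if_distrib sum.delta cong: if_cong)
    moreover have "augmentation F (unit_vec l) \<in> I"
      using F fmod_unit_vec[OF that] by (auto simp: graded_free_resolution_def free_mod_fmod)
    ultimately show ?thesis using I by simp
  qed
  have cyc: "tensor_cycles (extend_complex F) (Suc i) j = tensor_cycles F i j"
  proof (cases i)
    case 0
    have "tensor_differential (extend_complex F) 0 w = 0" for w
      using aug by (auto simp: tensor_differential_def fun_eq_iff intro!: sum.neutral)
    then show ?thesis
      by (simp add: 0 tensor_cycles_def tensor_comp_tcomp)
  qed (simp add: tensor_cycles_def tensor_comp_tcomp)
  have bd: "tensor_boundaries (extend_complex F) (Suc i) j = tensor_boundaries F i j"
    by (simp add: tensor_boundaries_def tensor_comp_tcomp)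
  have "tensor_boundaries (extend_complex F) (Suc i) j \<subseteq> tensor_cycles (extend_complex F) (Suc i) j"
    by (rule tensor_boundaries_subset_cycles[OF E])
  then have sub: "tensor_boundaries F i j \<subseteq> tensor_cycles F i j"
    unfolding cyc bd .
  have subsp: "kvec.subspace (tensor_boundaries F i j)"
  proof -
    have add: "tensor_differential F i x + tensor_differential F i y = tensor_differential F i (x + y)" for x y
      by (auto simp: tensor_differential_def fun_eq_iff distrib_left sum.distrib)
    have scale: "scale_fun c (tensor_differential F i y) = tensor_differential F i (scale_fun c y)" for c y
      by (auto simp: tensor_differential_def scale_fun_def fun_eq_iff sum_distrib_left mult_ac)
    have closed: "x + y \<in> tcomp sh j" "scale_fun c y \<in> tcomp sh j" if "x \<in> tcomp sh j" "y \<in> tcomp sh j"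
      for x y :: "nat \<Rightarrow> 'b" and sh c
      using that unfolding tcomp_def scale_fun_def
      by (auto, (metis add_0_right)+)
    have zero: "0 = tensor_differential F i 0" "0 \<in> tcomp (shifts F (Suc i)) j"
      by (auto simp: tensor_differential_def tcomp_def fun_eq_iff)
    show ?thesis
      unfolding tensor_boundaries_def tensor_comp_tcomp
    proof (rule kvec.subspaceI)
      show "0 \<in> tensor_differential F i ` tcomp (shifts F (Suc i)) j"
        using zero by (rule image_eqI)
    qed (auto simp: add scale intro: closed)
  qed
  have "tensor_cycles F i j \<subseteq> tcomp (shifts F i) j"
    by (auto simp: tensor_cycles_def tensor_comp_tcomp split: nat.splits)
  then have "tensor_cycles F i j \<subseteq> kvec.span (unit_vec ` {..<length (shifts F i)})"
    using scale_fun_unit_vec_span by blast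
  then show ?thesis
    unfolding tensor_homology_dim_def tor_vanishes_def cyc bd
    by (intro dim_diff_eq_0[OF subsp sub, of "unit_vec ` {..<length (shifts F i)}"]) auto
qed

text \<open>A resolution of \<open>I\<close> exists as the truncation of \<open>G\<close>, and the
  chosen one has the same vanishing pattern as \<open>G\<close>. The bound \<open>low\<close> makes
  the set of values finite, so that its maximum is meaningful. Here \<open>r\<close> belongs to
  \<open>S/I\<close>, one less than for \<open>I\<close>.\<close>

theorem regularity_eqI:
  assumes G: "resolves V I G" and I: "I \<subseteq> R V" "\<And>p. p \<in> I \<Longrightarrow> const_coeff p = 0"
    and low: "\<And>i s. s \<in> set (shifts G i) \<Longrightarrow> int i \<le> s"
    and van: "\<And>i j. j - int i > r \<Longrightarrow> tor_vanishes G (Suc i) (j + 1)"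
    and non: "\<not> tor_vanishes G (Suc i0) (int i0 + r + 1)"
  shows "regularity V I = r + 1"
proof -
  define F where "F = (SOME F. graded_free_resolution V I F)"
  have F: "graded_free_resolution V I F"
    unfolding F_def using graded_free_resolution_truncate[OF G I(1)] by (rule someI)
  note E = resolves_extend[OF F]
  have betti: "betti V I i j = 0 \<longleftrightarrow> tor_vanishes G (Suc i) j" for i j
    using tensor_homology_dim_eq_0[OF F I(2)] tor_vanishes_transfer[OF E G] tor_vanishes_transfer[OF G E]
    unfolding betti_def F_def[symmetric] by blast
  have lower: "tor_vanishes G i j" if "j < int i" for i j
  proof -
    have "w = 0" if "w \<in> tcomp (shifts G i) j" for w :: "nat \<Rightarrow> 'b"
      using that low[of _ i] \<open>j < int i\<close> by (auto simp: tcomp_def fun_eq_iff) (metis nth_mem not_less)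
    then have "tensor_cycles G i j \<subseteq> {0}"
      by (auto simp: tensor_cycles_def tensor_comp_tcomp split: nat.splits)
    moreover have "0 \<in> tensor_boundaries G i j"
      by (auto simp: tensor_boundaries_def tensor_comp_tcomp tcomp_def tensor_differential_mat_map intro!: image_eqI[of _ _ 0])
    ultimately show ?thesis by (auto simp: tor_vanishes_def)
  qed
  define S where "S = {j - int i |i j. betti V I i j \<noteq> 0}"
  have bounds: "0 \<le> s \<and> s \<le> r + 1" if "s \<in> S" for s
  proof -
    obtain i j where ij: "s = j - int i" "\<not> tor_vanishes G (Suc i) j"
      using \<open>s \<in> S\<close> betti by (auto simp: S_def)
    have "\<not> (j - 1) - int i > r"
      using van[of "j - 1" i] ij(2) by auto
    moreover have "\<not> j < int (Suc i)"
      using lower ij(2) by blast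
    ultimately show ?thesis using ij(1) by simp
  qed
  then have "S \<subseteq> {0..r + 1}" by auto
  then have "finite S" by (rule finite_subset) simp
  moreover have "r + 1 \<in> S"
    using non betti[of i0 "int i0 + r + 1"] unfolding S_def by (intro CollectI exI[of _ i0] exI[of _ "int i0 + r + 1"]) auto
  ultimately show ?thesis
    unfolding regularity_def S_def[symmetric] using bounds by (intro Max_eqI) auto
qed


section \<open>Mapping cones\<close>

definition glue :: "nat \<Rightarrow> (nat \<Rightarrow> 'a) \<Rightarrow> (nat \<Rightarrow> 'a) \<Rightarrow> nat \<Rightarrow> 'a"
  where "glue n g x = (\<lambda>k. if k < n then g k else x (k - n))"

text \<open>The mapping cone of \<open>\<Phi> : F(-d) -> G\<close>, with the blocks of
  \<open>G\<close> listed first; the sign makes consecutive maps compose to zero. At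
  \<open>i = 0\<close> the truncated \<open>i - 1\<close> is harmless, since no row beyond
  \<open>rank G 0\<close> is in range.\<close>

definition cone :: "('v, 'k::field) mpoly free_complex \<Rightarrow> ('v, 'k) mpoly free_complex \<Rightarrow>
    (nat \<Rightarrow> nat \<Rightarrow> nat \<Rightarrow> ('v, 'k) mpoly) \<Rightarrow> int \<Rightarrow> ('v, 'k) mpoly free_complex"
  where "cone F G \<Phi> d =
    \<lparr>shifts = (\<lambda>i. shifts G i @ (case i of 0 \<Rightarrow> [] | Suc m \<Rightarrow> map (\<lambda>s. s + d) (shifts F m))),
     diff = (\<lambda>i k l.
       if l < rank G (Suc i) then if k < rank G i then diff G i k l else 0
       else if k < rank G i then \<Phi> i k (l - rank G (Suc i))
       else - diff F (i - 1) (k - rank G i) (l - rank G (Suc i))),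
     aug = (\<lambda>_. 0)\<rparr>"

abbreviation pred_rank :: "('v, 'k::field) mpoly free_complex \<Rightarrow> nat \<Rightarrow> nat"
  where "pred_rank F i \<equiv> (case i of 0 \<Rightarrow> 0 | Suc m \<Rightarrow> rank F m)"

lemma shifts_cone:
  "shifts (cone F G \<Phi> d) i = shifts G i @ (case i of 0 \<Rightarrow> [] | Suc m \<Rightarrow> map (\<lambda>s. s + d) (shifts F m))"
  by (simp add: cone_def)

lemma rank_cone: "rank (cone F G \<Phi> d) i = rank G i + pred_rank F i"
  by (simp add: rank_def shifts_cone split: nat.splits)

lemma diff_cone:
  "diff (cone F G \<Phi> d) i = (\<lambda>k l.
       if l < rank G (Suc i) then if k < rank G i then diff G i k l else 0
       else if k < rank G i then \<Phi> i k (l - rank G (Suc i))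
       else - diff F (i - 1) (k - rank G i) (l - rank G (Suc i)))"
  by (simp add: cone_def)

lemma sum_lessThan_add: "(\<Sum>l<a + b. f l) = (\<Sum>l<a. f l) + (\<Sum>l<b. f (a + l :: nat) :: 'a::comm_monoid_add)"
  by (induction b) (simp_all add: add.assoc)

lemma mat_map_glue:
  "mat_map (r1 + r2) (s1 + s2)
      (\<lambda>k l. if l < s1 then if k < r1 then A k l else 0
        else if k < r1 then B k (l - s1) else C (k - r1) (l - s1)) (glue s1 g x) =
    glue r1 (\<lambda>k. mat_map r1 s1 A g k + mat_map r1 s2 B x k) (mat_map r2 s2 C x)"
  by (auto simp: mat_map_def glue_def sum_lessThan_add fun_eq_iff)

lemma differential_cone:
  "differential (cone F G \<Phi> d) i (glue (rank G (Suc i)) g x) =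
    glue (rank G i) (\<lambda>k. differential G i g k + app F G \<Phi> i x k)
      (mat_map (pred_rank F i) (rank F i) (\<lambda>k l. - diff F (i - 1) k l) x)"
  unfolding differential_mat_map rank_cone diff_cone nat.case(2) by (rule mat_map_glue)

lemma tensor_differential_cone:
  "tensor_differential (cone F G \<Phi> d) i (glue (rank G (Suc i)) g x) =
    glue (rank G i) (\<lambda>k. tensor_differential G i g k + mat_map (rank G i) (rank F i) (cmat (\<Phi> i)) x k)
      (mat_map (pred_rank F i) (rank F i) (\<lambda>k l. - const_coeff (diff F (i - 1) k l)) x)"
  unfolding tensor_differential_mat_map rank_cone diff_cone
  by (simp add: mat_map_glue[symmetric] const_coeff_uminus if_distrib[of const_coeff] cong: if_cong)

lemma mat_map_uminus_mat: "mat_map r s (\<lambda>k l. - A k l) x = (\<lambda>k. - mat_map r s A x k)"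
  by (auto simp: mat_map_def sum_negf)

lemma glue_fmod: "g \<in> fmod V a \<Longrightarrow> x \<in> fmod V b \<Longrightarrow> glue a g x \<in> fmod V (a + b)"
  by (auto simp: glue_def fmod_def)

lemma fmod_glueE:
  assumes "u \<in> fmod V (a + b)"
  obtains g x where "g \<in> fmod V a" "x \<in> fmod V b" "u = glue a g x"
  using assms
  by (intro that[of "\<lambda>k. if k < a then u k else 0" "\<lambda>k. u (k + a)"]) (auto simp: glue_def fmod_def)

lemma fmod_uminus: "g \<in> fmod V a \<Longrightarrow> (\<lambda>k. - g k) \<in> fmod V a"
  by (auto simp: fmod_def intro: R_uminus)

lemma fmod_mat_map: "differential G i g \<in> fmod V (rank G i)"
  if "resolves V I G" "g \<in> fmod V (rank G (Suc i))"
  using boundary_cycle[OF that] by (rule cycles_free_mod)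

lemma glue_eq_0: "g \<in> fmod V a \<Longrightarrow> glue a g x = 0 \<longleftrightarrow> g = 0 \<and> x = 0"
proof
  assume g: "g \<in> fmod V a" "glue a g x = 0"
  have "g k = 0" for k
    using g(1) fun_cong[OF g(2), of k] by (cases "k < a") (simp_all add: glue_def fmod_def)
  moreover have "x k = 0" for k
    using fun_cong[OF g(2), of "k + a"] by (simp add: glue_def)
  ultimately show "g = 0 \<and> x = 0" by auto
qed (auto simp: glue_def)

lemma hmat_cone:
  assumes G: "resolves V I G" and F: "resolves V K F" and \<Phi>: "chain_map V F G d \<Phi>"
  shows "hmat V (shifts (cone F G \<Phi> d) i) (shifts (cone F G \<Phi> d) (Suc i)) 0 (diff (cone F G \<Phi> d) i)"
proof -
  note h = resolvesD(3)[OF G, of i] chain_mapD(1)[OF \<Phi>, of i]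
  show ?thesis
  proof (cases i)
    case 0
    then show ?thesis
      using h by (auto simp: hmat_def shifts_cone diff_cone rank_def nth_append homogeneous_whom algebra_simps)
  next
    case (Suc n)
    then show ?thesis
      using h resolvesD(3)[OF F, of n]
      by (auto simp: hmat_def shifts_cone diff_cone rank_def nth_append homogeneous_whom algebra_simps
          intro!: R_uminus whom_uminus)
  qed
qed

text \<open>Multiplication by \<open>f\<close> embeds \<open>S/K\<close>, shifted by
  \<open>d\<close>, into \<open>S/I\<close> with cokernel \<open>S/I'\<close>; the cone of a lift of
  this embedding resolves the cokernel.\<close>

theorem resolves_cone:
  assumes G: "resolves V I G" and F: "resolves V K F"
    and \<Phi>: "chain_map V F G d \<Phi>" "\<Phi> 0 0 0 = f"
    and K: "\<And>p. p \<in> K \<longleftrightarrow> p \<in> R V \<and> f * p \<in> I"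
    and I': "\<And>p. p \<in> I' \<longleftrightarrow> p \<in> R V \<and> (\<exists>q\<in>R V. p - f * q \<in> I)"
    and I: "I \<subseteq> R V"
  shows "resolves V I' (cone F G \<Phi> d)"
  unfolding resolves_def
proof (intro conjI allI)
  let ?C = "cone F G \<Phi> d"
  note r = resolvesD(1,2)[OF F] resolvesD(1,2)[OF G]
  show "shifts ?C 0 = [0]" using r by (simp add: shifts_cone)
  fix i
  show "hmat V (shifts ?C i) (shifts ?C (Suc i)) 0 (diff ?C i)"
    by (rule hmat_cone[OF G F \<Phi>(1)])
  have app0: "app F G \<Phi> 0 x = (\<lambda>k. if k = 0 then f * x 0 else 0)" for x
    using r \<Phi>(2) by (auto simp: mat_map_def)
  have app_fmod: "app F G \<Phi> n x \<in> fmod V (rank G n)" if "x \<in> fmod V (rank F n)" for n x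
    using mat_map_fmod[OF chain_mapD(1)[OF \<Phi>(1)]] that by (simp add: rank_def)
  show "cycles V I' ?C i = differential ?C i ` free_mod V ?C (Suc i)"
  proof (intro equalityI subsetI)
    fix u assume "u \<in> differential ?C i ` free_mod V ?C (Suc i)"
    then obtain v where "v \<in> fmod V (rank G (Suc i) + rank F i)" "u = differential ?C i v"
      by (auto simp: free_mod_fmod rank_cone)
    then obtain g x where gx: "g \<in> fmod V (rank G (Suc i))" "x \<in> fmod V (rank F i)"
      and u: "u = differential ?C i (glue (rank G (Suc i)) g x)"
      by (metis fmod_glueE)
    note dg = fmod_mat_map[OF G gx(1)] and ax = app_fmod[OF gx(2)]
    show "u \<in> cycles V I' ?C i"
    proof (cases i)
      case 0
      have "differential G 0 g 0 \<in> I"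
        using boundary_cycle[OF G, of g 0] gx(1) by (simp add: 0 cycles_def)
      moreover have "u 0 = differential G 0 g 0 + f * x 0"
        unfolding u 0 differential_cone app0 using r(4) by (simp add: glue_def)
      moreover have "x 0 \<in> R V"
        using gx(2) r(2) by (simp add: 0 fmod_def)
      moreover have "u \<in> fmod V (rank G 0)"
        using dg ax r unfolding u 0 differential_cone by (auto simp: 0 glue_def fmod_def mat_map_def intro: R_add)
      ultimately show ?thesis
        using r(4) by (auto simp: 0 cycles_def free_mod_fmod rank_cone I' fmod_def intro!: bexI[of _ "x 0"])
    next
      case (Suc n)
      have dx: "differential F n x \<in> fmod V (rank F n)"
        using gx(2) unfolding Suc by (rule fmod_mat_map[OF F])
      have u': "u = glue (rank G i) (\<lambda>k. differential G i g k + app F G \<Phi> i x k) (\<lambda>k. - differential F n x k)"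
        unfolding u differential_cone by (simp add: Suc mat_map_uminus_mat differential_mat_map)
      have "u \<in> fmod V (rank ?C i)"
        unfolding u' rank_cone using dg ax dx by (auto simp: Suc intro!: glue_fmod fmod_add fmod_uminus)
      moreover have "differential ?C n u = 0"
      proof -
        have "differential G n (\<lambda>k. differential G i g k + app F G \<Phi> i x k) k + app F G \<Phi> n (\<lambda>k. - differential F n x k) k = 0" for k
        proof -
          have "differential G n (\<lambda>k. differential G i g k + app F G \<Phi> i x k) =
              (\<lambda>k. differential G n (differential G i g) k + differential G n (app F G \<Phi> i x) k)"
            by (simp add: differential_mat_map mat_map_add)
          moreover have "differential G n (differential G i g) = 0"
            using differential_differential[OF G] gx(1) by (simp add: Suc)
          moreover have "differential G n (app F G \<Phi> i x) = app F G \<Phi> n (differential F n x)"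
            unfolding Suc by (rule chain_mapD(2)[OF \<Phi>(1)])
          moreover have "app F G \<Phi> n (\<lambda>k. - differential F n x k) = (\<lambda>k. - app F G \<Phi> n (differential F n x) k)"
            by (rule mat_map_uminus)
          ultimately show ?thesis by simp
        qed
        moreover have "mat_map (pred_rank F n) (rank F n) (\<lambda>k l. - diff F (n - 1) k l) (\<lambda>k. - differential F n x k) = 0"
        proof (cases n)
          case 0
          then show ?thesis by (simp add: mat_map_def fun_eq_iff)
        next
          case (Suc m)
          have "differential F m (differential F (Suc m) x) = 0"
            using differential_differential[OF F] gx(2) by (simp add: \<open>i = Suc n\<close> Suc)
          then show ?thesis
            unfolding mat_map_uminus_mat mat_map_uminus by (simp add: Suc differential_mat_map fun_eq_iff)
        qed
        ultimately show ?thesis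
          unfolding u' Suc differential_cone by (auto simp: glue_def fun_eq_iff)
      qed
      ultimately show ?thesis
        by (simp add: Suc cycles_def free_mod_fmod)
    qed
  next
    fix u assume u: "u \<in> cycles V I' ?C i"
    have "\<exists>g\<in>fmod V (rank G (Suc i)). \<exists>x\<in>fmod V (rank F i). u = differential ?C i (glue (rank G (Suc i)) g x)"
    proof (cases i)
      case 0
      have uf: "u \<in> fmod V 1" "u 0 \<in> I'"
        using u r(4) by (simp_all add: 0 cycles_def free_mod_fmod rank_cone)
      then obtain q where q: "q \<in> R V" "u 0 - f * q \<in> I" using I' by auto
      have "(\<lambda>k. if k = 0 then u 0 - f * q else 0) \<in> cycles V I G 0"
        using q I r(4) by (auto simp: cycles_def free_mod_fmod fmod_def)
      then obtain g where g: "g \<in> fmod V (rank G (Suc 0))" "(\<lambda>k. if k = 0 then u 0 - f * q else 0) = differential G 0 g"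
        unfolding resolvesD(4)[OF G] free_mod_fmod by auto
      let ?x = "\<lambda>k. if k = 0 then q else 0"
      have "u = differential ?C 0 (glue (rank G (Suc 0)) g ?x)"
        unfolding differential_cone g(2)[symmetric] app0
        using uf(1) r(4) by (auto simp: glue_def fmod_def fun_eq_iff mat_map_def)
      moreover have "?x \<in> fmod V (rank F 0)"
        using q(1) r(2) by (auto simp: fmod_def)
      ultimately show ?thesis
        using g(1) unfolding 0 by blast
    next
      case (Suc n)
      have "u \<in> fmod V (rank G (Suc n) + rank F n)" and du: "differential ?C n u = 0"
        using u by (simp_all add: Suc cycles_def free_mod_fmod rank_cone)
      then obtain g x where gx: "g \<in> fmod V (rank G (Suc n))" "x \<in> fmod V (rank F n)"
        and ueq: "u = glue (rank G (Suc n)) g x"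
        by (metis fmod_glueE)
      note dg = fmod_mat_map[OF G gx(1)] and ax = app_fmod[OF gx(2)]
      have "(\<lambda>k. differential G n g k + app F G \<Phi> n x k) = 0 \<and>
          mat_map (pred_rank F n) (rank F n) (\<lambda>k l. - diff F (n - 1) k l) x = 0"
        using du unfolding ueq differential_cone
        by (subst (asm) glue_eq_0[of _ V]) (auto intro: fmod_add dg ax)
      then have dx0: "mat_map (pred_rank F n) (rank F n) (\<lambda>k l. - diff F (n - 1) k l) x = 0"
        and "\<forall>k. differential G n g k + app F G \<Phi> n x k = 0"
        by (auto simp: fun_eq_iff)
      then have sum0: "differential G n g k + app F G \<Phi> n x k = 0" for k
        by blast
      have "x \<in> cycles V K F n"
      proof (cases n)
        case 0
        have "differential G 0 (\<lambda>k. - g k) \<in> cycles V I G 0"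
          using gx(1) by (intro boundary_cycle[OF G] fmod_uminus) (simp add: 0)
        moreover have "differential G 0 (\<lambda>k. - g k) 0 = - differential G 0 g 0"
          by (simp add: differential_mat_map mat_map_uminus)
        moreover have "f * x 0 = - differential G 0 g 0"
          using sum0[of 0] by (simp add: 0 app0 eq_neg_iff_add_eq_0 add.commute)
        ultimately have "f * x 0 \<in> I"
          by (simp add: cycles_def)
        then show ?thesis
          using gx(2) r(2) by (simp add: 0 cycles_def free_mod_fmod K fmod_def)
      next
        case (Suc m)
        then show ?thesis
          using dx0 gx(2) unfolding mat_map_uminus_mat
          by (simp add: cycles_def free_mod_fmod differential_mat_map fun_eq_iff)
      qed
      then obtain x' where x': "x' \<in> fmod V (rank F (Suc n))" "x = differential F n x'"
        unfolding resolvesD(4)[OF F] free_mod_fmod by auto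
      \<comment> \<open>Adding the image of the lift \<open>x'\<close> turns \<open>g\<close> into a
        cycle of \<open>G\<close>; the preimage of the pair \<open>(g, x)\<close> is then
        \<open>(g', - x')\<close>.\<close>
      let ?g = "\<lambda>k. g k + app F G \<Phi> (Suc n) x' k"
      have "differential G n ?g = 0"
        using sum0 chain_mapD(2)[OF \<Phi>(1), of n x']
        by (simp add: differential_mat_map[of G] mat_map_add x'(2) fun_eq_iff)
      then have "?g \<in> cycles V I G (Suc n)"
        using gx(1) app_fmod[OF x'(1)] by (simp add: cycles_def free_mod_fmod fmod_add)
      then obtain g' where g': "g' \<in> fmod V (rank G (Suc (Suc n)))" "?g = differential G (Suc n) g'"
        unfolding resolvesD(4)[OF G] free_mod_fmod by auto
      have "u = differential ?C (Suc n) (glue (rank G (Suc (Suc n))) g' (\<lambda>k. - x' k))"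
        unfolding differential_cone g'(2)[symmetric] mat_map_uminus mat_map_uminus_mat ueq x'(2)
        by (simp add: differential_mat_map)
      then show ?thesis
        using g'(1) fmod_uminus[OF x'(1)] unfolding Suc by blast
    qed
    then show "u \<in> differential ?C i ` free_mod V ?C (Suc i)"
      by (auto simp: free_mod_fmod rank_cone intro!: glue_fmod)
  qed
qed

lemma chain_map_scalar:
  assumes "f \<in> R V" "homogeneous d f"
  shows "chain_map V F F d (\<lambda>i k l. if k = l then f else 0)"
  unfolding chain_map_def
  using assms
  by (auto simp: hmat_def homogeneous_whom rank_def sum.delta if_distrib[of "\<lambda>x. x * _"]
      if_distrib[of "\<lambda>x. _ * x"] mult.commute cong: if_cong)

text \<open>Regularity is studied among polynomials in all variables, resolutions over
  \<open>R V\<close>. For \<open>B\<close> in \<open>R V\<close> this contraction is the ideal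
  generated inside \<open>R V\<close>, because selecting the monomials in \<open>V\<close> is linear
  over \<open>R V\<close>.\<close>

definition ideal_on :: "'v set \<Rightarrow> ('v, 'k::field) mpoly set \<Rightarrow> ('v, 'k) mpoly set"
  where "ideal_on V B = ispan B \<inter> R V"

lemma select_R: "p \<in> R V \<Longrightarrow> select (\<lambda>m. Poly_Mapping.keys m \<subseteq> V) p = p"
  by (rule select_id) (simp add: R_eq)

lemma R_select: "select (\<lambda>m. Poly_Mapping.keys m \<subseteq> V) p \<in> R V"
  by (simp add: R_eq keys_select)

lemma select_mult_R: "g \<in> R V \<Longrightarrow> select (\<lambda>m. Poly_Mapping.keys m \<subseteq> V) (c * g) =
    select (\<lambda>m. Poly_Mapping.keys m \<subseteq> V) c * g"
  by (rule select_mult) (simp add: R_eq keys_plus_nat)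

lemma ispan_select:
  assumes "B \<subseteq> R V" "p \<in> ispan B"
  shows "select (\<lambda>m. Poly_Mapping.keys m \<subseteq> V) p \<in> ispan B"
  using assms(2)
proof (induction rule: ideal.span_induct_alt)
  case (step c g p)
  then show ?case
    using assms(1) by (auto simp: select_add select_mult_R intro!: ideal.span_add ispan_mult_base)
qed (simp add: ideal.span_zero)

lemma ideal_on_insert_iff:
  assumes "B \<subseteq> R V" "f \<in> R V"
  shows "p \<in> ideal_on V (insert f B) \<longleftrightarrow> p \<in> R V \<and> (\<exists>q\<in>R V. p - f * q \<in> ideal_on V B)"
proof
  let ?\<pi> = "select (\<lambda>m. Poly_Mapping.keys m \<subseteq> V)"
  assume p: "p \<in> ideal_on V (insert f B)"
  then obtain k where "p - k * f \<in> ispan B"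
    by (auto simp: ideal_on_def ideal.span_insert)
  then have "?\<pi> (p - k * f) \<in> ispan B"
    by (rule ispan_select[OF assms(1)])
  moreover have "?\<pi> (p - k * f) = p - ?\<pi> k * f"
    using p assms(2) by (simp add: ideal_on_def select_diff select_R select_mult_R)
  ultimately have "p - f * ?\<pi> k \<in> ispan B"
    by (simp add: mult.commute)
  then show "p \<in> R V \<and> (\<exists>q\<in>R V. p - f * q \<in> ideal_on V B)"
    using p assms(2) by (auto simp: ideal_on_def intro!: bexI[of _ "?\<pi> k"] R_diff R_mult R_select)
next
  assume "p \<in> R V \<and> (\<exists>q\<in>R V. p - f * q \<in> ideal_on V B)"
  then show "p \<in> ideal_on V (insert f B)"
    by (auto simp: ideal_on_def mult.commute intro: ispan_insertI)
qed

lemma resolves_cone_ideal_on: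
  assumes "B \<subseteq> R V" "f \<in> R V" "resolves V (ideal_on V B) G" "resolves V (ideal_on V C) F"
    "\<And>x. f * x \<in> ispan B \<longleftrightarrow> x \<in> ispan C" "chain_map V F G d \<Phi>" "\<Phi> 0 0 0 = f"
  shows "resolves V (ideal_on V (insert f B)) (cone F G \<Phi> d)"
proof (rule resolves_cone[OF assms(3,4,6,7)])
  show "p \<in> ideal_on V C \<longleftrightarrow> p \<in> R V \<and> f * p \<in> ideal_on V B" for p
    using assms(2,5) by (auto simp: ideal_on_def intro: R_mult)
  show "p \<in> ideal_on V (insert f B) \<longleftrightarrow> p \<in> R V \<and> (\<exists>q\<in>R V. p - f * q \<in> ideal_on V B)" for p
    by (rule ideal_on_insert_iff[OF assms(1,2)])
qed (auto simp: ideal_on_def)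

lemma exists_chain_map_ideal_on:
  assumes "f \<in> R V" "homogeneous d f" "resolves V (ideal_on V B) G" "resolves V (ideal_on V C) F"
    "\<And>x. f * x \<in> ispan B \<longleftrightarrow> x \<in> ispan C"
  obtains \<Phi> where "chain_map V F G d \<Phi>" "\<Phi> 0 0 0 = f"
  by (rule exists_chain_map[OF assms(4,3,1,2)]) (use assms in \<open>auto simp: ideal_on_def intro: R_mult\<close>)

section \<open>Regular sequences\<close>

text \<open>The tensor product of \<open>G\<close> with the Koszul complex of the single element
  \<open>f\<close>.\<close>

definition koszul_step :: "('v, 'k::field) mpoly free_complex \<Rightarrow> ('v, 'k) mpoly \<Rightarrow> int \<Rightarrow> ('v, 'k) mpoly free_complex"
  where "koszul_step G f d = cone G G (\<lambda>i k l. if k = l then f else 0) d"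

lemma resolves_koszul_step:
  assumes "B \<subseteq> R V" "f \<in> R V" "homogeneous d f" "resolves V (ideal_on V B) G" "nzd B f"
  shows "resolves V (ideal_on V (insert f B)) (koszul_step G f d)"
  unfolding koszul_step_def
proof (rule resolves_cone_ideal_on[OF assms(1,2,4,4)])
  show "f * x \<in> ispan B \<longleftrightarrow> x \<in> ispan B" for x
    using assms(5) by (auto simp: nzd_def intro: ideal.span_scale)
qed (use assms in \<open>auto intro: chain_map_scalar\<close>)

definition trivial_complex :: "('v, 'k::field) mpoly free_complex"
  where "trivial_complex = \<lparr>shifts = (\<lambda>i. if i = 0 then [0] else []), diff = (\<lambda>_ _ _. 0), aug = (\<lambda>_. 0)\<rparr>"

lemma trivial_complex_simps [simp]:
  "shifts trivial_complex i = (if i = 0 then [0] else [])"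
  "rank trivial_complex i = (if i = 0 then 1 else 0)" "diff trivial_complex i k l = 0"
  by (simp_all add: trivial_complex_def rank_def)

lemma resolves_trivial_complex: "resolves V (ideal_on V {}) trivial_complex"
proof -
  have "differential trivial_complex i u = 0" for i :: nat and u :: "nat \<Rightarrow> ('a, 'b) mpoly"
    by (simp add: differential_def fun_eq_iff)
  moreover have "cycles V (ideal_on V {}) trivial_complex i = {0 :: nat \<Rightarrow> ('a, 'b) mpoly}" for i
  proof (cases i)
    case 0
    have "u = 0" if "u \<in> fmod V 1" "u 0 = 0" for u :: "nat \<Rightarrow> ('a, 'b) mpoly"
    proof
      show "u k = 0 k" for k using that by (cases k) (simp_all add: fmod_def)
    qed
    then show ?thesis
      unfolding 0 by (auto simp: cycles_def ideal_on_def free_mod_fmod) (auto simp: fmod_def)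
  qed (auto simp: cycles_def free_mod_fmod fmod_def fun_eq_iff differential_def)
  moreover have "free_mod V trivial_complex (Suc i) = {0 :: nat \<Rightarrow> ('a, 'b) mpoly}" for i
    by (auto simp: free_mod_fmod fmod_def fun_eq_iff)
  ultimately show ?thesis
    by (auto simp: resolves_def hmat_def)
qed

text \<open>The head of the list is adjoined last, which is why regular sequences enter through the
  reversed list; \<open>d\<close> is the common degree of the members.\<close>

primrec koszul :: "('v, 'k::field) mpoly list \<Rightarrow> int \<Rightarrow> ('v, 'k) mpoly free_complex"
  where
    "koszul [] d = trivial_complex"
  | "koszul (f # fs) d = koszul_step (koszul fs d) f d"

lemma resolves_koszul:
  assumes "\<And>f. f \<in> set fs \<Longrightarrow> f \<in> R V \<and> homogeneous d f" "regseq {} (rev fs)"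
  shows "resolves V (ideal_on V (set fs)) (koszul fs d)"
  using assms
proof (induction fs)
  case (Cons f fs)
  have "resolves V (ideal_on V (set fs)) (koszul fs d)"
    using Cons by (auto simp: regseq_append)
  then show ?case
    using Cons(2)[of f] Cons(2) Cons(3) by (auto simp: regseq_append intro!: resolves_koszul_step)
qed (simp add: resolves_trivial_complex)

lemma rank_koszul: "rank (koszul fs d) i = length fs choose i"
proof (induction fs arbitrary: i)
  case (Cons f fs)
  then show ?case
    by (cases i) (simp_all add: koszul_step_def rank_cone)
next
  case Nil
  then show ?case by (cases i) simp_all
qed

lemma shifts_koszul: "s \<in> set (shifts (koszul fs d) i) \<Longrightarrow> s = d * int i"
proof (induction fs arbitrary: i s)
  case (Cons f fs)
  then show ?case
    by (cases i) (auto simp: koszul_step_def shifts_cone distrib_left dest!: Cons.IH)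
qed (auto split: if_splits)

lemma diff_koszul:
  "k < rank (koszul fs d) i \<Longrightarrow> l < rank (koszul fs d) (Suc i) \<Longrightarrow> diff (koszul fs d) i k l \<in> ispan (set fs)"
proof (induction fs arbitrary: i k l)
  case (Cons f fs)
  have mono: "p \<in> ispan (insert f (set fs))" if "p \<in> ispan (set fs)" for p
    using that by (rule ispan_mono[rotated]) auto
  show ?case
  proof (cases i)
    case 0
    then show ?thesis
      using Cons.prems Cons.IH[of k i l]
      by (auto simp: koszul_step_def rank_cone diff_cone ideal.span_zero intro: mono ideal.span_base)
  next
    case (Suc n)
    have "- diff (koszul fs d) n (k - rank (koszul fs d) i) (l - rank (koszul fs d) (Suc i)) \<in> ispan (insert f (set fs))"
      if "\<not> k < rank (koszul fs d) i" "\<not> l < rank (koszul fs d) (Suc i)"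
      using that Cons.prems
      by (intro mono ideal.span_neg Cons.IH) (auto simp: Suc koszul_step_def rank_cone)
    then show ?thesis
      using Cons.prems Cons.IH[of k i l]
      by (auto simp: Suc koszul_step_def rank_cone diff_cone ideal.span_zero intro: mono ideal.span_base)
  qed
qed (simp add: ideal.span_zero)

lemma tcomp_glueE:
  assumes "w \<in> tcomp (sh @ map (\<lambda>s. s + d) sh') j"
  obtains w1 w2 where "w1 \<in> tcomp sh j" "w2 \<in> tcomp sh' (j - d)" "w = glue (length sh) w1 w2"
proof (rule that[of "\<lambda>k. if k < length sh then w k else 0" "\<lambda>k. w (k + length sh)"])
  show "(\<lambda>k. if k < length sh then w k else 0) \<in> tcomp sh j"
    using assms by (auto simp: tcomp_def nth_append split: if_splits)
  show "(\<lambda>k. w (k + length sh)) \<in> tcomp sh' (j - d)"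
    unfolding tcomp_def
  proof (intro CollectI allI impI)
    fix k assume "w (k + length sh) \<noteq> 0"
    then have "k + length sh < length sh + length sh'" "(sh @ map (\<lambda>s. s + d) sh') ! (k + length sh) = j"
      using assms by (auto simp: tcomp_def)
    then show "k < length sh' \<and> sh' ! k = j - d"
      by (auto simp: nth_append)
  qed
qed (auto simp: glue_def)

lemma tcomp_glue:
  "w1 \<in> tcomp sh j \<Longrightarrow> w2 \<in> tcomp sh' (j - d) \<Longrightarrow> glue (length sh) w1 w2 \<in> tcomp (sh @ map (\<lambda>s. s + d) sh') j"
  by (fastforce simp: tcomp_def glue_def nth_append)

text \<open>Regularity of the resolved quotient, measured by Tor rather than by the shifts because
  \<open>G\<close> may fail to be minimal.\<close>

definition has_regularity :: "('v, 'k::field) mpoly free_complex \<Rightarrow> int \<Rightarrow> bool"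
  where "has_regularity G r \<longleftrightarrow> (\<forall>i. \<forall>s\<in>set (shifts G i). int i \<le> s) \<and>
    (\<forall>i j. j - int i > r \<longrightarrow> tor_vanishes G i j) \<and> (\<exists>i j. j - int i = r \<and> \<not> tor_vanishes G i j)"

text \<open>A matrix without rows treats position 0 like the others; the negated matrix is the block
  that occurs in a cone.\<close>

lemma tensor_cycles_iff:
  "w \<in> tensor_cycles F i j \<longleftrightarrow> w \<in> tcomp (shifts F i) j \<and>
    mat_map (pred_rank F i) (rank F i) (\<lambda>k l. - const_coeff (diff F (i - 1) k l)) w = 0"
proof (cases i)
  case 0
  then show ?thesis
    by (auto simp: tensor_cycles_def tensor_comp_tcomp mat_map_def fun_eq_iff)
next
  case (Suc n)
  then show ?thesis
    by (auto simp: tensor_cycles_def tensor_comp_tcomp mat_map_uminus_mat tensor_differential_mat_map fun_eq_iff)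
qed

lemma tensor_boundaries_iff:
  "w \<in> tensor_boundaries F i j \<longleftrightarrow> (\<exists>y\<in>tcomp (shifts F (Suc i)) j. w = tensor_differential F i y)"
  by (auto simp: tensor_boundaries_def tensor_comp_tcomp)

lemma glue_inject:
  assumes "glue n g x = glue n g' x'" "\<And>k. n \<le> k \<Longrightarrow> g k = g' k"
  shows "g = g' \<and> x = x'"
proof -
  have "g k = g' k" for k
    using fun_cong[OF assms(1), of k] assms(2) by (cases "k < n") (simp_all add: glue_def)
  moreover have "x k = x' k" for k
    using fun_cong[OF assms(1), of "k + n"] by (simp add: glue_def)
  ultimately show ?thesis by auto
qed

lemma tcomp_uminus: "w \<in> tcomp sh j \<Longrightarrow> (\<lambda>k. - w k) \<in> tcomp sh j"
  by (auto simp: tcomp_def)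

lemma tcomp_0 [simp]: "0 \<in> tcomp sh j"
  by (simp add: tcomp_def)

text \<open>Without a constant term \<open>f\<close> becomes zero after tensoring, so the tensored
  cone is a direct sum: its Tor in position \<open>n + 1\<close> and degree \<open>j\<close>
  combines that of \<open>G\<close> at \<open>(n + 1, j)\<close> and at
  \<open>(n, j - d)\<close>.\<close>

lemma tensor_differential_koszul_step:
  assumes "const_coeff f = 0"
  shows "tensor_differential (koszul_step G f d) i (glue (rank G (Suc i)) g x) =
    glue (rank G i) (tensor_differential G i g)
      (mat_map (pred_rank G i) (rank G i) (\<lambda>k l. - const_coeff (diff G (i - 1) k l)) x)"
proof -
  have "mat_map r s (\<lambda>k l. const_coeff (if k = l then f else 0)) x = 0" for r s
    using assms by (auto simp: mat_map_def fun_eq_iff if_distrib[of const_coeff] cong: if_cong)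
  then show ?thesis
    by (simp add: koszul_step_def tensor_differential_cone)
qed

lemma tensor_differential_outside: "rank F i \<le> k \<Longrightarrow> tensor_differential F i w k = 0"
  by (simp add: tensor_differential_def)

lemma tor_vanishes_koszul_step:
  assumes f: "const_coeff f = 0" and G: "tor_vanishes G (Suc n) j" "tor_vanishes G n (j - d)"
  shows "tor_vanishes (koszul_step G f d) (Suc n) j"
  unfolding tor_vanishes_def
proof
  let ?C = "koszul_step G f d"
  have sh: "shifts ?C (Suc m) = shifts G (Suc m) @ map (\<lambda>s. s + d) (shifts G m)" for m
    by (simp add: koszul_step_def shifts_cone)
  fix w assume "w \<in> tensor_cycles ?C (Suc n) j"
  then have w: "w \<in> tcomp (shifts ?C (Suc n)) j" "tensor_differential ?C n w = 0"
    by (simp_all add: tensor_cycles_def tensor_comp_tcomp)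
  obtain w1 w2 where w12: "w1 \<in> tcomp (shifts G (Suc n)) j" "w2 \<in> tcomp (shifts G n) (j - d)"
    "w = glue (rank G (Suc n)) w1 w2"
    using w(1) unfolding sh rank_def by (rule tcomp_glueE)
  have "glue (rank G n) (tensor_differential G n w1)
      (mat_map (pred_rank G n) (rank G n) (\<lambda>k l. - const_coeff (diff G (n - 1) k l)) w2) = glue (rank G n) 0 0"
    using w(2) unfolding w12(3) tensor_differential_koszul_step[OF f] by (simp add: glue_def fun_eq_iff)
  from glue_inject[OF this] have "tensor_differential G n w1 = 0"
    "mat_map (pred_rank G n) (rank G n) (\<lambda>k l. - const_coeff (diff G (n - 1) k l)) w2 = 0"
    by (simp_all add: tensor_differential_outside)
  then have "w1 \<in> tensor_cycles G (Suc n) j" "w2 \<in> tensor_cycles G n (j - d)"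
    using w12 by (simp add: tensor_cycles_def tensor_comp_tcomp, simp add: tensor_cycles_iff)
  then obtain z1 z2 where z: "z1 \<in> tcomp (shifts G (Suc (Suc n))) j" "w1 = tensor_differential G (Suc n) z1"
    "z2 \<in> tcomp (shifts G (Suc n)) (j - d)" "w2 = tensor_differential G n z2"
    using G by (auto simp: tor_vanishes_def tensor_boundaries_iff dest!: subsetD)
  have "glue (rank G (Suc (Suc n))) z1 (\<lambda>k. - z2 k) \<in> tcomp (shifts ?C (Suc (Suc n))) j"
    unfolding sh rank_def by (intro tcomp_glue tcomp_uminus z)
  moreover have "w = tensor_differential ?C (Suc n) (glue (rank G (Suc (Suc n))) z1 (\<lambda>k. - z2 k))"
    unfolding tensor_differential_koszul_step[OF f] mat_map_uminus mat_map_uminus_mat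
    by (simp add: w12(3) z tensor_differential_mat_map)
  ultimately show "w \<in> tensor_boundaries ?C (Suc n) j"
    by (auto simp: tensor_boundaries_iff)
qed

lemma not_tor_vanishes_koszul_step:
  assumes f: "const_coeff f = 0" and G: "\<not> tor_vanishes G n j"
  shows "\<not> tor_vanishes (koszul_step G f d) (Suc n) (j + d)"
proof
  let ?C = "koszul_step G f d"
  have sh: "shifts ?C (Suc m) = shifts G (Suc m) @ map (\<lambda>s. s + d) (shifts G m)" for m
    by (simp add: koszul_step_def shifts_cone)
  assume van: "tor_vanishes ?C (Suc n) (j + d)"
  obtain w where w: "w \<in> tensor_cycles G n j" "w \<notin> tensor_boundaries G n j"
    using G by (auto simp: tor_vanishes_def)
  let ?w = "glue (rank G (Suc n)) 0 w"
  have "?w \<in> tcomp (shifts ?C (Suc n)) (j + d)"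
    unfolding sh rank_def using w(1) by (intro tcomp_glue) (simp_all add: tensor_cycles_iff)
  moreover have "tensor_differential ?C n ?w = 0"
    using w(1) unfolding tensor_differential_koszul_step[OF f]
    by (simp add: tensor_cycles_iff tensor_differential_mat_map glue_def fun_eq_iff)
  ultimately have "?w \<in> tensor_cycles ?C (Suc n) (j + d)"
    by (simp add: tensor_cycles_def tensor_comp_tcomp)
  then obtain z where z: "z \<in> tcomp (shifts ?C (Suc (Suc n))) (j + d)" "?w = tensor_differential ?C (Suc n) z"
    using van by (auto simp: tor_vanishes_def tensor_boundaries_iff dest!: subsetD)
  obtain z1 z2 where z12: "z1 \<in> tcomp (shifts G (Suc (Suc n))) (j + d)" "z2 \<in> tcomp (shifts G (Suc n)) (j + d - d)"
    "z = glue (rank G (Suc (Suc n))) z1 z2"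
    using z(1) unfolding sh rank_def by (rule tcomp_glueE)
  have "glue (rank G (Suc n)) 0 w = glue (rank G (Suc n)) (tensor_differential G (Suc n) z1)
      (\<lambda>k. - tensor_differential G n z2 k)"
    using z(2) unfolding z12(3) tensor_differential_koszul_step[OF f] mat_map_uminus_mat
    by (simp add: tensor_differential_mat_map)
  from glue_inject[OF this] have "w = (\<lambda>k. - tensor_differential G n z2 k)"
    by (simp add: tensor_differential_outside)
  also have "\<dots> = tensor_differential G n (\<lambda>k. - z2 k)"
    by (simp add: tensor_differential_mat_map mat_map_uminus)
  finally have "w \<in> tensor_boundaries G n j"
    using tcomp_uminus[OF z12(2)] by (auto simp: tensor_boundaries_iff)
  then show False using w(2) by blast
qed

lemma tcomp_eq_0:
  assumes "w \<in> tcomp sh j" "\<And>s. s \<in> set sh \<Longrightarrow> s \<noteq> j"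
  shows "w = 0"
proof
  show "w k = 0 k" for k
    using assms(1) assms(2)[of "sh ! k"] by (auto simp: tcomp_def)
qed

lemma tor_vanishes_no_cycles:
  assumes "\<And>s. s \<in> set (shifts F i) \<Longrightarrow> s \<noteq> j"
  shows "tor_vanishes F i j"
proof -
  have "w = 0" if "w \<in> tcomp (shifts F i) j" for w :: "nat \<Rightarrow> 'b"
    using that assms by (rule tcomp_eq_0)
  moreover have "0 \<in> tensor_boundaries F i j"
    by (auto simp: tensor_boundaries_iff tensor_differential_mat_map intro!: bexI[of _ 0])
  ultimately show ?thesis
    unfolding tor_vanishes_def tensor_cycles_iff by (metis (no_types, lifting) subsetI tensor_cycles_iff)
qed

text \<open>A class at \<open>(i, j)\<close> reappears at \<open>(i + 1, j + d)\<close>, which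
  changes \<open>j - i\<close> by \<open>d - 1\<close>; the unshifted copy contributes nothing
  larger because \<open>d\<close> is positive.\<close>

lemma has_regularity_koszul_step:
  assumes G: "shifts G 0 = [0]" "has_regularity G r" and "0 \<le> r" and f: "homogeneous d f" "0 < d"
  shows "has_regularity (koszul_step G f d) (r + d - 1)"
proof -
  let ?C = "koszul_step G f d"
  have sh: "shifts ?C (Suc m) = shifts G (Suc m) @ map (\<lambda>s. s + d) (shifts G m)" "shifts ?C 0 = [0]" for m
    by (simp_all add: koszul_step_def shifts_cone G)
  have f0: "const_coeff f = 0"
    using const_coeff_homogeneous[OF f(1)] f(2) by auto
  note reg = G(2)[unfolded has_regularity_def]
  show ?thesis
    unfolding has_regularity_def
  proof (intro conjI allI ballI impI)
    show "int i \<le> s" if "s \<in> set (shifts ?C i)" for i s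
      using that reg f(2) by (cases i) (force simp: sh)+
    show "tor_vanishes ?C i j" if "j - int i > r + d - 1" for i j
    proof (cases i)
      case 0
      then show ?thesis
        using that \<open>0 \<le> r\<close> f(2) by (intro tor_vanishes_no_cycles) (auto simp: sh)
    next
      case (Suc n)
      then show ?thesis
        using that reg f(2) by (auto intro!: tor_vanishes_koszul_step[OF f0])
    qed
    obtain i j where "j - int i = r" "\<not> tor_vanishes G i j"
      using reg by blast
    then show "\<exists>i j. j - int i = r + d - 1 \<and> \<not> tor_vanishes ?C i j"
      using not_tor_vanishes_koszul_step[OF f0, of G i j d]
      by (intro exI[of _ "Suc i"] exI[of _ "j + d"]) auto
  qed
qed

text \<open>As \<open>r\<close> is positive, the extremal class does not sit in position 0 and so
  comes from the ideal, one position lower.\<close>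

theorem regularity_has_regularity:
  assumes G: "resolves V I G" "has_regularity G r" and "0 < r"
    and I: "I \<subseteq> R V" "\<And>p. p \<in> I \<Longrightarrow> const_coeff p = 0"
  shows "regularity V I = r + 1"
proof -
  obtain i j where ij: "j - int i = r" "\<not> tor_vanishes G i j"
    using G(2) by (auto simp: has_regularity_def)
  have "i \<noteq> 0"
  proof
    assume "i = 0"
    then have "tor_vanishes G i j"
      using ij(1) \<open>0 < r\<close> resolvesD(1)[OF G(1)] by (intro tor_vanishes_no_cycles) auto
    then show False using ij(2) by blast
  qed
  then obtain n where n: "i = Suc n" by (cases i) auto
  show ?thesis
  proof (rule regularity_eqI[OF G(1) I])
    show "int i \<le> s" if "s \<in> set (shifts G i)" for i s
      using that G(2) by (auto simp: has_regularity_def)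
    show "tor_vanishes G (Suc i) (j + 1)" if "j - int i > r" for i j
      using that G(2) by (auto simp: has_regularity_def)
    have "int n + r + 1 = j" using ij(1) n by simp
    then show "\<not> tor_vanishes G (Suc n) (int n + r + 1)"
      using ij(2) n by simp
  qed
qed


section \<open>The resolution of the X-pentomino ideal\<close>

text \<open>
  With \<open>L = J + (\<Delta>)\<close>, multiplication by \<open>\<Delta>\<close> is null-homotopic on a resolution of \<open>S/L\<close>.  In the top
  degree of the mapping cone of \<open>\<Delta> : K(Y) \<rightarrow> K(J)\<close> this exhibits \<open>\<Delta>\<close> as a combination of the entry \<open>c\<close>
  of the comparison map and of elements of \<open>(Y)\<close>; hence \<open>c \<noteq> 0\<close>, and the two top summands cancel.
\<close>

lemma comparison_top_nonzero:
  assumes J: "length Js = 4" "\<And>f. f \<in> set Js \<Longrightarrow> f \<in> R V \<and> homogeneous 2 f" "regseq {} (rev Js)"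
    and Y: "length Ys = 4" "\<And>f. f \<in> set Ys \<Longrightarrow> f \<in> R V \<and> homogeneous 1 f" "regseq {} (rev Ys)"
    and \<Delta>: "\<Delta> \<in> R V" "homogeneous 4 \<Delta>" "\<Delta> \<notin> ispan (set Ys)"
      "\<And>x. \<Delta> * x \<in> ispan (set Js) \<longleftrightarrow> x \<in> ispan (set Ys)"
    and \<Phi>: "chain_map V (koszul Ys 1) (koszul Js 2) 4 \<Phi>" "\<Phi> 0 0 0 = \<Delta>"
  shows "const_coeff (\<Phi> 4 0 0) \<noteq> 0"
proof
  let ?J = "koszul Js 2" and ?Y = "koszul Ys 1"
  let ?P = "cone ?Y ?J \<Phi> 4"
  assume c: "const_coeff (\<Phi> 4 0 0) = 0"
  have P: "resolves V (ideal_on V (insert \<Delta> (set Js))) ?P"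
    using J by (intro resolves_cone_ideal_on[OF _ \<Delta>(1) resolves_koszul resolves_koszul \<Delta>(4) \<Phi>] Y) auto
  have rank: "rank ?P 6 = 0" "rank ?P 5 = 1" "rank ?J 5 = 0" "rank ?J 4 = 1" "rank ?Y 4 = 1"
    by (simp_all add: rank_cone rank_koszul J Y eval_nat_numeral)
  \<comment> \<open>The entry leads from degree 4 + 4 to degree 8. It is thus a constant, and zero
    if its constant coefficient is.\<close>
  have "homogeneous (shifts ?Y 4 ! 0 + 4 - shifts ?J 4 ! 0) (\<Phi> 4 0 0)"
    using chain_mapD(1)[OF \<Phi>(1), of 4] rank by (simp add: hmat_def rank_def)
  moreover have "shifts ?Y 4 ! 0 = 4" "shifts ?J 4 ! 0 = 8"
    using shifts_koszul[of "shifts ?Y 4 ! 0" Ys 1 4] shifts_koszul[of "shifts ?J 4 ! 0" Js 2 4] rank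
    by (simp_all add: rank_def)
  ultimately have c0: "\<Phi> 4 0 0 = 0"
    using c homogeneous_0_const by simp
  have scalar: "chain_map V ?P ?P 4 (\<lambda>i k l. if k = l then \<Delta> else 0)"
    by (rule chain_map_scalar[OF \<Delta>(1,2)])
  have "(if 0 = (0 :: nat) then \<Delta> else 0) \<in> ideal_on V (insert \<Delta> (set Js))"
    using \<Delta>(1) by (simp add: ideal_on_def ideal.span_base)
  then obtain h :: "nat \<Rightarrow> nat \<Rightarrow> nat \<Rightarrow> ('a, 'b) mpoly" where
    h: "\<And>i k l. k < rank ?P (Suc i) \<Longrightarrow> l < rank ?P (Suc i) \<Longrightarrow> (if k = l then \<Delta> else 0) =
      (\<Sum>m<rank ?P (Suc (Suc i)). diff ?P (Suc i) k m * h (Suc i) m l) +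
      (\<Sum>m<rank ?P i. h i k m * diff ?P i m l)"
    by (rule null_homotopic[OF P P scalar]) (rule that)
  \<comment> \<open>Position 5 is the top of the cone, so only the term \<open>h d\<close> of the
    homotopy survives there.\<close>
  have "\<Delta> = (\<Sum>m<rank ?P 4. h 4 0 m * diff ?P 4 m 0)"
    using h[of 0 4 0] rank(1,2) by simp
  also have "\<dots> \<in> ispan (set Ys)"
  proof (intro ideal.span_sum ideal.span_scale)
    fix m assume m: "m \<in> {..<rank ?P 4}"
    show "diff ?P 4 m 0 \<in> ispan (set Ys)"
    proof (cases "m = 0")
      case True
      then show ?thesis
        by (simp add: diff_cone rank c0 ideal.span_zero)
    next
      case False
      have "diff ?Y 3 (m - 1) 0 \<in> ispan (set Ys)"
        using m False rank by (intro diff_koszul) (auto simp: rank_cone)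
      then show ?thesis
        using False by (simp add: diff_cone rank ideal.span_neg)
    qed
  qed
  finally show False using \<Delta>(3) by blast
qed

text \<open>In position \<open>i\<close>, \<open>P\<close> has degrees \<open>2 i\<close> and
  \<open>i + 3\<close>, and \<open>G\<close> has degrees \<open>2 i\<close> and
  \<open>i + 4\<close>, within the ranges below. Only degree 10 in position 5 exceeds regularity 4.
  It stems from the top of the complex of \<open>Js\<close>, and cancels against position 6, which
  stems from the top of the complex of \<open>Ys\<close>.\<close>

lemma exists_resolution_X:
  assumes J: "length Js = 4" "\<And>f. f \<in> set Js \<Longrightarrow> f \<in> R V \<and> homogeneous 2 f" "regseq {} (rev Js)"
    and Y: "length Ys = 4" "\<And>f. f \<in> set Ys \<Longrightarrow> f \<in> R V \<and> homogeneous 1 f" "regseq {} (rev Ys)"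
    and \<Delta>: "\<Delta> \<in> R V" "homogeneous 4 \<Delta>" "\<Delta> \<notin> ispan (set Ys)"
      "\<And>x. \<Delta> * x \<in> ispan (set Js) \<longleftrightarrow> x \<in> ispan (set Ys)"
    and c: "c \<in> R V" "homogeneous 2 c" "\<And>x. c * x \<in> ispan (set Js) \<longleftrightarrow> x \<in> ispan (insert \<Delta> (set Js))"
  shows "\<exists>G. resolves V (ideal_on V (insert c (set Js))) G \<and> has_regularity G 4"
proof -
  let ?J = "koszul Js 2" and ?Y = "koszul Ys 1"
  have resJ: "resolves V (ideal_on V (set Js)) ?J" and resY: "resolves V (ideal_on V (set Ys)) ?Y"
    using J Y by (auto intro: resolves_koszul)
  obtain \<Phi> where \<Phi>: "chain_map V ?Y ?J 4 \<Phi>" "\<Phi> 0 0 0 = \<Delta>"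
    by (rule exists_chain_map_ideal_on[OF \<Delta>(1,2) resJ resY \<Delta>(4)])
  note top = comparison_top_nonzero[OF J Y \<Delta> \<Phi>]
  define P where "P = cone ?Y ?J \<Phi> 4"
  have P: "resolves V (ideal_on V (insert \<Delta> (set Js))) P"
    unfolding P_def using J resJ resY \<Delta>(1,4) \<Phi> by (intro resolves_cone_ideal_on) auto
  obtain \<Psi> where \<Psi>: "chain_map V P ?J 2 \<Psi>" "\<Psi> 0 0 0 = c"
    by (rule exists_chain_map_ideal_on[OF c(1,2) resJ P c(3)])
  define G where "G = cone P ?J \<Psi> 2"
  have G: "resolves V (ideal_on V (insert c (set Js))) G"
    unfolding G_def using J resJ P c(1,3) \<Psi> by (intro resolves_cone_ideal_on) auto
  have sJ: "s = 2 * int i \<and> i \<le> 4" if "s \<in> set (shifts ?J i)" for s i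
  proof -
    have "rank ?J i \<noteq> 0" using that by (auto simp: rank_def)
    then show ?thesis using shifts_koszul[OF that] by (simp add: rank_koszul J)
  qed
  have sY: "s = int i \<and> i \<le> 4" if "s \<in> set (shifts ?Y i)" for s i
  proof -
    have "rank ?Y i \<noteq> 0" using that by (auto simp: rank_def)
    then show ?thesis using shifts_koszul[OF that] by (simp add: rank_koszul Y)
  qed
  have sP: "s = 2 * int i \<and> i \<le> 4 \<or> s = int i + 3 \<and> 1 \<le> i \<and> i \<le> 5" if "s \<in> set (shifts P i)" for s i
    using that unfolding P_def shifts_cone by (cases i) (auto dest!: sJ sY)
  have sG: "s = 2 * int i \<and> i \<le> 5 \<or> s = int i + 4 \<and> 2 \<le> i \<and> i \<le> 6" if "s \<in> set (shifts G i)" for s i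
    using that unfolding G_def shifts_cone by (cases i) (auto dest!: sJ sP)
  have rank: "rank ?J 6 = 0" "rank ?J 5 = 0" "rank ?J 4 = 1" "rank ?Y 4 = 1" "rank ?Y 5 = 0" "rank P 5 = 1" "rank G 6 = 1"
      "rank G 5 > 0"
    by (simp_all add: G_def P_def rank_cone rank_koszul J Y eval_nat_numeral)
  have shifts: "shifts ?J 4 ! 0 = 8" "shifts ?Y 4 ! 0 = 4"
    using shifts_koszul[of "shifts ?Y 4 ! 0" Ys 1 4] shifts_koszul[of "shifts ?J 4 ! 0" Js 2 4] rank
    by (simp_all add: rank_def)
  have G5: "shifts G 5 = map (\<lambda>s. s + 2) (shifts P 4)" and G6: "shifts G 6 = map (\<lambda>s. s + 2) (shifts P 5)"
    and P4: "shifts P 4 = shifts ?J 4 @ map (\<lambda>s. s + 4) (shifts ?Y 3)" and P5: "shifts P 5 = map (\<lambda>s. s + 4) (shifts ?Y 4)"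
    using rank by (simp_all add: G_def P_def shifts_cone rank_def eval_nat_numeral)
  have "tor_vanishes G 5 10"
    unfolding tor_vanishes_def
  proof
    fix w assume "w \<in> tensor_cycles G 5 10"
    then have w: "w \<in> tcomp (shifts G 5) 10"
      by (simp add: tensor_cycles_iff)
    \<comment> \<open>The other basis elements of \<open>G\<close> in position 5 come from position
      3 of the complex of \<open>Ys\<close> and have degree 3 + 4 + 2.\<close>
    have uniq: "u k = 0" if u: "u \<in> tcomp (shifts G 5) 10" and "k \<noteq> 0" for u :: "nat \<Rightarrow> 'b" and k
    proof (rule ccontr)
      assume "u k \<noteq> 0"
      then have k: "k < length (shifts P 4)" "shifts P 4 ! k = 8"
        using u by (auto simp: tcomp_def G5)
      then have "k - 1 < length (shifts ?Y 3)" "shifts P 4 ! k = shifts ?Y 3 ! (k - 1) + 4"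
        using \<open>k \<noteq> 0\<close> rank(3) by (auto simp: P4 nth_append rank_def)
      moreover from this have "shifts ?Y 3 ! (k - 1) = 3"
        using sY[of "shifts ?Y 3 ! (k - 1)" 3] by simp
      ultimately show False using k by simp
    qed
    \<comment> \<open>The sign compensates the one in the differential of the cone.\<close>
    define y where "y k = (if k = 0 then - (w 0 / const_coeff (\<Phi> 4 0 0)) else 0)" for k :: nat
    have y: "y \<in> tcomp (shifts G (Suc 5)) 10"
      using rank(4) shifts(2) by (auto simp: y_def tcomp_def G6 P5 rank_def)
    have "tensor_differential G 5 y \<in> tcomp (shifts G 5) 10"
      using tcomp_mat_map[OF resolvesD(3)[OF G] y] by (simp add: tensor_differential_mat_map rank_def)
    moreover have "tensor_differential G 5 y 0 = w 0"
    proof -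
      have "diff G 5 0 0 = - \<Phi> 4 0 0"
        using rank by (simp add: G_def P_def diff_cone)
      then show ?thesis
        using rank top by (simp add: tensor_differential_def y_def const_coeff_uminus)
    qed
    ultimately have "tensor_differential G 5 y k = w k" for k
      using uniq[of "tensor_differential G 5 y" k] uniq[of w k] w by (cases "k = 0") auto
    then have "w = tensor_differential G 5 y" by auto
    then show "w \<in> tensor_boundaries G 5 10"
      using y by (auto simp: tensor_boundaries_iff)
  qed
  then have van: "tor_vanishes G i j" if "j - int i > 4" for i j
  proof (cases "i = 5 \<and> j = 10")
    case False
    then show ?thesis
      using that sG by (intro tor_vanishes_no_cycles) fastforce
  qed simp
  \<comment> \<open>The top of the complex of \<open>Js\<close> survives, since positions 3 and 5
    contain nothing of degree 8.\<close>
  have non: "\<not> tor_vanishes G 4 8"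
  proof
    assume "tor_vanishes G 4 8"
    moreover have e: "unit_vec 0 \<in> tcomp (shifts G 4) 8"
      using shifts(1) rank(3) by (auto simp: tcomp_def unit_vec_def G_def shifts_cone nth_append rank_def)
    have "tensor_differential G 3 (unit_vec 0) \<in> tcomp (shifts G 3) 8"
      using tcomp_mat_map[OF resolvesD(3)[OF G, of 3]] e by (simp add: tensor_differential_mat_map rank_def eval_nat_numeral)
    then have "tensor_differential G 3 (unit_vec 0) = 0"
      by (rule tcomp_eq_0) (auto dest!: sG)
    then have "unit_vec 0 \<in> tensor_cycles G (Suc 3) 8"
      using e by (simp add: tensor_cycles_def tensor_comp_tcomp)
    ultimately have "unit_vec 0 \<in> tensor_boundaries G 4 8"
      by (auto simp: tor_vanishes_def)
    then obtain y where y: "y \<in> tcomp (shifts G (Suc 4)) 8" "unit_vec 0 = tensor_differential G 4 y"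
      by (auto simp: tensor_boundaries_iff)
    have "y = 0"
      using y(1) by (rule tcomp_eq_0) (auto dest!: sG)
    then have "unit_vec 0 0 = (0 :: 'b)"
      using fun_cong[OF y(2), of 0] by (simp add: tensor_differential_mat_map)
    then show False by (simp add: unit_vec_def)
  qed
  have "int i \<le> s" if "s \<in> set (shifts G i)" for i s
    using sG[OF that] by auto
  then have "has_regularity G 4"
    unfolding has_regularity_def using van non
    by (intro conjI allI ballI impI exI[of _ 4] exI[of _ 8]) auto
  then show ?thesis using G by blast
qed


section \<open>Ideals of arms\<close>

definition resolvable :: "'v set \<Rightarrow> ('v, 'k::field) mpoly set \<Rightarrow> int \<Rightarrow> bool"
  where "resolvable V I r \<longleftrightarrow> (\<exists>G. resolves V I G \<and> has_regularity G r)"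

lemma homogeneous_Var: "homogeneous 1 (Var v)"
  unfolding homogeneous_whom by (rule whom_Var) (simp add: unit_weight_def)

lemma homogeneous_mult: "homogeneous d p \<Longrightarrow> homogeneous e q \<Longrightarrow> homogeneous (d + e) (p * q)"
  unfolding homogeneous_whom by (rule whom_mult)

lemma homogeneous_minor: "homogeneous 2 (Var a * Var b - Var c * Var d)"
proof -
  have "homogeneous 2 (Var x * Var y :: ('a, 'b) mpoly)" for x y
    using homogeneous_mult[OF homogeneous_Var[of x] homogeneous_Var[of y]] by simp
  then show ?thesis
    unfolding homogeneous_whom by (intro whom_diff)
qed

lemma const_coeff_ispan:
  assumes "\<And>g. g \<in> B \<Longrightarrow> const_coeff g = 0" "p \<in> ispan B"
  shows "const_coeff p = 0"
  using assms(2)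
  by (induction rule: ideal.span_induct_alt) (simp_all add: assms(1) const_coeff_add const_coeff_mult)

lemma ispan_eq_up_to_sign:
  assumes "\<And>g. g \<in> A \<Longrightarrow> g \<in> B \<or> - g \<in> B" "\<And>g. g \<in> B \<Longrightarrow> g \<in> A \<or> - g \<in> A"
  shows "ispan A = ispan B"
proof -
  have "g \<in> ispan C" if "g \<in> C \<or> - g \<in> C" for g :: 'a and C
    using that ideal.span_neg[of "- g" C] by (auto intro: ideal.span_base)
  then show ?thesis
    unfolding ideal.span_eq using assms by blast
qed

context arms
begin

definition gens where "gens = insert center J"

lemma R_gens:
  assumes "{y0, y1, y2, y3} \<union> P0 \<union> P1 \<union> P2 \<union> P3 \<subseteq> V"
  shows "gens \<subseteq> R V"
proof
  fix g assume "g \<in> gens"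
  moreover have "g \<in> R V" if "g \<in> set (chain (X a) (X b) xs)" "{a, b} \<union> set (pvars xs) \<subseteq> V" for a b xs
    using vars_chain[OF that(1)] that(2) unfolding R_iff_vars by auto
  moreover have "center \<in> R V"
    using assms unfolding center_def by (intro R_diff R_mult R_Var) auto
  ultimately show "g \<in> R V"
    using assms unfolding gens_def J_arms chain_eqs[symmetric] P0_def P1_def P2_def P3_def by blast
qed

lemma homogeneous_gens: "g \<in> {center, f0, f1, f2, f3} \<Longrightarrow> homogeneous 2 g"
  unfolding center_def f0_def f1_def f2_def f3_def by (auto intro: homogeneous_minor)

lemma resolvable_base:
  assumes "zs0 = []" "zs1 = []" "zs2 = []" "zs3 = []"
    and V: "{y0, y1, y2, y3} \<union> P0 \<union> P1 \<union> P2 \<union> P3 \<subseteq> V"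
  shows "resolvable V (ideal_on V gens) 4"
proof -
  have tails: "tails = {}"
    unfolding tails_def tail0_def tail1_def tail2_def tail3_def by (simp add: assms)
  have J: "J = set [f0, f1, f2, f3]" and Y: "Y = set [X y0, X y1, X y2, X y3]"
    by (auto simp: J_def Y_def tails)
  have \<Delta>: "homogeneous 4 \<Delta>"
  proof -
    have "homogeneous (1 + 1 + 1 + 1) (X a * X b * X c * X d)" for a b c d
      by (intro homogeneous_mult homogeneous_Var)
    then show ?thesis
      unfolding \<Delta>_def homogeneous_whom by (intro whom_diff) simp_all
  qed
  \<comment> \<open>Otherwise cancelling the regular element \<open>\<Delta>\<close> would make
    \<open>(Y)\<close> the unit ideal.\<close>
  have "\<Delta> \<notin> ispan Y"
  proof
    assume "\<Delta> \<in> ispan Y"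
    then have "1 \<in> ispan Y"
      using nzdD[OF nzd_Y_\<Delta>, of 1] by simp
    moreover have "const_coeff g = 0" if "g \<in> Y" for g
      using that const_coeff_homogeneous[OF homogeneous_Var] unfolding Y by fastforce
    ultimately have "const_coeff (1 :: ('v, 'k) mpoly) = 0"
      using const_coeff_ispan by blast
    then show False by simp
  qed
  moreover have "\<Delta> \<in> R V"
    using V in_P unfolding \<Delta>_def by (intro R_diff R_mult R_Var) blast+
  moreover have "f \<in> R V \<and> homogeneous 2 f" if "f \<in> {center, f0, f1, f2, f3}" for f
    using that R_gens[OF V] homogeneous_gens by (auto simp: gens_def J_def)
  moreover have "f \<in> R V \<and> homogeneous 1 f" if "f \<in> Y" for f
    using that V unfolding Y by (auto intro: R_Var homogeneous_Var)
  ultimately show ?thesis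
    unfolding resolvable_def gens_def J
    using exists_resolution_X[of "[f0, f1, f2, f3]" V "[X y0, X y1, X y2, X y3]" \<Delta> center] \<Delta>
      regseq_J[OF assms(1-4)] regseq_Y colon_\<Delta> colon_center
    unfolding J Y by simp
qed

lemma resolvable_prolong:
  assumes prolonged: "arms y0 y1 y2 y3 u0 v0 u1 v1 u2 v2 u3 v3 (zs0 @ [(a, b)]) zs1 zs2 zs3"
    and V: "{y0, y1, y2, y3} \<union> P0 \<union> P1 \<union> P2 \<union> P3 \<union> {a, b} \<subseteq> V"
    and r: "resolvable V (ideal_on V gens) r" "0 \<le> r"
  shows "resolvable V (ideal_on V (arms.gens y0 y1 y2 y3 u0 v0 u1 v1 u2 v2 u3 v3 (zs0 @ [(a, b)]) zs1 zs2 zs3 ::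
    ('v, 'k) mpoly set)) (r + 1)"
proof -
  interpret pro: arms y0 y1 y2 y3 u0 v0 u1 v1 u2 v2 u3 v3 "zs0 @ [(a, b)]" zs1 zs2 zs3 "TYPE('k)"
    by (rule prolonged)
  let ?g = "X (fst (last ((u0, v0) # zs0))) * X b - X (snd (last ((u0, v0) # zs0))) * X a"
  note prolong = nzd_prolong[OF prolonged]
  have gens: "pro.gens = insert ?g gens"
    unfolding gens_def pro.gens_def prolong(1) by auto
  have "{y0, y1, y2, y3} \<union> pro.P0 \<union> P1 \<union> P2 \<union> P3 \<subseteq> V"
    using V by (auto simp: P0_def pro.P0_def)
  then have R: "?g \<in> R V" "gens \<subseteq> R V"
    using pro.R_gens gens by auto
  obtain G where G: "resolves V (ideal_on V gens) G" "has_regularity G r"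
    using r by (auto simp: resolvable_def)
  have "resolves V (ideal_on V pro.gens) (koszul_step G ?g 2)"
    unfolding gens using prolong(2) R G(1)
    by (intro resolves_koszul_step homogeneous_minor) (simp_all add: gens_def)
  moreover have "has_regularity (koszul_step G ?g 2) (r + 2 - 1)"
    using G r(2) resolvesD(1) homogeneous_minor by (intro has_regularity_koszul_step) auto
  ultimately show ?thesis
    by (auto simp: resolvable_def add.commute)
qed

interpretation rot: arms y1 y2 y3 y0 u1 v1 u2 v2 u3 v3 u0 v0 zs1 zs2 zs3 zs0 "TYPE('k)"
  by (rule rotated)

lemma ideal_on_rot_gens: "ideal_on V rot.gens = ideal_on V gens"
proof -
  have "ispan rot.gens = ispan gens"
    by (rule ispan_eq_up_to_sign) (auto simp: rot.gens_def gens_def rot_simps)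
  then show ?thesis by (simp add: ideal_on_def)
qed

end

lemma arms_butlast:
  assumes "arms y0 y1 y2 y3 u0 v0 u1 v1 u2 v2 u3 v3 (zs0 @ zs) zs1 zs2 zs3"
  shows "arms y0 y1 y2 y3 u0 v0 u1 v1 u2 v2 u3 v3 zs0 zs1 zs2 zs3"
proof -
  have middle: "distinct (A @ B @ C)" if "distinct (A @ (B @ D) @ C)" for A B C D :: "'a list"
    using that by auto
  have "pvars ((u0, v0) # zs0 @ zs) = pvars ((u0, v0) # zs0) @ pvars zs"
    by (simp add: pvars_simps)
  then show ?thesis
    using assms middle unfolding arms_def by metis
qed

lemma resolvable_grow:
  fixes V :: "'v set" and field_type :: "'k::field itself"
  assumes "arms y0 y1 y2 y3 u0 v0 u1 v1 u2 v2 u3 v3 zs0 zs1 zs2 zs3"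
    and "{y0, y1, y2, y3, u0, v0} \<union> set (pvars zs0) \<union> set (pvars ((u1, v1) # zs1)) \<union>
      set (pvars ((u2, v2) # zs2)) \<union> set (pvars ((u3, v3) # zs3)) \<subseteq> V"
    and "resolvable V (ideal_on V (arms.gens y0 y1 y2 y3 u0 v0 u1 v1 u2 v2 u3 v3 [] zs1 zs2 zs3 :: ('v, 'k) mpoly set)) r"
    and "0 \<le> r"
  shows "resolvable V (ideal_on V (arms.gens y0 y1 y2 y3 u0 v0 u1 v1 u2 v2 u3 v3 zs0 zs1 zs2 zs3 :: ('v, 'k) mpoly set))
    (r + int (length zs0))"
  using assms(1,2)
proof (induction zs0 rule: rev_induct)
  case Nil
  then show ?case using assms(3) by simp
next
  case (snoc ab zs0)
  obtain a b where ab: "ab = (a, b)" by (cases ab)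
  interpret arms y0 y1 y2 y3 u0 v0 u1 v1 u2 v2 u3 v3 zs0 zs1 zs2 zs3 "TYPE('k)"
    using snoc(2) by (rule arms_butlast)
  have V: "{y0, y1, y2, y3} \<union> P0 \<union> P1 \<union> P2 \<union> P3 \<union> {a, b} \<subseteq> V"
    using snoc(3) unfolding ab P0_def P1_def P2_def P3_def pvars_simps by auto
  have "resolvable V (ideal_on V gens) (r + int (length zs0))"
    using snoc(3) by (intro snoc(1) arms_axioms) (simp add: ab)
  then show ?case
    using resolvable_prolong[OF snoc(2)[unfolded ab] V, of "r + int (length zs0)"] assms(4)
    by (simp add: ab algebra_simps)
qed

text \<open>Only the first arm can be prolonged directly. Starting from four single cells, each arm
  is rotated into first place and grown in turn, beginning with \<open>zs3\<close>.\<close>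

theorem resolvable_arms:
  fixes V :: "'v set" and field_type :: "'k::field itself"
  assumes "arms y0 y1 y2 y3 u0 v0 u1 v1 u2 v2 u3 v3 zs0 zs1 zs2 zs3"
    and "{y0, y1, y2, y3} \<union> set (pvars ((u0, v0) # zs0)) \<union> set (pvars ((u1, v1) # zs1)) \<union>
      set (pvars ((u2, v2) # zs2)) \<union> set (pvars ((u3, v3) # zs3)) \<subseteq> V"
  shows "resolvable V (ideal_on V (arms.gens y0 y1 y2 y3 u0 v0 u1 v1 u2 v2 u3 v3 zs0 zs1 zs2 zs3 :: ('v, 'k) mpoly set))
    (4 + int (length zs0 + length zs1 + length zs2 + length zs3))"
proof -
  have a0: "arms y0 y1 y2 y3 u0 v0 u1 v1 u2 v2 u3 v3 [] zs1 zs2 zs3"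
    using arms_butlast[of _ _ _ _ _ _ _ _ _ _ _ _ "[]"] assms(1) by simp
  interpret a0: arms y0 y1 y2 y3 u0 v0 u1 v1 u2 v2 u3 v3 "[]" zs1 zs2 zs3 "TYPE('k)" by (rule a0)
  note r0 = a0.rotated
  have a1: "arms y1 y2 y3 y0 u1 v1 u2 v2 u3 v3 u0 v0 [] zs2 zs3 []"
    using arms_butlast[of _ _ _ _ _ _ _ _ _ _ _ _ "[]"] r0 by simp
  interpret a1: arms y1 y2 y3 y0 u1 v1 u2 v2 u3 v3 u0 v0 "[]" zs2 zs3 "[]" "TYPE('k)" by (rule a1)
  note r1 = a1.rotated
  have a2: "arms y2 y3 y0 y1 u2 v2 u3 v3 u0 v0 u1 v1 [] zs3 [] []"
    using arms_butlast[of _ _ _ _ _ _ _ _ _ _ _ _ "[]"] r1 by simp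
  interpret a2: arms y2 y3 y0 y1 u2 v2 u3 v3 u0 v0 u1 v1 "[]" zs3 "[]" "[]" "TYPE('k)" by (rule a2)
  note r2 = a2.rotated
  have a3: "arms y3 y0 y1 y2 u3 v3 u0 v0 u1 v1 u2 v2 [] [] [] []"
    using arms_butlast[of _ _ _ _ _ _ _ _ _ _ _ _ "[]"] r2 by simp
  interpret a3: arms y3 y0 y1 y2 u3 v3 u0 v0 u1 v1 u2 v2 "[]" "[]" "[]" "[]" "TYPE('k)" by (rule a3)
  have "resolvable V (ideal_on V a3.gens) 4"
    using assms(2) by (intro a3.resolvable_base) (auto simp: a3.P0_def a3.P1_def a3.P2_def a3.P3_def pvars_simps)
  from resolvable_grow[OF r2 _ this]
  have "resolvable V (ideal_on V a2.gens) (4 + int (length zs3))"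
    using assms(2) by (simp add: pvars_simps a2.ideal_on_rot_gens)
  from resolvable_grow[OF r1 _ this]
  have "resolvable V (ideal_on V a1.gens) (4 + int (length zs3) + int (length zs2))"
    using assms(2) by (simp add: pvars_simps a1.ideal_on_rot_gens)
  from resolvable_grow[OF r0 _ this]
  have "resolvable V (ideal_on V a0.gens) (4 + int (length zs3) + int (length zs2) + int (length zs1))"
    using assms(2) by (simp add: pvars_simps a0.ideal_on_rot_gens)
  from resolvable_grow[OF assms(1) _ this]
  show ?thesis
    using assms(2) by (simp add: pvars_simps algebra_simps)
qed


section \<open>Generated ideals\<close>

lemma poly_ring_simps:
  "x \<oplus>\<^bsub>poly_ring V\<^esub> y = x + y" "x \<otimes>\<^bsub>poly_ring V\<^esub> y = x * y" "\<zero>\<^bsub>poly_ring V\<^esub> = 0"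
  by (simp_all add: poly_ring_def)

lemma genideal_poly_ring:
  fixes B :: "('v, 'k::field) mpoly set"
  assumes "B \<subseteq> R V"
  shows "genideal (poly_ring V) B = ideal_on V B"
proof -
  interpret cring "poly_ring V :: ('v, 'k) mpoly ring" by (rule cring_poly_ring)
  have "ideal (ideal_on V B) (poly_ring V)"
  proof (rule idealI)
    show "ring (poly_ring V :: ('v, 'k) mpoly ring)" by (rule ring_axioms)
    show "subgroup (ideal_on V B) (add_monoid (poly_ring V))"
    proof (rule add.subgroupI)
      show "ideal_on V B \<subseteq> R V" "ideal_on V B \<noteq> {}"
        using ideal.span_zero[of B] by (auto simp: ideal_on_def)
      fix a assume a: "a \<in> ideal_on V B"
      have "\<ominus>\<^bsub>poly_ring V\<^esub> a = - a"
        using a by (intro minus_equality) (auto simp: ideal_on_def poly_ring_simps intro: R_uminus)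
      then show "\<ominus>\<^bsub>poly_ring V\<^esub> a \<in> ideal_on V B"
        using a by (auto simp: ideal_on_def intro: R_uminus ideal.span_neg)
      show "a \<oplus>\<^bsub>poly_ring V\<^esub> b \<in> ideal_on V B" if "b \<in> ideal_on V B" for b
        using a that by (auto simp: ideal_on_def poly_ring_simps intro: R_add ideal.span_add)
    qed
    show "x \<otimes>\<^bsub>poly_ring V\<^esub> a \<in> ideal_on V B" "a \<otimes>\<^bsub>poly_ring V\<^esub> x \<in> ideal_on V B"
      if "a \<in> ideal_on V B" "x \<in> R V" for a x
      using that by (auto simp: ideal_on_def poly_ring_simps intro: R_mult ideal.span_scale ispan_scale2)
  qed
  moreover have "B \<subseteq> ideal_on V B"
    using assms by (auto simp: ideal_on_def intro: ideal.span_base)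
  moreover have "ideal_on V B \<subseteq> I" if I: "ideal I (poly_ring V)" "B \<subseteq> I" for I
  proof
    interpret I: ideal I "poly_ring V" by (rule I(1))
    fix p assume p: "p \<in> ideal_on V B"
    \<comment> \<open>Coefficients of a member of \<open>ispan B\<close> may involve variables
      outside \<open>V\<close>; selecting removes them and fixes the members of
      \<open>R V\<close>.\<close>
    have "select (\<lambda>m. Poly_Mapping.keys m \<subseteq> V) x \<in> I" if "x \<in> ispan B" for x
      using that
    proof (induction rule: ideal.span_induct_alt)
      case base
      then show ?case using I.zero_closed by (simp add: poly_ring_simps)
    next
      case (step c g x)
      have "select (\<lambda>m. Poly_Mapping.keys m \<subseteq> V) c * g \<in> I"
        using I.I_l_closed[OF _ R_select] step(1) I(2) by (auto simp: poly_ring_simps)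
      then show ?case
        using step I.a_closed assms by (auto simp: select_add select_mult_R poly_ring_simps)
    qed
    then show "p \<in> I"
      using p select_R by (fastforce simp: ideal_on_def)
  qed
  ultimately show ?thesis
    unfolding genideal_def by blast
qed


section \<open>Generalized X-pentominoes\<close>

definition arm_pairs :: "(nat \<Rightarrow> 'v) \<Rightarrow> (nat \<Rightarrow> 'v) \<Rightarrow> nat \<Rightarrow> nat \<Rightarrow> ('v \<times> 'v) list"
  where "arm_pairs P Q m n = map (\<lambda>t. (P t, Q t)) [m..<Suc n]"

lemma arm_pairs_Cons: "m \<le> n \<Longrightarrow> arm_pairs P Q m n = (P m, Q m) # arm_pairs P Q (Suc m) n"
  by (simp add: arm_pairs_def upt_conv_Cons del: upt_Suc)

lemma length_arm_pairs [simp]: "length (arm_pairs P Q m n) = Suc n - m"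
  by (simp add: arm_pairs_def del: upt_Suc)

lemma set_pvars_arm_pairs: "set (pvars (arm_pairs P Q m n)) = P ` {m..n} \<union> Q ` {m..n}"
  by (simp add: arm_pairs_def set_pvars image_image atLeastLessThanSuc_atLeastAtMost del: upt_Suc)

lemma distinct_pvars_arm_pairs:
  assumes "inj_on P {m..n}" "inj_on Q {m..n}" "P ` {m..n} \<inter> Q ` {m..n} = {}"
  shows "distinct (pvars (arm_pairs P Q m n))"
proof -
  have "distinct (pvars (map (\<lambda>t. (P t, Q t)) l))" if "distinct l" "set l \<subseteq> {m..n}" for l
    using that
  proof (induction l)
    case (Cons t l)
    then have t: "t \<in> {m..n}" "t \<notin> set l" "set l \<subseteq> {m..n}" by auto
    have "P t \<notin> P ` set l" "Q t \<notin> Q ` set l"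
      using t assms(1,2) by (simp_all add: inj_on_image_mem_iff)
    moreover have "P t \<notin> Q ` set l" "Q t \<notin> P ` set l" "P t \<noteq> Q t"
      using t assms(3) by blast+
    ultimately show ?case
      using Cons by (simp add: pvars_simps set_pvars image_image)
  qed (simp add: pvars_simps)
  then show ?thesis
    unfolding arm_pairs_def by (simp add: atLeastLessThanSuc_atLeastAtMost del: upt_Suc)
qed

lemma chain_arm_pairs:
  assumes "m \<le> n"
  shows "chain (Var (P m)) (Var (Q m)) (arm_pairs P Q (Suc m) n) =
    map (\<lambda>t. Var (P t) * Var (Q (Suc t)) - Var (Q t) * Var (P (Suc t))) [m..<n]"
  using assms
proof (induction rule: inc_induct)
  case base
  then show ?case by (simp add: arm_pairs_def)
next
  case (step m)
  then show ?case by (simp add: arm_pairs_Cons upt_conv_Cons)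
qed

lemma set_chain_arm_pairs:
  "set (chain (Var (P 0)) (Var (Q 0)) (arm_pairs P Q 1 n)) =
    (\<lambda>t. Var (P t) * Var (Q (Suc t)) - Var (Q t) * Var (P (Suc t))) ` {..<n}"
  unfolding One_nat_def chain_arm_pairs[OF le0] by (simp add: lessThan_atLeast0)

text \<open>The arms are listed counterclockwise from the right, which is the cyclic order of the
  edges of the central cell.\<close>

definition cross :: "nat \<Rightarrow> nat \<Rightarrow> nat \<Rightarrow> nat \<Rightarrow> nat \<Rightarrow> nat \<Rightarrow> cell list"
  where "cross i j n0 n1 n2 n3 = (i, j) # map (\<lambda>t. (i + 1 + t, j)) [0..<n0] @ map (\<lambda>t. (i, j + 1 + t)) [0..<n1] @
    map (\<lambda>t. (i - Suc t, j)) [0..<n2] @ map (\<lambda>t. (i, j - Suc t)) [0..<n3]"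

lemma card_cross:
  assumes "n2 < i" "n3 < j"
  shows "card (set (cross i j n0 n1 n2 n3)) = 1 + n0 + n1 + n2 + n3"
proof -
  have "distinct (cross i j n0 n1 n2 n3)"
    using assms by (auto simp: cross_def distinct_map inj_on_def)
  from distinct_card[OF this] show ?thesis
    by (simp add: cross_def)
qed

lemma regularity_cross:
  fixes i j n0 n1 n2 n3 :: nat
  assumes n: "0 < n0" "0 < n1" "0 < n2" "0 < n3" "n2 < i" "n3 < j"
  defines "\<C> \<equiv> set (cross i j n0 n1 n2 n3)"
  shows "regularity (vertices \<C>) (adj_ideal \<C> :: (nat \<times> nat, 'k::field) mpoly set) = int (1 + n0 + n1 + n2 + n3)"
proof -
  \<comment> \<open>The corners, counterclockwise from the lower right, are the values at
    \<open>t = 0\<close> of \<open>P0, ..., P3\<close>. In each arm \<open>P\<close> continues the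
    side of the first corner of its edge and \<open>Q\<close> that of the second.\<close>
  define P0 where "P0 t = (i + 1 + t, j)" for t
  define Q0 where "Q0 t = (i + 1 + t, j + 1)" for t
  define P1 where "P1 t = (i + 1, j + 1 + t)" for t
  define Q1 where "Q1 t = (i, j + 1 + t)" for t
  define P2 where "P2 t = (i - t, j + 1)" for t
  define Q2 where "Q2 t = (i - t, j)" for t
  define P3 where "P3 t = (i, j - t)" for t
  define Q3 where "Q3 t = (i + 1, j - t)" for t
  note defs = P0_def Q0_def P1_def Q1_def P2_def Q2_def P3_def Q3_def
  have corner: "Q0 0 = P1 0" "Q1 0 = P2 0" "Q2 0 = P3 0" "Q3 0 = P0 0"
    by (simp_all add: defs)
  \<comment> \<open>Pair 0 is the edge of the central cell and pair 1 is a separate parameter of the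
    locale, so the tails begin at 2.\<close>
  let ?zs0 = "arm_pairs P0 Q0 2 n0" and ?zs1 = "arm_pairs P1 Q1 2 n1"
    and ?zs2 = "arm_pairs P2 Q2 2 n2" and ?zs3 = "arm_pairs P3 Q3 2 n3"
  have Cons: "(P0 1, Q0 1) # ?zs0 = arm_pairs P0 Q0 1 n0" "(P1 1, Q1 1) # ?zs1 = arm_pairs P1 Q1 1 n1"
    "(P2 1, Q2 1) # ?zs2 = arm_pairs P2 Q2 1 n2" "(P3 1, Q3 1) # ?zs3 = arm_pairs P3 Q3 1 n3"
    unfolding numeral_2_eq_2 One_nat_def using n by (simp_all add: arm_pairs_Cons[of "Suc 0"])
  have arms: "arms (P0 0) (P1 0) (P2 0) (P3 0) (P0 1) (Q0 1) (P1 1) (Q1 1) (P2 1) (Q2 1) (P3 1) (Q3 1) ?zs0 ?zs1 ?zs2 ?zs3"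
  proof -
    have "distinct (pvars (arm_pairs P0 Q0 1 n0))" "distinct (pvars (arm_pairs P1 Q1 1 n1))"
      "distinct (pvars (arm_pairs P2 Q2 1 n2))" "distinct (pvars (arm_pairs P3 Q3 1 n3))"
      using n by (intro distinct_pvars_arm_pairs; force simp: defs inj_on_def)+
    moreover have "distinct [P0 0, P1 0, P2 0, P3 0]"
      by (simp add: defs)
    ultimately show ?thesis
      unfolding arms_def Cons distinct_append set_append set_pvars_arm_pairs
      using n by (auto simp: defs)
  qed
  interpret arms "P0 0" "P1 0" "P2 0" "P3 0" "P0 1" "Q0 1" "P1 1" "Q1 1" "P2 1" "Q2 1" "P3 1" "Q3 1" ?zs0 ?zs1 ?zs2 ?zs3 "TYPE('k)"
    by (rule arms)
  let ?cb = "cell_binomial :: cell \<Rightarrow> (nat \<times> nat, 'k) mpoly"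
  have "insert f0 tail0 = (\<lambda>t. ?cb (i + 1 + t, j)) ` {..<n0}"
    unfolding trans[OF chain_eqs(1)[unfolded Cons, symmetric] set_chain_arm_pairs[of P0 Q0 n0, unfolded corner]]
    by (rule image_cong) (auto simp: defs mult.commute)
  moreover have "insert f1 tail1 = (\<lambda>t. - ?cb (i, j + 1 + t)) ` {..<n1}"
    unfolding trans[OF chain_eqs(2)[unfolded Cons, symmetric] set_chain_arm_pairs[of P1 Q1 n1, unfolded corner]]
    by (rule image_cong) (auto simp: defs mult.commute)
  moreover have "insert f2 tail2 = (\<lambda>t. ?cb (i - Suc t, j)) ` {..<n2}"
    unfolding trans[OF chain_eqs(3)[unfolded Cons, symmetric] set_chain_arm_pairs[of P2 Q2 n2, unfolded corner]]
    using n by (intro image_cong) (auto simp: defs Suc_diff_Suc mult.commute)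
  moreover have "insert f3 tail3 = (\<lambda>t. - ?cb (i, j - Suc t)) ` {..<n3}"
    unfolding trans[OF chain_eqs(4)[unfolded Cons, symmetric] set_chain_arm_pairs[of P3 Q3 n3, unfolded corner]]
    using n by (intro image_cong) (auto simp: defs Suc_diff_Suc mult.commute)
  ultimately have chains:
    "insert f0 tail0 = (\<lambda>t. ?cb (i + 1 + t, j)) ` {..<n0}" "insert f1 tail1 = (\<lambda>t. - ?cb (i, j + 1 + t)) ` {..<n1}"
    "insert f2 tail2 = (\<lambda>t. ?cb (i - Suc t, j)) ` {..<n2}" "insert f3 tail3 = (\<lambda>t. - ?cb (i, j - Suc t)) ` {..<n3}"
    by blast+
  have center: "center = ?cb (i, j)"
    unfolding center_def by (simp add: defs mult.commute)
  have cells: "set (cross i j n0 n1 n2 n3) = insert (i, j) ((\<lambda>t. (i + 1 + t, j)) ` {..<n0} \<union> (\<lambda>t. (i, j + 1 + t)) ` {..<n1} \<union>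
      (\<lambda>t. (i - Suc t, j)) ` {..<n2} \<union> (\<lambda>t. (i, j - Suc t)) ` {..<n3})"
    by (auto simp: cross_def)
  \<comment> \<open>The orientation of the two vertical arms produces the cell binomials with a
    minus sign.\<close>
  have gens: "ispan gens = ispan (?cb ` \<C>)"
    unfolding gens_def J_arms chains center \<C>_def cells
    by (rule ispan_eq_up_to_sign) (auto simp del: cell_binomial.simps)
  have V: "{P0 0, P1 0, P2 0, P3 0} \<union> set (pvars ((P0 1, Q0 1) # ?zs0)) \<union> set (pvars ((P1 1, Q1 1) # ?zs1)) \<union>
      set (pvars ((P2 1, Q2 1) # ?zs2)) \<union> set (pvars ((P3 1, Q3 1) # ?zs3)) \<subseteq> vertices \<C>"
  proof -
    have vert: "v \<in> vertices \<C>" if "c \<in> \<C>" "v \<in> cell_vertices c" for v c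
      using that by (auto simp: vertices_def)
    have arm: "set (pvars (arm_pairs P Q 1 n)) \<subseteq> vertices \<C>"
      if "\<And>t. t < n \<Longrightarrow> {P (Suc t), Q (Suc t)} \<subseteq> vertices \<C>" for P Q n
      using that unfolding set_pvars_arm_pairs image_Suc_lessThan[symmetric] by blast
    have "{P0 (Suc t), Q0 (Suc t)} \<subseteq> vertices \<C>" if "t < n0" for t
      using that vert[of "(i + 1 + t, j)"] by (auto simp: \<C>_def cells defs)
    moreover have "{P1 (Suc t), Q1 (Suc t)} \<subseteq> vertices \<C>" if "t < n1" for t
      using that vert[of "(i, j + 1 + t)"] by (auto simp: \<C>_def cells defs)
    moreover have "{P2 (Suc t), Q2 (Suc t)} \<subseteq> vertices \<C>" if "t < n2" for t
      using that vert[of "(i - Suc t, j)"] by (auto simp: \<C>_def cells defs)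
    moreover have "{P3 (Suc t), Q3 (Suc t)} \<subseteq> vertices \<C>" if "t < n3" for t
      using that vert[of "(i, j - Suc t)"] by (auto simp: \<C>_def cells defs)
    moreover have "{P0 0, P1 0, P2 0, P3 0} \<subseteq> vertices \<C>"
      using vert[of "(i, j)"] by (auto simp: \<C>_def cells defs)
    ultimately show ?thesis
      unfolding Cons by (intro Un_least arm)
  qed
  have R: "?cb ` \<C> \<subseteq> R (vertices \<C>)"
  proof
    fix p assume "p \<in> ?cb ` \<C>"
    then obtain a b where ab: "(a, b) \<in> \<C>" "p = ?cb (a, b)" by auto
    have "cell_vertices (a, b) \<subseteq> vertices \<C>"
      unfolding vertices_def using ab(1) by blast
    then show "p \<in> R (vertices \<C>)"
      unfolding ab(2) by (auto intro!: R_diff R_mult R_Var)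
  qed
  have adj: "adj_ideal \<C> = ideal_on (vertices \<C>) gens"
    unfolding adj_ideal_def genideal_poly_ring[OF R] ideal_on_def gens ..
  have "resolvable (vertices \<C>) (ideal_on (vertices \<C>) gens)
      (4 + int (length ?zs0 + length ?zs1 + length ?zs2 + length ?zs3))"
    by (rule resolvable_arms[OF arms V])
  \<comment> \<open>Each tail has one entry fewer than its arm has cells; the four missing ones are
    the 4 of the base case.\<close>
  moreover have "4 + int (length ?zs0 + length ?zs1 + length ?zs2 + length ?zs3) = int (n0 + n1 + n2 + n3)"
    using n by auto
  ultimately have "resolvable (vertices \<C>) (ideal_on (vertices \<C>) gens) (int (n0 + n1 + n2 + n3))"
    by (simp only:)
  then obtain G where G: "resolves (vertices \<C>) (ideal_on (vertices \<C>) gens) G"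
      "has_regularity G (int (n0 + n1 + n2 + n3))"
    unfolding resolvable_def by blast
  have "const_coeff p = 0" if "p \<in> ideal_on (vertices \<C>) gens" for p
  proof (rule const_coeff_ispan)
    show "p \<in> ispan (?cb ` \<C>)"
      using that unfolding ideal_on_def gens by blast
    show "const_coeff g = 0" if "g \<in> ?cb ` \<C>" for g
      using that const_coeff_homogeneous[OF homogeneous_minor] by fastforce
  qed
  then have "regularity (vertices \<C>) (ideal_on (vertices \<C>) gens) = int (n0 + n1 + n2 + n3) + 1"
    using G n by (intro regularity_has_regularity) (auto simp: ideal_on_def)
  then show ?thesis
    by (simp add: adj)
qed

lemma generalized_X_pentomino_cross:
  assumes "generalized_X_pentomino \<C>"
  obtains i j n0 n1 n2 n3 where "0 < n0" "0 < n1" "0 < n2" "0 < n3" "n2 < i" "n3 < j"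
    "\<C> = set (cross i j n0 n1 n2 n3)"
proof -
  obtain p q j p' q' i where C: "\<C> = {(x, j) |x. p \<le> x \<and> x < q} \<union> {(i, y) |y. p' \<le> y \<and> y < q'}"
    and pq: "1 \<le> p" "1 \<le> p'"
    using assms unfolding generalized_X_pentomino_def row_of_cells_def column_of_cells_def by blast
  obtain a b where ab: "1 < a" "1 < b" "{(a, b), (a - 1, b), (a + 1, b), (a, b - 1), (a, b + 1)} \<subseteq> \<C>"
    using assms unfolding generalized_X_pentomino_def X_pentomino_def by auto
  \<comment> \<open>The two horizontal neighbours of \<open>(a, b)\<close> cannot both lie in the
    column of cells, which forces \<open>b = j\<close>; the vertical ones force
    \<open>a = i\<close>.\<close>
  have "b = j" "a = i"
    using ab unfolding C by auto
  then have bounds: "p < i" "i + 1 < q" "p' < j" "j + 1 < q'"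
    using ab unfolding C by auto
  show thesis
  proof (rule that[of "q - 1 - i" "q' - 1 - j" "i - p" "j - p'" i j])
    show "\<C> = set (cross i j (q - 1 - i) (q' - 1 - j) (i - p) (j - p'))"
    proof (intro equalityI subsetI)
      fix z assume "z \<in> \<C>"
      then consider x where "z = (x, j)" "p \<le> x" "x < q" | y where "z = (i, y)" "p' \<le> y" "y < q'"
        unfolding C by auto
      then show "z \<in> set (cross i j (q - 1 - i) (q' - 1 - j) (i - p) (j - p'))"
      proof cases
        case (1 x)
        consider "x = i" | "i < x" | "x < i" by linarith
        then show ?thesis
        proof cases
          case 2
          then have "z \<in> (\<lambda>t. (i + 1 + t, j)) ` {..<q - 1 - i}"
            using 1 by (intro image_eqI[of _ _ "x - i - 1"]) auto
          then show ?thesis by (simp add: cross_def lessThan_atLeast0)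
        next
          case 3
          then have "z \<in> (\<lambda>t. (i - Suc t, j)) ` {..<i - p}"
            using 1 by (intro image_eqI[of _ _ "i - x - 1"]) auto
          then show ?thesis by (simp add: cross_def lessThan_atLeast0)
        qed (simp add: 1 cross_def)
      next
        case (2 y)
        consider "y = j" | "j < y" | "y < j" by linarith
        then show ?thesis
        proof cases
          case 2
          then have "z \<in> (\<lambda>t. (i, j + 1 + t)) ` {..<q' - 1 - j}"
            using \<open>z = (i, y)\<close> \<open>y < q'\<close> by (intro image_eqI[of _ _ "y - j - 1"]) auto
          then show ?thesis by (simp add: cross_def lessThan_atLeast0)
        next
          case 3
          then have "z \<in> (\<lambda>t. (i, j - Suc t)) ` {..<j - p'}"
            using \<open>z = (i, y)\<close> \<open>p' \<le> y\<close> by (intro image_eqI[of _ _ "j - y - 1"]) auto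
          then show ?thesis by (simp add: cross_def lessThan_atLeast0)
        qed (simp add: 2 cross_def)
      qed
    next
      fix z assume "z \<in> set (cross i j (q - 1 - i) (q' - 1 - j) (i - p) (j - p'))"
      then show "z \<in> \<C>"
        using bounds unfolding C cross_def by auto
    qed
  qed (use bounds pq in auto)
qed

theorem theorem1p6:
  fixes \<C> :: "cell set"
  assumes "generalized_X_pentomino \<C>"
  shows "regularity (vertices \<C>) (adj_ideal \<C> :: (nat \<times> nat, 'k::field) mpoly set) = int (card \<C>)"
proof -
  obtain i j n0 n1 n2 n3 where n: "0 < n0" "0 < n1" "0 < n2" "0 < n3" "n2 < i" "n3 < j"
    and C: "\<C> = set (cross i j n0 n1 n2 n3)"
    using assms by (rule generalized_X_pentomino_cross)
  show ?thesis
    unfolding C regularity_cross[OF n] card_cross[OF n(5,6)] ..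
qed

end
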